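(* Let $\mathcal A$ be a deterministic extended 1-clock PTA and $v$ a parameter valuation. The set of parameter valuations $v'$ such that $\mathrm{Traces}(v'(\mathcal A))=\mathrm{Traces}(v(\mathcal A))$ is computable (as a finite union/intersection of linear constraints on the parameters) in time proportional to $|L|\times 2^{|LT|(|LT|+1)}$, where $|L|$ is the number of locations and $|LT|$ the number of distinct parametric linear terms in the guards and invariants of $\mathcal A$.
   Context: An extended 1-clock PTA is a PTA $(\Sigma,L,\ell_0,\{x\},P,I,E)$ with a single real-valued clock $x$, finitely many parameters $P$ (nonnegative rationals), and whose guards and invariants are conjunctions of constraints $x\sim\sum_i\alpha_ip_i+c$ ($p_i\in P$, $\alpha_i,c\in\mathbb Z$); edges $(\ell,g,a,R,\ell')$ with guard, action, reset set. It is deterministic if for every location $\ell$ and action $a$ there is at most one edge with source $\ell$ labelled $a$. For a parameter valuation $v$, $v(\mathcal A)$ is the timed automaton obtained by substituting parameter values, with steps $(\ell,w)\xrightarrow{d,e}(\ell',w')$ for delay $d\ge0$ when $w+d$ satisfies the guard and $w'=(w+d)[R\mapsto0]$ (configurations satisfy invariants). A run is a maximal step sequence $s_0\xrightarrow{d_0,e_0}s_1\cdots$ from $(\ell_0,0)$; its untimed trace is $(\ell_i,a_i)_i$; $\mathrm{Traces}(v(\mathcal A))$ is the set of untimed traces of runs.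
   Formalization: The time bound proved is a constant times (|Σ|+1)(|P|+1)·|L|·2^{|LT|(|LT|+1)} on a unit-cost machine; the factors in the numbers of actions and parameters are added because merely reading the edges and coefficients requires them. *)

theory Defs
  imports Complex_Main "HOL-Library.FuncSet" "HOL-Library.Extended_Nat"
begin

subsection \<open>One-clock timed automata with guard bounds of an arbitrary type\<close>

datatype rel = Lt | Le | Eq | Ge | Gt

fun rel_holds :: "rel \<Rightarrow> 'a::linorder \<Rightarrow> 'a \<Rightarrow> bool" where
  "rel_holds Lt x y = (x < y)"
| "rel_holds Le x y = (x \<le> y)"
| "rel_holds Eq x y = (x = y)"
| "rel_holds Ge x y = (x \<ge> y)"
| "rel_holds Gt x y = (x > y)"

text \<open>A pair \<open>(r, b)\<close> is the constraint \<open>x r b\<close> on the unique clock \<open>x\<close>; a set of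
  such pairs is their conjunction.  Since there is only one clock, the reset set of an edge is
  either empty or \<open>{x}\<close>, and is given by a Boolean.  Actions, locations and parameters are
  named by natural numbers.\<close>

type_synonym 'b guard = "(rel \<times> 'b) set"

record 'b edge =
  src :: nat
  guard :: "'b guard"
  act :: nat
  resets :: bool
  tgt :: nat

record 'b automaton =
  actions :: "nat set"
  locs :: "nat set"
  init :: nat
  invar :: "nat \<Rightarrow> 'b guard"
  edges :: "'b edge set"

definition sat_guard :: "rat guard \<Rightarrow> real \<Rightarrow> bool" where
  "sat_guard g w \<longleftrightarrow> (\<forall>(r, b) \<in> g. rel_holds r w (of_rat b))"

subsection \<open>Extended one-clock parametric timed automata\<close>

text \<open>The pair \<open>(\<alpha>, c)\<close> is the linear term \<open>\<Sum>\<^sub>p \<alpha> p * p + c\<close>.\<close>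

type_synonym lterm = "(nat \<Rightarrow> int) \<times> int"
type_synonym valuation = "nat \<Rightarrow> rat"

record pta = "lterm automaton" +
  params :: "nat set"

text \<open>Coefficients vanish outside the parameter set, so that distinct terms are distinct pairs.\<close>

definition term_over :: "nat set \<Rightarrow> lterm \<Rightarrow> bool" where
  "term_over P t \<longleftrightarrow> (\<forall>p. p \<notin> P \<longrightarrow> fst t p = 0)"

definition guard_over :: "nat set \<Rightarrow> lterm guard \<Rightarrow> bool" where
  "guard_over P g \<longleftrightarrow> finite g \<and> (\<forall>(r, t) \<in> g. term_over P t)"

definition wf_pta :: "pta \<Rightarrow> bool" where
  "wf_pta A \<longleftrightarrow>
     finite (actions A) \<and> finite (locs A) \<and> finite (params A) \<and> finite (edges A) \<and>
     init A \<in> locs A \<and>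
     (\<forall>l \<in> locs A. guard_over (params A) (invar A l)) \<and>
     (\<forall>e \<in> edges A. src e \<in> locs A \<and> tgt e \<in> locs A \<and> act e \<in> actions A \<and>
        guard_over (params A) (guard e))"

definition deterministic :: "pta \<Rightarrow> bool" where
  "deterministic A \<longleftrightarrow>
     (\<forall>e \<in> edges A. \<forall>e' \<in> edges A. src e = src e' \<and> act e = act e' \<longrightarrow> e = e')"

definition LT :: "pta \<Rightarrow> lterm set" where
  "LT A = snd ` ((\<Union>l \<in> locs A. invar A l) \<union> (\<Union>e \<in> edges A. guard e))"

definition valuations :: "nat set \<Rightarrow> valuation set" where
  "valuations P = P \<rightarrow>\<^sub>E {q. 0 \<le> q}"

definition term_val :: "nat set \<Rightarrow> valuation \<Rightarrow> lterm \<Rightarrow> rat" where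
  "term_val P v t = (\<Sum>p \<in> P. of_int (fst t p) * v p) + of_int (snd t)"

definition inst_guard :: "nat set \<Rightarrow> valuation \<Rightarrow> lterm guard \<Rightarrow> rat guard" where
  "inst_guard P v g = (\<lambda>(r, t). (r, term_val P v t)) ` g"

definition inst_edge :: "nat set \<Rightarrow> valuation \<Rightarrow> lterm edge \<Rightarrow> rat edge" where
  "inst_edge P v e =
     \<lparr> src = src e, guard = inst_guard P v (guard e), act = act e,
       resets = resets e, tgt = tgt e \<rparr>"

text \<open>The timed automaton \<open>v(A)\<close>.\<close>

definition inst :: "valuation \<Rightarrow> pta \<Rightarrow> rat automaton" where
  "inst v A =
     \<lparr> actions = actions A, locs = locs A, init = init A,
       invar = (\<lambda>l. inst_guard (params A) v (invar A l)),
       edges = inst_edge (params A) v ` edges A \<rparr>"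

subsection \<open>Runs and untimed traces\<close>

type_synonym config = "nat \<times> real"

definition is_config :: "rat automaton \<Rightarrow> config \<Rightarrow> bool" where
  "is_config B s \<longleftrightarrow> fst s \<in> locs B \<and> 0 \<le> snd s \<and> sat_guard (invar B (fst s)) (snd s)"

fun step :: "rat automaton \<Rightarrow> config \<Rightarrow> real \<Rightarrow> rat edge \<Rightarrow> config \<Rightarrow> bool" where
  "step B (l, w) d e (l', w') \<longleftrightarrow>
     0 \<le> d \<and> (\<forall>d' \<in> {0..d}. is_config B (l, w + d')) \<and>
     e \<in> edges B \<and> src e = l \<and> tgt e = l' \<and> sat_guard (guard e) (w + d) \<and>
     w' = (if resets e then 0 else w + d) \<and> is_config B (l', w')"

text \<open>A run of length \<open>N\<close> (possibly infinite) uses the configurations \<open>s i\<close> for \<open>i \<le> N\<close>, and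
  the delays \<open>d i\<close> and edges \<open>e i\<close> for \<open>i < N\<close>.\<close>

definition is_run ::
  "rat automaton \<Rightarrow> enat \<Rightarrow> (nat \<Rightarrow> config) \<Rightarrow> (nat \<Rightarrow> real) \<Rightarrow> (nat \<Rightarrow> rat edge) \<Rightarrow> bool" where
  "is_run B N s d e \<longleftrightarrow>
     s 0 = (init B, 0) \<and> is_config B (s 0) \<and>
     (\<forall>i. enat i < N \<longrightarrow> step B (s i) (d i) (e i) (s (Suc i))) \<and>
     (\<forall>n. N = enat n \<longrightarrow> (\<nexists>d' e' s'. step B (s n) d' e' s'))"

datatype trace = Fin "(nat \<times> nat) list" | Inf "nat \<Rightarrow> nat \<times> nat"

fun untimed :: "enat \<Rightarrow> (nat \<Rightarrow> config) \<Rightarrow> (nat \<Rightarrow> rat edge) \<Rightarrow> trace" where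
  "untimed (enat n) s e = Fin (map (\<lambda>i. (fst (s i), act (e i))) [0..<n])"
| "untimed \<infinity> s e = Inf (\<lambda>i. (fst (s i), act (e i)))"

definition Traces :: "rat automaton \<Rightarrow> trace set" where
  "Traces B = {untimed N s e | N s d e. is_run B N s d e}"

subsection \<open>Finite unions of finite intersections of linear constraints\<close>

text \<open>Here \<open>(r, t)\<close> is the constraint \<open>t r 0\<close> on the parameters; the outer list is a
  disjunction, the inner ones are conjunctions.\<close>

type_synonym lformula = "(rel \<times> lterm) list list"

definition formula_over :: "nat set \<Rightarrow> lformula \<Rightarrow> bool" where
  "formula_over P F \<longleftrightarrow> (\<forall>C \<in> set F. \<forall>(r, t) \<in> set C. term_over P t)"

definition solutions :: "nat set \<Rightarrow> lformula \<Rightarrow> valuation set" where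
  "solutions P F =
     {v \<in> valuations P. \<exists>C \<in> set F. \<forall>(r, t) \<in> set C. rel_holds r (term_val P v t) 0}"

subsection \<open>Model of computation: a unit-cost random access machine\<close>

text \<open>While-programs over finitely many integer arrays (those named in the program), with
  indirect addressing.  Every executed assignment and every evaluated test costs one time unit;
  as the size of the expressions occurring in a fixed program is bounded, charging each
  arithmetic operation or memory access separately changes times by a constant factor only.\<close>

datatype aexp =
    Num int
  | Read string aexp
  | Plus aexp aexp
  | Minus aexp aexp
  | Times aexp aexp

datatype bexp = Less aexp aexp | Not bexp | And bexp bexp

datatype com =
    Skip
  | Assign string aexp aexp  \<comment> \<open>\<open>a[i] := e\<close>\<close>
  | Seq com com
  | If bexp com com
  | While bexp com

type_synonym state = "string \<Rightarrow> int \<Rightarrow> int"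

fun aval :: "aexp \<Rightarrow> state \<Rightarrow> int" where
  "aval (Num k) \<sigma> = k"
| "aval (Read a i) \<sigma> = \<sigma> a (aval i \<sigma>)"
| "aval (Plus x y) \<sigma> = aval x \<sigma> + aval y \<sigma>"
| "aval (Minus x y) \<sigma> = aval x \<sigma> - aval y \<sigma>"
| "aval (Times x y) \<sigma> = aval x \<sigma> * aval y \<sigma>"

fun bval :: "bexp \<Rightarrow> state \<Rightarrow> bool" where
  "bval (Less x y) \<sigma> = (aval x \<sigma> < aval y \<sigma>)"
| "bval (Not b) \<sigma> = (\<not> bval b \<sigma>)"
| "bval (And b b') \<sigma> = (bval b \<sigma> \<and> bval b' \<sigma>)"

text \<open>\<open>exec c \<sigma> n \<sigma>'\<close>: started in \<open>\<sigma>\<close>, the program \<open>c\<close> halts in \<open>\<sigma>'\<close> after \<open>n\<close> time units.\<close>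

inductive exec :: "com \<Rightarrow> state \<Rightarrow> nat \<Rightarrow> state \<Rightarrow> bool" where
  Skip: "exec Skip \<sigma> 1 \<sigma>"
| Assign: "exec (Assign a i x) \<sigma> 1 (\<sigma>(a := (\<sigma> a)(aval i \<sigma> := aval x \<sigma>)))"
| Seq: "exec c \<sigma> m \<sigma>' \<Longrightarrow> exec c' \<sigma>' n \<sigma>'' \<Longrightarrow> exec (Seq c c') \<sigma> (m + n) \<sigma>''"
| IfTrue: "bval b \<sigma> \<Longrightarrow> exec c \<sigma> n \<sigma>' \<Longrightarrow> exec (If b c c') \<sigma> (Suc n) \<sigma>'"
| IfFalse: "\<not> bval b \<sigma> \<Longrightarrow> exec c' \<sigma> n \<sigma>' \<Longrightarrow> exec (If b c c') \<sigma> (Suc n) \<sigma>'"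
| WhileFalse: "\<not> bval b \<sigma> \<Longrightarrow> exec (While b c) \<sigma> 1 \<sigma>"
| WhileTrue: "bval b \<sigma> \<Longrightarrow> exec c \<sigma> m \<sigma>' \<Longrightarrow> exec (While b c) \<sigma>' n \<sigma>'' \<Longrightarrow>
    exec (While b c) \<sigma> (Suc (m + n)) \<sigma>''"

definition input_state :: "int list \<Rightarrow> state" where
  "input_state xs =
     (\<lambda>a i. if a = ''in'' \<and> 0 \<le> i \<and> i < int (length xs) then xs ! nat i else 0)"

definition outputs :: "state \<Rightarrow> int list \<Rightarrow> bool" where
  "outputs \<sigma> ys \<longleftrightarrow> (\<forall>i < length ys. \<sigma> ''out'' (int i) = ys ! i)"

subsection \<open>Encoding of inputs and outputs as integer sequences\<close>

definition enc_list :: "('a \<Rightarrow> int list) \<Rightarrow> 'a list \<Rightarrow> int list" where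
  "enc_list f xs = int (length xs) # concat (map f xs)"

definition enc_nats :: "nat list \<Rightarrow> int list" where
  "enc_nats = enc_list (\<lambda>k. [int k])"

fun enc_rel :: "rel \<Rightarrow> int" where
  "enc_rel Lt = 0" | "enc_rel Le = 1" | "enc_rel Eq = 2" | "enc_rel Ge = 3" | "enc_rel Gt = 4"

text \<open>Coefficients are listed in increasing order of the parameter names.\<close>

fun enc_constr :: "nat set \<Rightarrow> rel \<times> lterm \<Rightarrow> int list" where
  "enc_constr P (r, \<alpha>, c) = enc_rel r # map \<alpha> (sorted_list_of_set P) @ [c]"

definition enc_formula :: "nat set \<Rightarrow> lformula \<Rightarrow> int list" where
  "enc_formula P = enc_list (enc_list (enc_constr P))"

definition enc_valuation :: "nat set \<Rightarrow> valuation \<Rightarrow> int list" where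
  "enc_valuation P v =
     concat (map (\<lambda>p. [fst (quotient_of (v p)), snd (quotient_of (v p))]) (sorted_list_of_set P))"

definition enumerates :: "'a list \<Rightarrow> 'a set \<Rightarrow> bool" where
  "enumerates xs S \<longleftrightarrow> distinct xs \<and> set xs = S"

text \<open>Guards, invariants and the set of edges are written down without repetition, in an
  arbitrary order; so an input has several encodings.  \<open>G\<close> chooses the order inside each
  conjunction.\<close>

definition encodes :: "int list \<Rightarrow> pta \<Rightarrow> valuation \<Rightarrow> bool" where
  "encodes xs A v \<longleftrightarrow>
     (\<exists>G es. (\<forall>g. finite g \<longrightarrow> enumerates (G g) g) \<and> enumerates es (edges A) \<and>
        xs = enc_nats (sorted_list_of_set (actions A)) @
             enc_nats (sorted_list_of_set (params A)) @
             enc_list (\<lambda>l. int l # enc_list (enc_constr (params A)) (G (invar A l)))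
               (sorted_list_of_set (locs A)) @
             [int (init A)] @
             enc_list (\<lambda>e. int (src e) # enc_list (enc_constr (params A)) (G (guard e)) @
                 [int (act e), of_bool (resets e), int (tgt e)]) es @
             enc_valuation (params A) v)"

lemma encodes_exists:
  assumes "wf_pta A"
  shows "\<exists>xs. encodes xs A v"
proof -
  have "\<exists>G. \<forall>g :: lterm guard. finite g \<longrightarrow> enumerates (G g) g"
    unfolding enumerates_def using finite_distinct_list by metis
  moreover have "\<exists>es. enumerates es (edges A)"
    using assms finite_distinct_list unfolding wf_pta_def enumerates_def by metis
  ultimately show ?thesis
    unfolding encodes_def by blast
qed

end

(* The untimed traces of an instance depend only on the order type of the values of its parametric
   linear terms together with 0: on a single clock, traces are governed by intervals with such
   endpoints, and a greedy (earliest) choice of firing times decides feasibility.  Every order type is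
   realised as a ranking of the at most |LT| + 1 terms by numbers below |LT| + 1, so the solution set
   is the union, over the rankings whose traces agree with those of v, of the conjunctions that
   describe the order type.  For one ranking, equality of traces is a reachability question in the
   product of two interval automata whose states are an edge and two integer clock values; since
   both automata are deterministic over the same edges, the product has O(|E| |LT|^2) states.  There
   are at most (|LT| + 1)^(|LT| + 1) rankings, and (m + 1)^(m + 3) <= 16 * 2^(m (m + 1)) absorbs the
   polynomial cost per ranking. *)
theory Submission imports Defs begin

lemma sat_guard_convex:
  assumes "sat_guard g u" "sat_guard g w" "u \<le> x" "x \<le> w"
  shows "sat_guard g x"
  unfolding sat_guard_def
proof safe
  fix r b assume "(r, b) \<in> g"
  then have "rel_holds r u (of_rat b)" "rel_holds r w (of_rat b)"
    using assms unfolding sat_guard_def by auto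
  then show "rel_holds r x (of_rat b)"
    using assms(3,4) by (cases r) auto
qed

locale indexed_pta =
  fixes A :: pta and I :: "int set" and e0 :: int and ed :: "int \<Rightarrow> lterm edge"
  assumes wf: "wf_pta A" and det: "deterministic A"
    and bij: "bij_betw ed I (edges A)" and e0: "e0 \<notin> I"
begin

definition lsrc :: "int \<Rightarrow> nat" where "lsrc q = src (ed q)"
definition ltgt :: "int \<Rightarrow> nat" where "ltgt q = (if q = e0 then init A else tgt (ed q))"
definition rst :: "int \<Rightarrow> bool" where "rst q \<longleftrightarrow> q = e0 \<or> resets (ed q)"
definition lab :: "int \<Rightarrow> nat \<times> nat" where "lab q = (src (ed q), act (ed q))"

definition satl :: "valuation \<Rightarrow> nat \<Rightarrow> real \<Rightarrow> bool" where
  "satl v l = sat_guard (inst_guard (params A) v (invar A l))"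

definition fire :: "valuation \<Rightarrow> int \<Rightarrow> real \<Rightarrow> bool" where
  "fire v q w \<longleftrightarrow> 0 \<le> w \<and>
     (if q = e0 then satl v (init A) 0
      else satl v (lsrc q) w \<and> sat_guard (inst_guard (params A) v (guard (ed q))) w \<and>
        satl v (ltgt q) (if rst q then 0 else w))"

definition after :: "int \<Rightarrow> real \<Rightarrow> real" where "after q w = (if rst q then 0 else w)"

definition dead :: "valuation \<Rightarrow> nat \<Rightarrow> real \<Rightarrow> bool" where
  "dead v l u \<longleftrightarrow> (\<forall>q \<in> I. lsrc q = l \<longrightarrow> (\<forall>w \<ge> u. \<not> fire v q w))"

definition path :: "(nat \<Rightarrow> int) \<Rightarrow> nat \<Rightarrow> bool" where
  "path x k \<longleftrightarrow> x 0 = e0 \<and> (\<forall>j. Suc j < k \<longrightarrow> x (Suc j) \<in> I \<and> lsrc (x (Suc j)) = ltgt (x j))"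

definition timed :: "valuation \<Rightarrow> (nat \<Rightarrow> int) \<Rightarrow> (nat \<Rightarrow> real) \<Rightarrow> nat \<Rightarrow> bool" where
  "timed v x w k \<longleftrightarrow> (\<forall>j<k. fire v (x j) (w j)) \<and> (\<forall>j. Suc j < k \<longrightarrow> after (x j) (w j) \<le> w (Suc j))"

lemma lab_inj: "q \<in> I \<Longrightarrow> q' \<in> I \<Longrightarrow> lab q = lab q' \<Longrightarrow> q = q'"
  using bij det unfolding lab_def deterministic_def bij_betw_def inj_on_def by (metis imageI prod.inject)

lemma ltgt_locs: "q = e0 \<or> q \<in> I \<Longrightarrow> ltgt q \<in> locs A"
  using wf bij unfolding ltgt_def wf_pta_def bij_betw_def by auto

lemma is_config_inst:
  "is_config (inst v A) (l, u) \<longleftrightarrow> l \<in> locs A \<and> 0 \<le> u \<and> satl v l u"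
  unfolding is_config_def inst_def satl_def by simp

lemma step_inst:
  assumes "is_config (inst v A) (l, u)"
  shows "step (inst v A) (l, u) d e s' \<longleftrightarrow>
    (\<exists>q \<in> I. e = inst_edge (params A) v (ed q) \<and> lsrc q = l \<and> 0 \<le> d \<and> fire v q (u + d) \<and>
      s' = (ltgt q, after q (u + d)))"
    (is "?L \<longleftrightarrow> ?R")
proof
  assume L: ?L
  obtain l' w' where s': "s' = (l', w')" by fastforce
  from L have "e \<in> inst_edge (params A) v ` ed ` I"
    unfolding s' using bij by (simp add: inst_def bij_betw_def)
  then obtain q where q: "q \<in> I" "e = inst_edge (params A) v (ed q)" by blast
  from q(1) e0 have ne: "q \<noteq> e0" by auto
  have "is_config (inst v A) (l, u + d)" using L unfolding s' by auto
  then show ?R using L q ne assms unfolding s' is_config_inst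
    by (intro bexI[of _ q])
       (auto simp: inst_edge_def lsrc_def ltgt_def rst_def after_def fire_def is_config_inst satl_def)
next
  assume ?R
  then obtain q where q: "q \<in> I" "e = inst_edge (params A) v (ed q)" "lsrc q = l" "0 \<le> d"
    "fire v q (u + d)" "s' = (ltgt q, after q (u + d))" by blast
  from q(1) e0 have ne: "q \<noteq> e0" by auto
  have c: "is_config (inst v A) (l, u + d')" if "d' \<in> {0..d}" for d'
    using assms q(3,5) ne that unfolding is_config_inst fire_def satl_def
    by (auto intro: sat_guard_convex[of _ u "u + d"])
  have "e \<in> edges (inst v A)" using q bij by (auto simp: inst_def bij_betw_def)
  then show ?L using q ne c ltgt_locs[of q] assms
    by (auto simp: inst_edge_def lsrc_def ltgt_def rst_def after_def fire_def is_config_inst satl_def)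
qed

lemma run_of_timed:
  assumes p: "\<And>j. enat j \<le> N \<Longrightarrow> path x (Suc j) \<and> timed v x w (Suc j)"
    and fin: "\<And>k. N = enat k \<Longrightarrow> dead v (ltgt (x k)) (after (x k) (w k))"
  shows "untimed N (\<lambda>j. (ltgt (x j), after (x j) (w j))) (\<lambda>j. inst_edge (params A) v (ed (x (Suc j))))
     \<in> Traces (inst v A)"
proof -
  let ?s = "\<lambda>j. (ltgt (x j), after (x j) (w j))"
  have p0: "x 0 = e0" using p[of 0] by (auto simp: path_def zero_enat_def[symmetric])
  have cfg: "is_config (inst v A) (?s j)" if "enat j \<le> N" for j
  proof -
    have "x j = e0 \<or> x j \<in> I" using p[OF that] unfolding path_def by (cases j) auto
    moreover have "fire v (x j) (w j)" using p[OF that] unfolding timed_def by auto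
    ultimately show ?thesis
      using ltgt_locs[of "x j"] unfolding is_config_inst fire_def after_def
      by (auto simp: rst_def ltgt_def)
  qed
  have st: "step (inst v A) (?s j) (w (Suc j) - after (x j) (w j))
      (inst_edge (params A) v (ed (x (Suc j)))) (?s (Suc j))" if "enat j < N" for j
  proof -
    have le: "enat (Suc j) \<le> N" using that by (simp add: Suc_ile_eq)
    show ?thesis
      using p[OF le] cfg[of j] that by (subst step_inst) (auto simp: path_def timed_def)
  qed
  have "is_run (inst v A) N ?s (\<lambda>j. w (Suc j) - after (x j) (w j))
      (\<lambda>j. inst_edge (params A) v (ed (x (Suc j))))"
    unfolding is_run_def
  proof (intro conjI allI impI)
    show "?s 0 = (init (inst v A), 0)" using p0 by (simp add: ltgt_def after_def rst_def inst_def)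
    show "is_config (inst v A) (?s 0)" by (rule cfg) (simp add: zero_enat_def[symmetric])
    show "step (inst v A) (?s j) (w (Suc j) - after (x j) (w j))
      (inst_edge (params A) v (ed (x (Suc j)))) (?s (Suc j))" if "enat j < N" for j
      by (rule st[OF that])
    fix n assume N: "N = enat n"
    show "\<nexists>d' e' s'. step (inst v A) (?s n) d' e' s'"
    proof safe
      fix d' e' l' w'
      assume "step (inst v A) (?s n) d' e' (l', w')"
      then show False
        using fin[OF N] unfolding step_inst[OF cfg[of n, unfolded N, OF order_refl]] dead_def by force
    qed
  qed
  then show ?thesis unfolding Traces_def by blast
qed

lemma timed_of_run:
  assumes "is_run (inst v A) N s d e"
  obtains x w where
    "\<And>j. enat j \<le> N \<Longrightarrow> path x (Suc j) \<and> timed v x w (Suc j) \<and> s j = (ltgt (x j), after (x j) (w j))"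
    "\<And>j. enat j < N \<Longrightarrow> e j = inst_edge (params A) v (ed (x (Suc j)))"
    "\<And>k. N = enat k \<Longrightarrow> dead v (ltgt (x k)) (after (x k) (w k))"
proof -
  define ix where "ix j = (SOME q. q \<in> I \<and> e j = inst_edge (params A) v (ed q) \<and> lsrc q = fst (s j) \<and>
     0 \<le> d j \<and> fire v q (snd (s j) + d j) \<and> s (Suc j) = (ltgt q, after q (snd (s j) + d j)))" for j
  define x where "x = case_nat e0 ix"
  define w where "w = case_nat 0 (\<lambda>j. snd (s j) + d j)"
  have init: "s 0 = (init A, 0)" "is_config (inst v A) (s 0)"
    and st: "\<And>j. enat j < N \<Longrightarrow> step (inst v A) (s j) (d j) (e j) (s (Suc j))"
    and fin: "\<And>n. N = enat n \<Longrightarrow> \<nexists>d' e' s'. step (inst v A) (s n) d' e' s'"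
    using assms unfolding is_run_def by (auto simp: inst_def)
  have cfg: "is_config (inst v A) (s j)" if "enat j \<le> N" for j
  proof (cases j)
    case (Suc i)
    then have "enat i < N" using that Suc_ile_eq by blast
    from st[OF this] show ?thesis unfolding Suc by (cases "s i"; cases "s (Suc i)") auto
  qed (use init in simp)
  have ix: "ix j \<in> I \<and> e j = inst_edge (params A) v (ed (ix j)) \<and> lsrc (ix j) = fst (s j) \<and>
     0 \<le> d j \<and> fire v (ix j) (snd (s j) + d j) \<and>
     s (Suc j) = (ltgt (ix j), after (ix j) (snd (s j) + d j))" if "enat j < N" for j
  proof -
    obtain l u where s: "s j = (l, u)" by fastforce
    have "is_config (inst v A) (l, u)" using cfg[of j] that s by auto
    from st[OF that, unfolded s step_inst[OF this]]
    have "\<exists>q. q \<in> I \<and> e j = inst_edge (params A) v (ed q) \<and> lsrc q = fst (s j) \<and>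
     0 \<le> d j \<and> fire v q (snd (s j) + d j) \<and> s (Suc j) = (ltgt q, after q (snd (s j) + d j))"
      unfolding s fst_conv snd_conv by blast
    from someI_ex[OF this] show ?thesis unfolding ix_def .
  qed
  have sj: "s j = (ltgt (x j), after (x j) (w j))" if "enat j \<le> N" for j
  proof (cases j)
    case 0 then show ?thesis using init by (simp add: x_def w_def ltgt_def after_def rst_def)
  next
    case (Suc i)
    then have "enat i < N" using that Suc_ile_eq by blast
    from ix[OF this] show ?thesis unfolding Suc by (simp add: x_def w_def)
  qed
  have path: "path x (Suc j)" if "enat j \<le> N" for j
    unfolding path_def
  proof (intro conjI allI impI)
    fix i assume "Suc i < Suc j"
    with that have i: "enat i < N" by (meson Suc_less_eq enat_ord_simps(2) order_less_le_trans)
    from ix[OF i] sj[OF less_imp_le[OF i]]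
    show "x (Suc i) \<in> I" "lsrc (x (Suc i)) = ltgt (x i)" by (auto simp: x_def)
  qed (simp add: x_def)
  have timed: "timed v x w (Suc j)" if "enat j \<le> N" for j
    unfolding timed_def
  proof (intro conjI allI impI)
    fix i assume "i < Suc j"
    with that have i: "enat i \<le> N" by (meson enat_ord_simps(1) less_Suc_eq_le order_trans)
    show "fire v (x i) (w i)"
    proof (cases i)
      case 0 then show ?thesis using init by (simp add: x_def w_def fire_def is_config_inst)
    next
      case (Suc k)
      then have "enat k < N" using i Suc_ile_eq by blast
      from ix[OF this] show ?thesis unfolding Suc by (simp add: x_def w_def)
    qed
  next
    fix i assume "Suc i < Suc j"
    with that have i: "enat i < N" by (meson Suc_less_eq enat_ord_simps(2) order_less_le_trans)
    from ix[OF i] sj[OF less_imp_le[OF i]] show "after (x i) (w i) \<le> w (Suc i)" by (auto simp: w_def)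
  qed
  have "dead v (ltgt (x k)) (after (x k) (w k))" if "N = enat k" for k
  proof (rule ccontr)
    assume "\<not> ?thesis"
    then obtain q u where q: "q \<in> I" "lsrc q = ltgt (x k)" "u \<ge> after (x k) (w k)" "fire v q u"
      unfolding dead_def by auto
    have "step (inst v A) (s k) (u - after (x k) (w k)) (inst_edge (params A) v (ed q)) (ltgt q, after q u)"
      using q cfg[of k] sj[of k] that by (simp add: step_inst del: step.simps) (auto intro!: exI[of _ q])
    with fin[OF that] show False by blast
  qed
  moreover have "e j = inst_edge (params A) v (ed (x (Suc j)))" if "enat j < N" for j
    using ix[OF that] by (simp add: x_def)
  ultimately show ?thesis
    using path timed sj by (intro that[of x w]) blast+
qed

lemma Fin_in_Traces:
  "Fin tr \<in> Traces (inst v A) \<longleftrightarrow> (\<exists>x w k. path x (Suc k) \<and> timed v x w (Suc k) \<and>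
     dead v (ltgt (x k)) (after (x k) (w k)) \<and> tr = map (\<lambda>j. lab (x (Suc j))) [0..<k])"
    (is "?L \<longleftrightarrow> ?R")
proof
  assume ?L
  then obtain N s d e where r: "is_run (inst v A) N s d e" "Fin tr = untimed N s e"
    unfolding Traces_def by auto
  then obtain k where N: "N = enat k" by (cases N) auto
  obtain x w where xw: "\<And>j. enat j \<le> N \<Longrightarrow> path x (Suc j) \<and> timed v x w (Suc j) \<and> s j = (ltgt (x j), after (x j) (w j))"
    "\<And>j. enat j < N \<Longrightarrow> e j = inst_edge (params A) v (ed (x (Suc j)))"
    "\<And>k. N = enat k \<Longrightarrow> dead v (ltgt (x k)) (after (x k) (w k))"
    using timed_of_run[OF r(1)] by metis
  have pk: "path x (Suc k)" using xw(1)[of k] N by simp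
  have "tr = map (\<lambda>j. lab (x (Suc j))) [0..<k]"
    using r(2) xw(1,2) pk unfolding N by (auto simp: lab_def inst_edge_def path_def lsrc_def)
  then show ?R using xw(1)[of k] xw(3) N by auto
next
  assume ?R
  then obtain x w k where xw: "path x (Suc k)" "timed v x w (Suc k)"
    "dead v (ltgt (x k)) (after (x k) (w k))" "tr = map (\<lambda>j. lab (x (Suc j))) [0..<k]" by blast
  have "Fin tr = untimed (enat k) (\<lambda>j. (ltgt (x j), after (x j) (w j))) (\<lambda>j. inst_edge (params A) v (ed (x (Suc j))))"
    using xw by (auto simp: lab_def inst_edge_def path_def lsrc_def)
  also have "\<dots> \<in> Traces (inst v A)"
    using xw by (intro run_of_timed) (auto simp: path_def timed_def)
  finally show ?L .
qed

lemma Inf_in_Traces: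
  "Inf tr \<in> Traces (inst v A) \<longleftrightarrow> (\<exists>x w. (\<forall>k. path x k \<and> timed v x w k) \<and> tr = (\<lambda>j. lab (x (Suc j))))"
    (is "?L \<longleftrightarrow> ?R")
proof
  assume ?L
  then obtain N s d e where r: "is_run (inst v A) N s d e" "Inf tr = untimed N s e"
    unfolding Traces_def by auto
  then have N: "N = \<infinity>" by (cases N) auto
  obtain x w where xw: "\<And>j. enat j \<le> N \<Longrightarrow> path x (Suc j) \<and> timed v x w (Suc j) \<and> s j = (ltgt (x j), after (x j) (w j))"
    "\<And>j. enat j < N \<Longrightarrow> e j = inst_edge (params A) v (ed (x (Suc j)))"
    using timed_of_run[OF r(1)] by metis
  have "path x k \<and> timed v x w k" for k
    using xw(1)[of k] N by (auto simp: path_def timed_def)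
  moreover have "tr j = lab (x (Suc j))" for j
    using r(2) xw(1)[of "Suc j"] xw(1)[of j] xw(2)[of j] N
    by (auto simp: lab_def inst_edge_def path_def lsrc_def)
  ultimately show ?R by blast
next
  assume ?R
  then obtain x w where xw: "\<And>k. path x k" "\<And>k. timed v x w k" "tr = (\<lambda>j. lab (x (Suc j)))" by blast
  have "Inf tr = untimed \<infinity> (\<lambda>j. (ltgt (x j), after (x j) (w j))) (\<lambda>j. inst_edge (params A) v (ed (x (Suc j))))"
    using xw(1) unfolding xw(3) by (auto simp: lab_def inst_edge_def path_def lsrc_def)
  also have "\<dots> \<in> Traces (inst v A)"
    using xw by (intro run_of_timed) auto
  finally show ?L .
qed

end

context indexed_pta
begin

definition low :: "(int \<Rightarrow> int) \<Rightarrow> int \<Rightarrow> (nat \<Rightarrow> int) \<Rightarrow> nat \<Rightarrow> int" where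
  "low lo b x = rec_nat b (\<lambda>j i. if rst (x j) then b else max i (lo (x j)))"

lemma low_simps [simp]:
  "low lo b x 0 = b"
  "low lo b x (Suc j) = (if rst (x j) then b else max (low lo b x j) (lo (x j)))"
  by (simp_all add: low_def)

definition enabled :: "(int \<Rightarrow> int) \<Rightarrow> (int \<Rightarrow> int) \<Rightarrow> int \<Rightarrow> int \<Rightarrow> bool" where
  "enabled lo hi q i \<longleftrightarrow> max i (lo q) \<le> hi q"

definition greedy :: "(int \<Rightarrow> int) \<Rightarrow> (int \<Rightarrow> int) \<Rightarrow> int \<Rightarrow> (nat \<Rightarrow> int) \<Rightarrow> nat \<Rightarrow> bool" where
  "greedy lo hi b x k \<longleftrightarrow> (\<forall>j<k. enabled lo hi (x j) (low lo b x j))"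

definition stuck :: "(int \<Rightarrow> int) \<Rightarrow> (int \<Rightarrow> int) \<Rightarrow> nat \<Rightarrow> int \<Rightarrow> bool" where
  "stuck lo hi l n \<longleftrightarrow> (\<forall>q \<in> I. lsrc q = l \<longrightarrow> (\<forall>n' \<ge> n. \<not> (lo q \<le> n' \<and> n' \<le> hi q)))"

definition may_stop :: "(int \<Rightarrow> int) \<Rightarrow> (int \<Rightarrow> int) \<Rightarrow> int \<Rightarrow> int \<Rightarrow> bool" where
  "may_stop lo hi b q \<longleftrightarrow> stuck lo hi (ltgt q) (if rst q then b else hi q)"

lemma low_cong: "(\<And>i. i < k \<Longrightarrow> x i = y i) \<Longrightarrow> low lo b x k = low lo b y k"
  by (induction k) auto

lemma greedy_cong:
  assumes "\<And>i. i < k \<Longrightarrow> x i = y i"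
  shows "greedy lo hi b x k \<longleftrightarrow> greedy lo hi b y k"
proof -
  have "enabled lo hi (x j) (low lo b x j) \<longleftrightarrow> enabled lo hi (y j) (low lo b y j)" if "j < k" for j
    using assms that low_cong[of j x y lo b] by simp
  then show ?thesis unfolding greedy_def by blast
qed

lemma path_cong: "(\<And>i. i < k \<Longrightarrow> x i = y i) \<Longrightarrow> 0 < k \<Longrightarrow> path x k \<longleftrightarrow> path y k"
  unfolding path_def by (metis Suc_lessD)

lemma greedy_Suc:
  "greedy lo hi b x (Suc k) \<longleftrightarrow> greedy lo hi b x k \<and> enabled lo hi (x k) (low lo b x k)"
  unfolding greedy_def by (auto simp: less_Suc_eq)

end

text \<open>The relation \<open>sim\<close> pairs the real clock values of a region with the integers that
  represent it.  It is not a function in either direction: a region may have several integers.\<close>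

locale abstraction = indexed_pta A I e0 ed
  for A :: pta and I :: "int set" and e0 :: int and ed :: "int \<Rightarrow> lterm edge" +
  fixes v :: valuation and lo hi :: "int \<Rightarrow> int" and b :: int and sim :: "real \<Rightarrow> int \<Rightarrow> bool"
  assumes sim_range: "sim w n \<Longrightarrow> 0 \<le> w \<and> b \<le> n"
    and sim_0: "sim 0 b"
    and sim_ex: "0 \<le> w \<Longrightarrow> \<exists>n. sim w n"
    and sim_rect: "sim w n \<Longrightarrow> sim w' n \<Longrightarrow> sim w n' \<Longrightarrow> sim w' n'"
    and sim_mono1: "sim w n \<Longrightarrow> sim w' n' \<Longrightarrow> \<not> sim w' n \<Longrightarrow> w \<le> w' \<Longrightarrow> n \<le> n'"
    and sim_mono2: "sim w n \<Longrightarrow> sim w' n' \<Longrightarrow> \<not> sim w' n \<Longrightarrow> n \<le> n' \<Longrightarrow> w \<le> w'"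
    and sim_surj: "q = e0 \<or> q \<in> I \<Longrightarrow> lo q \<le> n \<Longrightarrow> n \<le> hi q \<Longrightarrow> \<exists>w. sim w n"
    and sim_fire: "q = e0 \<or> q \<in> I \<Longrightarrow> sim w n \<Longrightarrow> fire v q w \<longleftrightarrow> lo q \<le> n \<and> n \<le> hi q"
begin

definition abst :: "real \<Rightarrow> int" where "abst w = (SOME n. sim w n)"
definition conc :: "int \<Rightarrow> real" where "conc n = (SOME w. sim w n)"

lemma sim_abst: "0 \<le> w \<Longrightarrow> sim w (abst w)"
  unfolding abst_def using sim_ex by (rule someI_ex)

lemma sim_conc: "\<exists>w. sim w n \<Longrightarrow> sim (conc n) n"
  unfolding conc_def by (rule someI_ex)

lemma abst_mono:
  assumes "0 \<le> w" "w \<le> w'"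
  shows "abst w \<le> abst w'"
proof (cases "sim w' (abst w)")
  case True
  have "sim w = sim w'"
    using True sim_abst[OF assms(1)] sim_rect[of w "abst w" w'] sim_rect[of w' "abst w" w] by auto
  then show ?thesis by (simp add: abst_def)
next
  case False
  then show ?thesis using assms sim_mono1 sim_abst by (meson order_trans)
qed

lemma conc_mono:
  assumes "\<exists>w. sim w n" "\<exists>w. sim w n'" "n \<le> n'"
  shows "conc n \<le> conc n'"
proof (cases "sim (conc n') n")
  case True
  have "sim w n \<longleftrightarrow> sim w n'" for w
    using True sim_conc[OF assms(2)] sim_rect[of "conc n'" n w n'] sim_rect[of "conc n'" n' w n] by auto
  then show ?thesis by (simp add: conc_def)
next
  case False
  then show ?thesis using assms sim_mono2 sim_conc by meson
qed

lemma dead_iff_stuck: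
  assumes "sim u n"
  shows "dead v l u \<longleftrightarrow> stuck lo hi l n"
proof (intro iffI)
  assume d: "dead v l u"
  show "stuck lo hi l n"
    unfolding stuck_def
  proof safe
    fix q n' assume q: "q \<in> I" "l = lsrc q" "n \<le> n'" "lo q \<le> n'" "n' \<le> hi q"
    obtain w where w: "sim w n'" using sim_surj q by blast
    show False
    proof (cases "sim w n")
      case True
      then have "sim u n'" using assms w sim_rect by blast
      then have "fire v q u" using sim_fire q by blast
      then show False using d q unfolding dead_def by auto
    next
      case False
      then have "u \<le> w" using sim_mono2[OF assms w] q by blast
      moreover have "fire v q w" using sim_fire q w by blast
      ultimately show False using d q unfolding dead_def by auto
    qed
  qed
next
  assume d: "stuck lo hi l n"
  show "dead v l u"
    unfolding dead_def
  proof safe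
    fix q w assume q: "q \<in> I" "l = lsrc q" "u \<le> w" "fire v q w"
    have w: "sim w (abst w)" using q by (intro sim_abst) (auto simp: fire_def)
    show False
    proof (cases "sim w n")
      case True
      then have "lo q \<le> n \<and> n \<le> hi q" using sim_fire q by blast
      then show False using d q unfolding stuck_def by auto
    next
      case False
      then have "n \<le> abst w" using sim_mono1[OF assms w] q by blast
      moreover have "lo q \<le> abst w \<and> abst w \<le> hi q" using sim_fire q w by blast
      ultimately show False using d q unfolding stuck_def by auto
    qed
  qed
qed

lemma path_index: "path x k \<Longrightarrow> j < k \<Longrightarrow> x j = e0 \<or> x j \<in> I"
  unfolding path_def by (cases j) auto

lemma timed_abst:
  assumes "path x k" "timed v x w k" "j < k"
  shows "sim (w j) (abst (w j))" "low lo b x j \<le> abst (w j)" "lo (x j) \<le> abst (w j)" "abst (w j) \<le> hi (x j)"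
proof -
  have f: "0 \<le> w i" "fire v (x i) (w i)" if "i < k" for i
    using assms that unfolding timed_def fire_def by auto
  show s: "sim (w j) (abst (w j))" using f assms by (intro sim_abst)
  have bounds: "lo (x i) \<le> abst (w i) \<and> abst (w i) \<le> hi (x i)" if "i < k" for i
    using sim_fire[OF path_index[OF assms(1) that] sim_abst] f[OF that] by blast
  then show "lo (x j) \<le> abst (w j)" "abst (w j) \<le> hi (x j)" using assms by auto
  show "low lo b x j \<le> abst (w j)" using assms(3)
  proof (induction j)
    case 0 then show ?case using sim_range[OF sim_abst[of "w 0"]] f by auto
  next
    case (Suc j)
    have "abst (w j) \<le> abst (w (Suc j))" if "\<not> rst (x j)"
      using that assms Suc.prems f[of j] by (intro abst_mono) (auto simp: timed_def after_def)
    then show ?case using Suc bounds[of j] sim_range[OF sim_abst[of "w (Suc j)"]] f[of "Suc j"] by auto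
  qed
qed

lemma greedy_of_timed: "path x k \<Longrightarrow> timed v x w k \<Longrightarrow> greedy lo hi b x k"
  using timed_abst unfolding greedy_def enabled_def by (meson max.bounded_iff order_trans)

lemma timed_of_greedy:
  assumes p: "path x k" and g: "\<And>j. j < k \<Longrightarrow> max (low lo b x j) (lo (x j)) \<le> n j \<and> n j \<le> hi (x j)"
    and m: "\<And>j. Suc j < k \<Longrightarrow> n j \<le> max (low lo b x j) (lo (x j))"
  shows "timed v x (\<lambda>j. conc (n j)) k"
proof -
  have ex: "\<exists>w. sim w (n j)" if "j < k" for j
    using sim_surj[OF path_index[OF p that]] g[OF that] by auto
  show ?thesis
    unfolding timed_def
  proof (intro conjI allI impI)
    fix j assume j: "j < k"
    show "fire v (x j) (conc (n j))"
      using sim_fire[OF path_index[OF p j] sim_conc[OF ex[OF j]]] g[OF j] by auto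
  next
    fix j assume j: "Suc j < k"
    show "after (x j) (conc (n j)) \<le> conc (n (Suc j))"
    proof (cases "rst (x j)")
      case True
      then show ?thesis using sim_range[OF sim_conc[OF ex[OF j]]] by (simp add: after_def)
    next
      case False
      then show ?thesis using g[OF j] m[OF j] ex j by (auto simp: after_def intro!: conc_mono)
    qed
  qed
qed

lemma Fin_iff:
  assumes "path x (Suc k)"
  shows "(\<exists>w. timed v x w (Suc k) \<and> dead v (ltgt (x k)) (after (x k) (w k))) \<longleftrightarrow>
    greedy lo hi b x (Suc k) \<and> may_stop lo hi b (x k)"
    (is "?L \<longleftrightarrow> ?R")
proof
  assume ?L
  then obtain w where w: "timed v x w (Suc k)" "dead v (ltgt (x k)) (after (x k) (w k))" by blast
  note t = timed_abst[OF assms w(1), of k, simplified]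
  have "stuck lo hi (ltgt (x k)) (if rst (x k) then b else abst (w k))"
    using dead_iff_stuck[OF sim_0] dead_iff_stuck[OF t(1)] w(2) by (auto simp: after_def)
  then have "may_stop lo hi b (x k)"
    using t(4) unfolding may_stop_def stuck_def by (auto split: if_splits)
  then show ?R using greedy_of_timed[OF assms w(1)] by blast
next
  assume r: ?R
  define n where "n j = (if j = k then hi (x k) else max (low lo b x j) (lo (x j)))" for j
  have "timed v x (\<lambda>j. conc (n j)) (Suc k)"
    using r by (intro timed_of_greedy assms) (auto simp: n_def greedy_def enabled_def)
  moreover have "\<exists>w. sim w (hi (x k))"
    using path_index[OF assms, of k] r by (intro sim_surj[of "x k"]) (auto simp: greedy_def enabled_def)
  from sim_conc[OF this] have "dead v (ltgt (x k)) (after (x k) (conc (n k)))"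
    using r dead_iff_stuck[OF sim_0] dead_iff_stuck by (auto simp: n_def after_def may_stop_def)
  ultimately show ?L by blast
qed

lemma Fin_in_Traces':
  "Fin tr \<in> Traces (inst v A) \<longleftrightarrow> (\<exists>x k. path x (Suc k) \<and> greedy lo hi b x (Suc k) \<and>
     may_stop lo hi b (x k) \<and> tr = map (\<lambda>j. lab (x (Suc j))) [0..<k])"
  unfolding Fin_in_Traces using Fin_iff by blast

lemma Inf_in_Traces':
  "Inf tr \<in> Traces (inst v A) \<longleftrightarrow>
    (\<exists>x. (\<forall>k. path x k \<and> greedy lo hi b x k) \<and> tr = (\<lambda>j. lab (x (Suc j))))"
proof -
  have "(\<exists>w. \<forall>k. timed v x w k) \<longleftrightarrow> (\<forall>k. greedy lo hi b x k)" if p: "\<And>k. path x k" for x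
  proof
    assume "\<exists>w. \<forall>k. timed v x w k"
    then show "\<forall>k. greedy lo hi b x k" using greedy_of_timed p by blast
  next
    assume "\<forall>k. greedy lo hi b x k"
    then have "timed v x (\<lambda>j. conc (max (low lo b x j) (lo (x j)))) k" for k
      using p by (intro timed_of_greedy) (auto simp: greedy_def enabled_def)
    then show "\<exists>w. \<forall>k. timed v x w k" by blast
  qed
  then show ?thesis unfolding Inf_in_Traces by (metis (no_types))
qed

lemma greedy_extends:
  assumes "path x (Suc k)" "greedy lo hi b x (Suc k)"
  obtains tr y where "tr \<in> Traces (inst v A)" "\<And>i. i \<le> k \<Longrightarrow> y i = x i"
    "(\<exists>k' \<ge> k. path y (Suc k') \<and> tr = Fin (map (\<lambda>j. lab (y (Suc j))) [0..<k'])) \<or>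
     (\<forall>k'. path y k') \<and> tr = Inf (\<lambda>j. lab (y (Suc j)))"
proof -
  define P where "P n y \<longleftrightarrow> path y (Suc (k + n)) \<and> greedy lo hi b y (Suc (k + n)) \<and> (\<forall>i\<le>k. y i = x i)" for n y
  show thesis
  proof (cases "\<exists>n y. P n y \<and> may_stop lo hi b (y (k + n))")
    case True
    then obtain n y where y: "P n y" "may_stop lo hi b (y (k + n))" by blast
    have "Fin (map (\<lambda>j. lab (y (Suc j))) [0..<k + n]) \<in> Traces (inst v A)"
      unfolding Fin_in_Traces' using y unfolding P_def by blast
    then show thesis using y unfolding P_def by (intro that[where y = y]) (auto intro!: exI[of _ "k + n"])
  next
    case False
    have "\<exists>z. P (Suc n) z \<and> (\<forall>i\<le>k + n. z i = y i)" if y: "P n y" for n y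
    proof -
      have "\<not> may_stop lo hi b (y (k + n))" using False y by blast
      then obtain q n' where q: "q \<in> I" "lsrc q = ltgt (y (k + n))" "lo q \<le> n'" "n' \<le> hi q"
        "(if rst (y (k + n)) then b else hi (y (k + n))) \<le> n'"
        unfolding may_stop_def stuck_def by auto
      define z where "z = y(Suc (k + n) := q)"
      have eq: "\<And>i. i < Suc (k + n) \<Longrightarrow> z i = y i" by (auto simp: z_def)
      have "path z (Suc (k + Suc n))"
        unfolding path_def
      proof (intro conjI allI impI)
        show "z 0 = e0" using y by (auto simp: P_def path_def z_def)
        fix j assume "Suc j < Suc (k + Suc n)"
        then show "z (Suc j) \<in> I" "lsrc (z (Suc j)) = ltgt (z j)"
          using y q by (auto simp: P_def path_def z_def)
      qed
      moreover have "greedy lo hi b z (Suc (k + n))" using y greedy_cong[of "Suc (k + n)" z y] eq by (simp add: P_def)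
      moreover have "enabled lo hi (z (Suc (k + n))) (low lo b z (Suc (k + n)))"
        using q calculation(2) eq[of "k + n"] unfolding enabled_def greedy_def
        by (auto simp: z_def split: if_splits)
      ultimately show ?thesis using y by (intro exI[of _ z]) (auto simp: P_def greedy_Suc z_def)
    qed
    moreover have "P 0 x" using assms by (simp add: P_def)
    ultimately obtain f where f: "\<And>n. P n (f n)" "\<And>n i. i \<le> k + n \<Longrightarrow> f (Suc n) i = f n i"
      using dependent_nat_choice[of P "\<lambda>n y z. \<forall>i\<le>k + n. z i = y i"] by metis
    define y where "y i = f i i" for i
    have ag: "f (n + d) i = f n i" if "i \<le> k + n" for n d i
      using that by (induction d) (auto simp: f(2))
    have y: "y i = f n i" if "i \<le> k + n" for n i
    proof (cases "i \<le> n")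
      case True
      then show ?thesis using ag[of i i "n - i"] by (simp add: y_def)
    next
      case False
      then show ?thesis using ag[of i n "i - n"] that by (simp add: y_def)
    qed
    have py: "path y (Suc (k + n)) \<and> greedy lo hi b y (Suc (k + n))" for n
      using f(1)[of n] path_cong[of "Suc (k + n)" y "f n"] greedy_cong[of "Suc (k + n)" y "f n"] y[of _ n]
      by (simp add: P_def)
    have p: "path y n \<and> greedy lo hi b y n" for n
      using py[of n] by (auto simp: path_def greedy_def)
    then have "Inf (\<lambda>j. lab (y (Suc j))) \<in> Traces (inst v A)" unfolding Inf_in_Traces' by blast
    moreover have "y i = x i" if "i \<le> k" for i using y[of i 0] f(1)[of 0] that by (simp add: P_def)
    ultimately show thesis using p by (intro that[where y = y]) auto
  qed
qed

end

context indexed_pta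
begin

lemma path_lab_eq:
  assumes "path x (Suc k)" "path y (Suc k)" "\<And>j. j < k \<Longrightarrow> lab (x (Suc j)) = lab (y (Suc j))" "i \<le> k"
  shows "x i = y i"
proof (cases i)
  case 0 then show ?thesis using assms by (simp add: path_def)
next
  case (Suc j)
  then show ?thesis using assms by (auto simp: path_def intro!: lab_inj)
qed

lemma greedy_mono: "greedy lo hi b x k \<Longrightarrow> k' \<le> k \<Longrightarrow> greedy lo hi b x k'"
  unfolding greedy_def by auto

lemma path_mono: "path x k \<Longrightarrow> k' \<le> k \<Longrightarrow> path x k'"
  unfolding path_def by auto

lemma Traces_subset_greedy:
  assumes "abstraction A I e0 ed v1 lo1 hi1 b1 sim1" "abstraction A I e0 ed v2 lo2 hi2 b2 sim2"
    and sub: "Traces (inst v1 A) \<subseteq> Traces (inst v2 A)"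
    and x: "path x (Suc k)" "greedy lo1 hi1 b1 x (Suc k)"
  shows "greedy lo2 hi2 b2 x (Suc k)" "may_stop lo1 hi1 b1 (x k) \<Longrightarrow> may_stop lo2 hi2 b2 (x k)"
proof -
  interpret a1: abstraction A I e0 ed v1 lo1 hi1 b1 sim1 by fact
  interpret a2: abstraction A I e0 ed v2 lo2 hi2 b2 sim2 by fact
  obtain tr y where y: "tr \<in> Traces (inst v1 A)" "\<And>i. i \<le> k \<Longrightarrow> y i = x i"
    "(\<exists>k' \<ge> k. path y (Suc k') \<and> tr = Fin (map (\<lambda>j. lab (y (Suc j))) [0..<k'])) \<or>
     (\<forall>k'. path y k') \<and> tr = Inf (\<lambda>j. lab (y (Suc j)))"
    using a1.greedy_extends[OF x] by blast
  have tr2: "tr \<in> Traces (inst v2 A)" using y(1) sub by blast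
  obtain z where z: "path z (Suc k)" "greedy lo2 hi2 b2 z (Suc k)"
    "\<And>j. j < k \<Longrightarrow> lab (y (Suc j)) = lab (z (Suc j))"
  proof (cases tr)
    case (Fin xs)
    with y(3) obtain k' where k': "k \<le> k'" "xs = map (\<lambda>j. lab (y (Suc j))) [0..<k']" by auto
    from tr2[unfolded Fin a2.Fin_in_Traces'] obtain z k''
      where z: "path z (Suc k'')" "greedy lo2 hi2 b2 z (Suc k'')" "xs = map (\<lambda>j. lab (z (Suc j))) [0..<k'']" by blast
    have "k'' = k'" using k' z by (metis length_map length_upt diff_zero)
    then show thesis using z k' by (intro that[of z]) (auto intro: path_mono greedy_mono)
  next
    case (Inf xs)
    with y(3) have "xs = (\<lambda>j. lab (y (Suc j)))" by auto
    moreover from tr2[unfolded Inf a2.Inf_in_Traces'] obtain z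
      where z: "\<forall>k. path z k \<and> greedy lo2 hi2 b2 z k" "xs = (\<lambda>j. lab (z (Suc j)))" by blast
    ultimately show thesis by (intro that[of z]) (auto simp: fun_eq_iff)
  qed
  have "x i = z i" if "i \<le> k" for i
    using path_lab_eq[OF x(1) z(1) _ that] z(3) y(2) by (simp add: Suc_leI)
  then show "greedy lo2 hi2 b2 x (Suc k)" using z(2) greedy_cong[of "Suc k" x z] by simp
  assume "may_stop lo1 hi1 b1 (x k)"
  then have "Fin (map (\<lambda>j. lab (x (Suc j))) [0..<k]) \<in> Traces (inst v2 A)"
    using sub x a1.Fin_in_Traces' by blast
  then obtain u k' where u: "path u (Suc k')" "may_stop lo2 hi2 b2 (u k')"
    "map (\<lambda>j. lab (x (Suc j))) [0..<k] = map (\<lambda>j. lab (u (Suc j))) [0..<k']"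
    using a2.Fin_in_Traces' by blast
  have "k' = k" using u(3) by (metis length_map length_upt diff_zero)
  then have "x k = u k" using u by (intro path_lab_eq[OF x(1)]) auto
  then show "may_stop lo2 hi2 b2 (x k)" using u \<open>k' = k\<close> by simp
qed

inductive reach for lo1 hi1 b1 lo2 hi2 b2 where
  start: "reach lo1 hi1 b1 lo2 hi2 b2 e0 b1 b2"
| move: "reach lo1 hi1 b1 lo2 hi2 b2 q i j \<Longrightarrow> enabled lo1 hi1 q i \<Longrightarrow> enabled lo2 hi2 q j \<Longrightarrow>
    q' \<in> I \<Longrightarrow> lsrc q' = ltgt q \<Longrightarrow>
    reach lo1 hi1 b1 lo2 hi2 b2 q' (if rst q then b1 else max i (lo1 q)) (if rst q then b2 else max j (lo2 q))"

definition agree where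
  "agree lo1 hi1 b1 lo2 hi2 b2 q i j \<longleftrightarrow> (enabled lo1 hi1 q i \<longleftrightarrow> enabled lo2 hi2 q j) \<and>
    (enabled lo1 hi1 q i \<longrightarrow> (may_stop lo1 hi1 b1 q \<longleftrightarrow> may_stop lo2 hi2 b2 q))"

lemma reach_iff:
  "reach lo1 hi1 b1 lo2 hi2 b2 q i j \<longleftrightarrow>
    (\<exists>x k. path x (Suc k) \<and> greedy lo1 hi1 b1 x k \<and> greedy lo2 hi2 b2 x k \<and> q = x k \<and>
      i = low lo1 b1 x k \<and> j = low lo2 b2 x k)" (is "_ \<longleftrightarrow> ?R q i j")
proof
  show "reach lo1 hi1 b1 lo2 hi2 b2 q i j \<Longrightarrow> ?R q i j"
  proof (induction rule: reach.induct)
    case start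
    show ?case by (intro exI[of _ "\<lambda>_. e0"] exI[of _ 0]) (auto simp: path_def greedy_def)
  next
    case (move q i j q')
    then obtain x k where x: "path x (Suc k)" "greedy lo1 hi1 b1 x k" "greedy lo2 hi2 b2 x k" "q = x k"
      "i = low lo1 b1 x k" "j = low lo2 b2 x k" by blast
    define y where "y = x(Suc k := q')"
    have eq: "i < Suc k \<Longrightarrow> y i = x i" for i by (simp add: y_def)
    have "path y (Suc (Suc k))"
      using x move(4,5) by (auto simp: path_def y_def)
    moreover have "greedy lo1 hi1 b1 y (Suc k)" "greedy lo2 hi2 b2 y (Suc k)"
      using x move(2,3) eq greedy_cong[of "Suc k" y x] by (auto simp: greedy_Suc)
    moreover have "low lo1 b1 y k = i" "low lo2 b2 y k = j"
      using x eq low_cong[of k y x] by auto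
    moreover have "y (Suc k) = q'" by (simp add: y_def)
    ultimately show ?case using x eq[of k]
      by (intro exI[of _ y] exI[of _ "Suc k"]) auto
  qed
  assume "?R q i j"
  then obtain x k where x: "path x (Suc k)" "greedy lo1 hi1 b1 x k" "greedy lo2 hi2 b2 x k" "q = x k"
      "i = low lo1 b1 x k" "j = low lo2 b2 x k" by blast
  have "reach lo1 hi1 b1 lo2 hi2 b2 (x n) (low lo1 b1 x n) (low lo2 b2 x n)" if "n \<le> k" for n
    using that
  proof (induction n)
    case 0
    have "x 0 = e0" using x by (simp add: path_def)
    then show ?case by (simp add: reach.start)
  next
    case (Suc n)
    then have "reach lo1 hi1 b1 lo2 hi2 b2 (x (Suc n)) (if rst (x n) then b1 else max (low lo1 b1 x n) (lo1 (x n)))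
      (if rst (x n) then b2 else max (low lo2 b2 x n) (lo2 (x n)))"
      using x by (intro reach.move) (auto simp: path_def greedy_def)
    then show ?case by simp
  qed
  then show "reach lo1 hi1 b1 lo2 hi2 b2 q i j" using x by auto
qed

theorem Traces_eq_iff:
  assumes "abstraction A I e0 ed v1 lo1 hi1 b1 sim1" "abstraction A I e0 ed v2 lo2 hi2 b2 sim2"
  shows "Traces (inst v1 A) = Traces (inst v2 A) \<longleftrightarrow>
    (\<forall>q i j. reach lo1 hi1 b1 lo2 hi2 b2 q i j \<longrightarrow> agree lo1 hi1 b1 lo2 hi2 b2 q i j)"
    (is "?L \<longleftrightarrow> ?R")
proof
  assume L: ?L
  show ?R
  proof (intro allI impI)
    fix q i j assume "reach lo1 hi1 b1 lo2 hi2 b2 q i j"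
    then obtain x k where x: "path x (Suc k)" "greedy lo1 hi1 b1 x k" "greedy lo2 hi2 b2 x k" "q = x k"
      "i = low lo1 b1 x k" "j = low lo2 b2 x k" unfolding reach_iff by blast
    show "agree lo1 hi1 b1 lo2 hi2 b2 q i j"
      using Traces_subset_greedy[OF assms _ x(1)] Traces_subset_greedy[OF assms(2,1) _ x(1)] L x
      unfolding agree_def by (auto simp: greedy_Suc)
  qed
next
  assume R: ?R
  interpret a1: abstraction A I e0 ed v1 lo1 hi1 b1 sim1 by fact
  interpret a2: abstraction A I e0 ed v2 lo2 hi2 b2 sim2 by fact
  have ag: "agree lo1 hi1 b1 lo2 hi2 b2 (x k) (low lo1 b1 x k) (low lo2 b2 x k)"
    if "path x (Suc k)" "greedy lo1 hi1 b1 x k" "greedy lo2 hi2 b2 x k" for x k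
    using R that unfolding reach_iff by blast
  have g: "greedy lo1 hi1 b1 x k \<longleftrightarrow> greedy lo2 hi2 b2 x k" if "path x k" for x k
    using that
  proof (induction k)
    case (Suc k)
    then have "greedy lo1 hi1 b1 x k \<longleftrightarrow> greedy lo2 hi2 b2 x k" using path_mono[of x "Suc k" k] by simp
    then show ?case using ag[OF Suc.prems] by (auto simp: greedy_Suc agree_def)
  qed (simp add: greedy_def)
  have s: "may_stop lo1 hi1 b1 (x k) \<longleftrightarrow> may_stop lo2 hi2 b2 (x k)"
    if "path x (Suc k)" "greedy lo1 hi1 b1 x (Suc k)" for x k
    using ag[OF that(1)] that(2) g[OF path_mono[OF that(1), of k]] by (auto simp: greedy_Suc agree_def)
  have "tr \<in> Traces (inst v1 A) \<longleftrightarrow> tr \<in> Traces (inst v2 A)" for tr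
    using g s by (cases tr) (auto simp: a1.Fin_in_Traces' a2.Fin_in_Traces' a1.Inf_in_Traces' a2.Inf_in_Traces', blast+)
  then show ?L by blast
qed

end

definition zero_term :: lterm where "zero_term = (\<lambda>_. 0, 0)"

definition terms :: "pta \<Rightarrow> lterm set" where "terms A = insert zero_term (LT A)"

definition consistent :: "pta \<Rightarrow> valuation \<Rightarrow> (lterm \<Rightarrow> int) \<Rightarrow> bool" where
  "consistent A v R \<longleftrightarrow> (\<forall>s \<in> terms A. \<forall>t \<in> terms A.
     term_val (params A) v s < term_val (params A) v t \<longleftrightarrow> R s < R t)"

definition isat :: "(lterm \<Rightarrow> int) \<Rightarrow> lterm guard \<Rightarrow> int \<Rightarrow> bool" where
  "isat R g n \<longleftrightarrow> (\<forall>(r, t) \<in> g. rel_holds r n (2 * R t))"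

text \<open>The even integer \<open>2 * R t\<close> represents the value of the term \<open>t\<close>, and the odd integers
  represent the open intervals between and above these values.\<close>

definition region :: "pta \<Rightarrow> valuation \<Rightarrow> (lterm \<Rightarrow> int) \<Rightarrow> int \<Rightarrow> real \<Rightarrow> int \<Rightarrow> bool" where
  "region A v R M w n \<longleftrightarrow> 0 \<le> w \<and> 2 * R zero_term \<le> n \<and> n \<le> M \<and>
     (\<forall>t \<in> terms A. (w < of_rat (term_val (params A) v t) \<longleftrightarrow> n < 2 * R t) \<and>
                    (of_rat (term_val (params A) v t) < w \<longleftrightarrow> 2 * R t < n))"

lemma term_val_zero [simp]: "term_val P v zero_term = 0"
  by (simp add: term_val_def zero_term_def)

lemma finite_LT: "wf_pta A \<Longrightarrow> finite (LT A)"
  unfolding LT_def wf_pta_def guard_over_def by auto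

lemma finite_terms: "wf_pta A \<Longrightarrow> finite (terms A)"
  unfolding terms_def by (simp add: finite_LT)

lemma sat_iff_isat:
  assumes "region A v R M w n" "snd ` g \<subseteq> terms A"
  shows "sat_guard (inst_guard (params A) v g) w \<longleftrightarrow> isat R g n"
proof -
  have "rel_holds r w (of_rat (term_val (params A) v t)) \<longleftrightarrow> rel_holds r n (2 * R t)"
    if "(r, t) \<in> g" for r t
  proof -
    have t: "t \<in> terms A" using that assms(2) by force
    show ?thesis
      using assms(1) t unfolding region_def by (cases r; simp; smt (verit))
  qed
  then show ?thesis unfolding sat_guard_def inst_guard_def isat_def by fastforce
qed

lemma finite_split:
  fixes f :: "'a \<Rightarrow> real"
  assumes "finite S" "finite U" "S \<noteq> {}" "\<And>s u. s \<in> S \<Longrightarrow> u \<in> U \<Longrightarrow> f s < f u"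
  shows "\<exists>w. (\<forall>s \<in> S. f s < w) \<and> (\<forall>u \<in> U. w < f u)"
proof (cases "U = {}")
  case True
  have "\<forall>s \<in> S. f s < Max (f ` S) + 1"
    using assms by (auto intro: le_less_trans[OF Max_ge])
  then show ?thesis using True by blast
next
  case False
  have "Max (f ` S) < Min (f ` U)" using assms False by auto
  then obtain w where w: "Max (f ` S) < w" "w < Min (f ` U)" using dense by blast
  have "f s < w" if "s \<in> S" for s using w(1) that assms by (auto intro: le_less_trans[OF Max_ge])
  moreover have "w < f u" if "u \<in> U" for u using w(2) that assms by (auto intro: less_le_trans[OF _ Min_le])
  ultimately show ?thesis by blast
qed

context
  fixes A :: pta and v :: valuation and R :: "lterm \<Rightarrow> int" and M :: int
  assumes wf: "wf_pta A" and cons: "consistent A v R" and M: "\<And>t. t \<in> terms A \<Longrightarrow> 2 * R t < M"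
begin

private definition val :: "lterm \<Rightarrow> real" where "val t = of_rat (term_val (params A) v t)"

private lemma val_less: "s \<in> terms A \<Longrightarrow> t \<in> terms A \<Longrightarrow> val s < val t \<longleftrightarrow> R s < R t"
  using cons unfolding consistent_def val_def by (simp add: of_rat_less)

private lemma zero: "zero_term \<in> terms A" "val zero_term = 0"
  by (simp_all add: terms_def val_def)

private lemma region_iff: "region A v R M w n \<longleftrightarrow> 0 \<le> w \<and> 2 * R zero_term \<le> n \<and> n \<le> M \<and>
     (\<forall>t \<in> terms A. (w < val t \<longleftrightarrow> n < 2 * R t) \<and> (val t < w \<longleftrightarrow> 2 * R t < n))"
  unfolding region_def val_def by simp

private lemma val_region: "t \<in> terms A \<Longrightarrow> 0 \<le> val t \<Longrightarrow> region A v R M (val t) (2 * R t)"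
  unfolding region_iff
proof (intro conjI ballI)
  assume t: "t \<in> terms A" "0 \<le> val t"
  show "2 * R zero_term \<le> 2 * R t" using val_less[OF t(1) zero(1)] zero(2) t(2) by (simp add: not_less[symmetric])
  show "2 * R t \<le> M" using M[OF t(1)] by simp
  fix s assume s: "s \<in> terms A"
  show "val t < val s \<longleftrightarrow> 2 * R t < 2 * R s" "val s < val t \<longleftrightarrow> 2 * R s < 2 * R t"
    using val_less[OF t(1) s] val_less[OF s t(1)] by simp_all
qed

lemma region_ex:
  assumes "0 \<le> w"
  shows "\<exists>n. region A v R M w n"
proof (cases "\<exists>t \<in> terms A. val t = w")
  case True
  then show ?thesis using val_region assms by blast
next
  case False
  define S where "S = {t \<in> terms A. val t < w}"
  have S: "finite S" "zero_term \<in> S"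
    using finite_terms[OF wf] False zero assms unfolding S_def by force+
  define m where "m = Max (R ` S)"
  have ge: "R t \<le> m" if "t \<in> S" for t using S(1) that unfolding m_def by simp
  obtain s where s: "s \<in> S" "R s = m" using S
  proof -
    have "m \<in> R ` S" unfolding m_def using S by (intro Max_in) auto
    then show thesis using that by blast
  qed
  have gt: "m < R t" if "t \<in> terms A" "t \<notin> S" for t
  proof -
    have "val s < val t" using that s unfolding S_def by force
    then show ?thesis using s that val_less[of s t] by (simp add: S_def)
  qed
  have "region A v R M w (2 * m + 1)"
    unfolding region_iff
  proof (intro conjI ballI)
    show "2 * m + 1 \<le> M" using s M[of s] by (auto simp: S_def)
    show "2 * R zero_term \<le> 2 * m + 1" using ge[OF S(2)] by simp
    fix t assume t: "t \<in> terms A"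
    show "w < val t \<longleftrightarrow> 2 * m + 1 < 2 * R t"
      using ge[of t] gt[OF t] t False by (cases "t \<in> S") (force simp: S_def)+
    show "val t < w \<longleftrightarrow> 2 * R t < 2 * m + 1"
      using ge[of t] gt[OF t] t False by (cases "t \<in> S") (force simp: S_def)+
  qed (use assms in simp)
  then show ?thesis by blast
qed

lemma region_surj:
  assumes n: "2 * R zero_term \<le> n" "n \<le> M"
  shows "\<exists>w. region A v R M w n"
proof (cases "\<exists>t \<in> terms A. 2 * R t = n")
  case True
  then obtain t where t: "t \<in> terms A" "2 * R t = n" by blast
  have "0 \<le> val t" using val_less[OF t(1) zero(1)] zero(2) t n by (simp add: not_less[symmetric])
  then show ?thesis using val_region[OF t(1)] t(2) by blast
next
  case False
  define S U where "S = {t \<in> terms A. 2 * R t < n}" and "U = {t \<in> terms A. n < 2 * R t}"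
  have z: "zero_term \<in> S" using zero n False unfolding S_def by force
  have "\<exists>w. (\<forall>s \<in> S. val s < w) \<and> (\<forall>u \<in> U. w < val u)"
  proof (rule finite_split)
    show "val s < val u" if "s \<in> S" "u \<in> U" for s u
      using that val_less[of s u] by (auto simp: S_def U_def)
    show "S \<noteq> {}" using z by blast
  qed (use finite_terms[OF wf] in \<open>simp_all add: S_def U_def\<close>)
  then obtain w where w: "\<And>s. s \<in> S \<Longrightarrow> val s < w" "\<And>u. u \<in> U \<Longrightarrow> w < val u" by blast
  have "region A v R M w n"
    unfolding region_iff
  proof (intro conjI ballI)
    show "0 \<le> w" using w(1)[OF z] zero by simp
    fix t assume t: "t \<in> terms A"
    then have "t \<in> S \<or> t \<in> U" using False unfolding S_def U_def by force
    then show "w < val t \<longleftrightarrow> n < 2 * R t" "val t < w \<longleftrightarrow> 2 * R t < n"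
      using w[of t] unfolding S_def U_def by force+
  qed (use n in auto)
  then show ?thesis by blast
qed

lemma region_rect:
  "region A v R M w n \<Longrightarrow> region A v R M w' n \<Longrightarrow> region A v R M w n' \<Longrightarrow> region A v R M w' n'"
  unfolding region_iff by auto

lemma region_separate:
  assumes "region A v R M w n" "region A v R M w' n'" "\<not> region A v R M w' n"
  shows "w \<le> w' \<longleftrightarrow> n \<le> n'"
proof -
  obtain t where t: "t \<in> terms A" "(w' < val t \<longleftrightarrow> n < 2 * R t) = False \<or> (val t < w' \<longleftrightarrow> 2 * R t < n) = False"
    using assms unfolding region_iff by blast
  have "(w < val t \<longleftrightarrow> n < 2 * R t) \<and> (val t < w \<longleftrightarrow> 2 * R t < n)"
    "(w' < val t \<longleftrightarrow> n' < 2 * R t) \<and> (val t < w' \<longleftrightarrow> 2 * R t < n')"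
    using assms t unfolding region_iff by auto
  with t show ?thesis by (smt (verit))
qed

lemma region_0: "region A v R M 0 (2 * R zero_term)"
  using val_region[OF zero(1)] zero(2) by simp

end

context indexed_pta
begin

definition ifire :: "(lterm \<Rightarrow> int) \<Rightarrow> int \<Rightarrow> int \<Rightarrow> int \<Rightarrow> bool" where
  "ifire R M q n \<longleftrightarrow> 2 * R zero_term \<le> n \<and> n \<le> M \<and>
     (if q = e0 then isat R (invar A (init A)) (2 * R zero_term)
      else isat R (invar A (lsrc q)) n \<and> isat R (guard (ed q)) n \<and>
        isat R (invar A (ltgt q)) (if rst q then 2 * R zero_term else n))"

lemma abstraction_of_ranks:
  assumes cons: "consistent A v R" and M: "\<And>t. t \<in> terms A \<Longrightarrow> 2 * R t < M"
    and lohi: "\<And>q n. q = e0 \<or> q \<in> I \<Longrightarrow> lo q \<le> n \<and> n \<le> hi q \<longleftrightarrow> ifire R M q n"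
  shows "abstraction A I e0 ed v lo hi (2 * R zero_term) (region A v R M)"
proof
  note reg = wf cons M
  fix w n w' n'
  show "region A v R M w n \<Longrightarrow> 0 \<le> w \<and> 2 * R zero_term \<le> n" by (auto simp: region_def)
  show "region A v R M 0 (2 * R zero_term)" by (rule region_0[OF reg])
  show "0 \<le> w \<Longrightarrow> \<exists>n. region A v R M w n" by (rule region_ex[OF reg])
  show "region A v R M w n \<Longrightarrow> region A v R M w' n \<Longrightarrow> region A v R M w n' \<Longrightarrow> region A v R M w' n'"
    by (rule region_rect[OF reg])
  show "region A v R M w n \<Longrightarrow> region A v R M w' n' \<Longrightarrow> \<not> region A v R M w' n \<Longrightarrow> w \<le> w' \<Longrightarrow> n \<le> n'"
    "region A v R M w n \<Longrightarrow> region A v R M w' n' \<Longrightarrow> \<not> region A v R M w' n \<Longrightarrow> n \<le> n' \<Longrightarrow> w \<le> w'"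
    using region_separate[OF reg] by blast+
next
  note reg = wf cons M
  fix q n assume q: "q = e0 \<or> q \<in> I" "lo q \<le> n" "n \<le> hi q"
  then have "ifire R M q n" using lohi by blast
  then show "\<exists>w. region A v R M w n" by (intro region_surj[OF reg]) (auto simp: ifire_def)
next
  note reg = wf cons M
  fix q w n assume q: "q = e0 \<or> q \<in> I" and s: "region A v R M w n"
  have inv: "snd ` invar A l \<subseteq> terms A" if "l \<in> locs A" for l
    using that unfolding terms_def LT_def by force
  have grd: "snd ` guard (ed q) \<subseteq> terms A" if "q \<in> I"
    using that bij unfolding terms_def LT_def bij_betw_def by force
  have src: "lsrc q \<in> locs A" if "q \<in> I"
    using that bij wf unfolding wf_pta_def bij_betw_def lsrc_def by auto
  have tgt: "ltgt q \<in> locs A" using ltgt_locs q by blast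
  have ini: "init A \<in> locs A" using wf by (simp add: wf_pta_def)
  have r0: "region A v R M 0 (2 * R zero_term)" by (rule region_0[OF reg])
  note sat = sat_iff_isat[OF s] sat_iff_isat[OF r0]
  have "fire v q w \<longleftrightarrow> ifire R M q n"
    using q e0 s sat[OF inv] sat[OF grd] src tgt ini
    unfolding fire_def ifire_def satl_def by (auto simp: region_def)
  then show "fire v q w \<longleftrightarrow> lo q \<le> n \<and> n \<le> hi q" using lohi[OF q] by blast
qed

end

subsection \<open>Reasoning about programs and their running time\<close>

definition upd :: "state \<Rightarrow> string \<Rightarrow> int \<Rightarrow> int \<Rightarrow> state" where
  "upd s a i x = s(a := (s a)(i := x))"

lemma upd_same [simp]: "upd s a i x a = (s a)(i := x)"
  by (simp add: upd_def)

lemma upd_other [simp]: "b \<noteq> a \<Longrightarrow> upd s a i x b = s b"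
  by (simp add: upd_def)

definition run :: "com \<Rightarrow> state \<Rightarrow> (nat \<Rightarrow> state \<Rightarrow> bool) \<Rightarrow> bool" where
  "run c s Q \<longleftrightarrow> (\<exists>n s'. exec c s n s' \<and> Q n s')"

lemma run_weak_cong [cong]: "c = c' \<Longrightarrow> s = s' \<Longrightarrow> run c s Q = run c' s' Q"
  by simp

inductive_cases exec_SkipE: "exec Skip s n s'"
inductive_cases exec_AssignE: "exec (Assign a i x) s n s'"
inductive_cases exec_SeqE: "exec (Seq c c') s n s'"
inductive_cases exec_IfE: "exec (If b c c') s n s'"

lemma run_Skip [simp]: "run Skip s Q \<longleftrightarrow> Q 1 s"
  unfolding run_def by (metis exec.Skip exec_SkipE)

lemma run_Assign [simp]: "run (Assign a i x) s Q \<longleftrightarrow> Q 1 (upd s a (aval i s) (aval x s))"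
  unfolding run_def upd_def by (metis exec.Assign exec_AssignE)

lemma run_Seq [simp]: "run (Seq c c') s Q \<longleftrightarrow> run c s (\<lambda>n s'. run c' s' (\<lambda>m. Q (n + m)))"
  unfolding run_def by (blast intro: exec.Seq elim: exec_SeqE)

lemma run_If [simp]:
  "run (If b c c') s Q \<longleftrightarrow>
    (if bval b s then run c s (\<lambda>n. Q (Suc n)) else run c' s (\<lambda>n. Q (Suc n)))"
  unfolding run_def by (cases "bval b s") (simp, blast intro: exec.IfTrue exec.IfFalse elim: exec_IfE)+

lemma run_conseq: "run c s P \<Longrightarrow> (\<And>n s'. P n s' \<Longrightarrow> Q n s') \<Longrightarrow> run c s Q"
  unfolding run_def by blast

fun writes :: "com \<Rightarrow> string set" where
  "writes Skip = {}"
| "writes (Assign a i x) = {a}"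
| "writes (Seq c c') = writes c \<union> writes c'"
| "writes (If b c c') = writes c \<union> writes c'"
| "writes (While b c) = writes c"

lemma exec_frame: "exec c s n s' \<Longrightarrow> a \<notin> writes c \<Longrightarrow> s' a = s a"
  by (induction rule: exec.induct) auto

lemma run_frame: "run c s Q \<Longrightarrow> run c s (\<lambda>n s'. Q n s' \<and> (\<forall>a. a \<notin> writes c \<longrightarrow> s' a = s a))"
  unfolding run_def using exec_frame by blast

lemma run_While:
  assumes "\<And>s'. I s' \<Longrightarrow> (\<And>a. a \<notin> writes c \<Longrightarrow> s' a = s a) \<Longrightarrow> bval b s' \<Longrightarrow>
      run c s' (\<lambda>n s''. n \<le> T \<and> I s'' \<and> \<mu> s'' < (\<mu> s' :: nat))"
    and "I s"
  shows "run (While b c) s (\<lambda>n s'. n \<le> \<mu> s * (T + 1) + 1 \<and> I s' \<and> \<not> bval b s' \<and>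
    (\<forall>a. a \<notin> writes c \<longrightarrow> s' a = s a))"
proof -
  have "\<exists>n s2. exec (While b c) s1 n s2 \<and> n \<le> \<mu> s1 * (T + 1) + 1 \<and> I s2 \<and> \<not> bval b s2"
    if "I s1" "\<And>a. a \<notin> writes c \<Longrightarrow> s1 a = s a" for s1
    using that
  proof (induction "\<mu> s1" arbitrary: s1 rule: less_induct)
    case less
    show ?case
    proof (cases "bval b s1")
      case False
      then show ?thesis using less.prems by (meson exec.WhileFalse le_add2)
    next
      case True
      obtain m s2 where m: "exec c s1 m s2" "m \<le> T" "I s2" "\<mu> s2 < \<mu> s1"
        using assms(1)[OF less.prems True] unfolding run_def by blast
      have "\<And>a. a \<notin> writes c \<Longrightarrow> s2 a = s a" using exec_frame[OF m(1)] less.prems(2) by simp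
      from less.hyps[OF m(4,3) this] obtain n s3 where
        n: "exec (While b c) s2 n s3" "n \<le> \<mu> s2 * (T + 1) + 1" "I s3" "\<not> bval b s3" by blast
      have "Suc (\<mu> s2) * (T + 1) \<le> \<mu> s1 * (T + 1)" using m(4) by (intro mult_le_mono) auto
      then have "Suc (m + n) \<le> \<mu> s1 * (T + 1) + 1" using m(2) n(2) by simp
      then show ?thesis using exec.WhileTrue[OF True m(1) n(1)] n by blast
    qed
  qed
  then have "run (While b c) s (\<lambda>n s'. n \<le> \<mu> s * (T + 1) + 1 \<and> I s' \<and> \<not> bval b s')"
    unfolding run_def using assms(2) by blast
  from run_frame[OF this] show ?thesis by (rule run_conseq) simp
qed

abbreviation V :: "string \<Rightarrow> aexp" where "V a \<equiv> Read a (Num 0)"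
abbreviation Set :: "string \<Rightarrow> aexp \<Rightarrow> com" where "Set a x \<equiv> Assign a (Num 0) x"
abbreviation Inc :: "string \<Rightarrow> com" where "Inc a \<equiv> Set a (Plus (V a) (Num 1))"

definition Equal :: "aexp \<Rightarrow> aexp \<Rightarrow> bexp" where
  "Equal x y = And (Not (Less x y)) (Not (Less y x))"

lemma bval_Equal [simp]: "bval (Equal x y) s \<longleftrightarrow> aval x s = aval y s"
  by (auto simp: Equal_def)

definition For :: "string \<Rightarrow> aexp \<Rightarrow> com \<Rightarrow> com" where
  "For i x c = Seq (Set i (Num 0)) (While (Less (V i) x) (Seq c (Inc i)))"

lemma writes_For [simp]: "writes (For i x c) = insert i (writes c)"
  by (auto simp: For_def)

lemma run_For:
  assumes I0: "I 0 (upd s i 0 0)"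
    and bound: "\<And>k s'. I k s' \<Longrightarrow> s' i 0 = int k \<Longrightarrow> (\<And>a. a \<notin> insert i (writes c) \<Longrightarrow> s' a = s a) \<Longrightarrow>
      aval x s' = int m"
    and body: "\<And>k s'. k < m \<Longrightarrow> I k s' \<Longrightarrow> s' i 0 = int k \<Longrightarrow>
      (\<And>a. a \<notin> insert i (writes c) \<Longrightarrow> s' a = s a) \<Longrightarrow>
      run c s' (\<lambda>n s''. n \<le> T \<and> s'' i 0 = int k \<and> I (Suc k) (upd s'' i 0 (int (Suc k))))"
  shows "run (For i x c) s (\<lambda>n s'. n \<le> m * (T + 2) + 2 \<and> I m s' \<and> s' i 0 = int m \<and>
    (\<forall>a. a \<notin> insert i (writes c) \<longrightarrow> s' a = s a))"
proof -
  let ?s = "upd s i 0 0"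
  let ?J = "\<lambda>s'. \<exists>k\<le>m. I k s' \<and> s' i 0 = int k \<and> (\<forall>a. a \<notin> insert i (writes c) \<longrightarrow> s' a = s a)"
  have "run (While (Less (V i) x) (Seq c (Inc i))) ?s (\<lambda>n s'. n \<le> (m - nat (?s i 0)) * ((T + 1) + 1) + 1 \<and>
     ?J s' \<and> \<not> bval (Less (V i) x) s' \<and> (\<forall>a. a \<notin> writes (Seq c (Inc i)) \<longrightarrow> s' a = ?s a))"
  proof (rule run_While[where \<mu> = "\<lambda>s'. m - nat (s' i 0)"])
    show "?J ?s" by (rule exI[of _ 0]) (use I0 in auto)
    fix s' assume J: "?J s'" and b: "bval (Less (V i) x) s'"
    then obtain k where k: "k \<le> m" "I k s'" "s' i 0 = int k" "\<And>a. a \<notin> insert i (writes c) \<Longrightarrow> s' a = s a" by blast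
    have km: "k < m" using b k(3) bound[OF k(2-4)] by simp
    show "run (Seq c (Inc i)) s' (\<lambda>n s''. n \<le> T + 1 \<and> ?J s'' \<and> m - nat (s'' i 0) < m - nat (s' i 0))"
      unfolding run_Seq
    proof (rule run_conseq[OF run_frame[OF body[OF km k(2-4)]]])
      fix n s''
      assume *: "(n \<le> T \<and> s'' i 0 = int k \<and> I (Suc k) (upd s'' i 0 (int (Suc k)))) \<and> (\<forall>a. a \<notin> writes c \<longrightarrow> s'' a = s' a)"
      then show "run (Inc i) s'' (\<lambda>na s'''. n + na \<le> T + 1 \<and> ?J s''' \<and> m - nat (s''' i 0) < m - nat (s' i 0))"
        using km k(3,4) by (auto simp: add.commute intro!: exI[of _ "Suc k"])
    qed
  qed
  then have "run (For i x c) s (\<lambda>n s'. n \<le> m * (T + 2) + 2 \<and> ?J s' \<and> \<not> bval (Less (V i) x) s')"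
    unfolding For_def by simp (erule run_conseq, auto)
  then show ?thesis
  proof (rule run_conseq)
    fix n s'
    assume *: "n \<le> m * (T + 2) + 2 \<and> ?J s' \<and> \<not> bval (Less (V i) x) s'"
    then obtain k where k: "k \<le> m" "I k s'" "s' i 0 = int k" "\<And>a. a \<notin> insert i (writes c) \<Longrightarrow> s' a = s a" by blast
    then have "k = m" using * bound[OF k(2-4)] by simp
    then show "n \<le> m * (T + 2) + 2 \<and> I m s' \<and> s' i 0 = int m \<and> (\<forall>a. a \<notin> insert i (writes c) \<longrightarrow> s' a = s a)"
      using * k by blast
  qed
qed

definition seg :: "(int \<Rightarrow> int) \<Rightarrow> int \<Rightarrow> int list \<Rightarrow> bool" where
  "seg f p ys \<longleftrightarrow> (\<forall>k < length ys. f (p + int k) = ys ! k)"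

lemma seg_Nil [simp]: "seg f p []"
  by (simp add: seg_def)

lemma seg_Cons [simp]: "seg f p (y # ys) \<longleftrightarrow> f p = y \<and> seg f (p + 1) ys"
  unfolding seg_def by (auto simp: less_Suc_eq_0_disj algebra_simps all_conj_distrib)

lemma seg_append: "seg f p (ys @ zs) \<longleftrightarrow> seg f p ys \<and> seg f (p + int (length ys)) zs"
  by (induction ys arbitrary: p) (auto simp: algebra_simps)

subsection \<open>Reading the input\<close>

notation Seq (infixr ";;" 60)

definition compare_prog :: com where
  "compare_prog =
     Set ''q'' (Num 1) ;;
     For ''k'' (Plus (V ''np'') (Num 1))
       (If (Equal (Read ''in'' (Plus (Read ''tp'' (V ''j'')) (V ''k'')))
                  (Read ''in'' (Plus (Plus (V ''p'') (Num 1)) (V ''k''))))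
         Skip (Set ''q'' (Num 0)))"

definition find_prog :: com where
  "find_prog =
     Set ''d'' (V ''nt'') ;;
     For ''j'' (V ''nt'')
       (compare_prog ;; If (Equal (V ''q'') (Num 1)) (Set ''d'' (V ''j'')) Skip)"

definition constr_prog :: com where
  "constr_prog =
     find_prog ;;
     If (Equal (V ''d'') (V ''nt''))
       (Assign ''tp'' (V ''nt'') (Plus (V ''p'') (Num 1)) ;; Inc ''nt'') Skip ;;
     Assign ''cr'' (V ''nc'') (Read ''in'' (V ''p'')) ;;
     Assign ''ct'' (V ''nc'') (V ''d'') ;;
     Assign ''cg'' (V ''nc'') (V ''g'') ;;
     Inc ''nc'' ;;
     Set ''p'' (Plus (V ''p'') (Plus (V ''np'') (Num 2)))"

definition constrs_prog :: com where
  "constrs_prog = Set ''m'' (Read ''in'' (V ''p'')) ;; Inc ''p'' ;; For ''i'' (V ''m'') constr_prog"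

lemma writes_compare [simp]: "writes compare_prog = {''q'', ''k''}"
  by (auto simp: compare_prog_def)

lemma writes_find [simp]: "writes find_prog = {''q'', ''k'', ''d'', ''j''}"
  by (auto simp: find_prog_def)

lemma writes_constr [simp]: "writes constr_prog =
    {''q'', ''k'', ''d'', ''j'', ''tp'', ''nt'', ''cr'', ''ct'', ''cg'', ''nc'', ''p''}"
  by (auto simp: constr_prog_def)

lemma writes_constrs [simp]: "writes constrs_prog =
    {''q'', ''k'', ''d'', ''j'', ''tp'', ''nt'', ''cr'', ''ct'', ''cg'', ''nc'', ''p'', ''m'', ''i''}"
  by (auto simp: constrs_prog_def)

lemma run_compare:
  assumes "s ''np'' 0 = int N"
  shows "run compare_prog s (\<lambda>n s'. n \<le> 4 * N + 7 \<and>
    s' ''q'' 0 = of_bool (\<forall>k\<le>N. s ''in'' (s ''tp'' (s ''j'' 0) + int k) = s ''in'' (s ''p'' 0 + 1 + int k)))"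
  unfolding compare_prog_def run_Seq run_Assign
proof (rule run_conseq[OF run_For[where m = "Suc N" and T = 2 and I = "\<lambda>k s'. s' ''q'' 0 =
    of_bool (\<forall>k'<k. s ''in'' (s ''tp'' (s ''j'' 0) + int k') = s ''in'' (s ''p'' 0 + 1 + int k'))"]])
  fix k s'
  assume "s' ''q'' 0 =
    of_bool (\<forall>k'<k. s ''in'' (s ''tp'' (s ''j'' 0) + int k') = s ''in'' (s ''p'' 0 + 1 + int k'))"
    "s' ''k'' 0 = int k"
    "\<And>a. a \<notin> insert ''k'' (writes (If (Equal (Read ''in'' (Plus (Read ''tp'' (V ''j'')) (V ''k'')))
                  (Read ''in'' (Plus (Plus (V ''p'') (Num 1)) (V ''k''))))
         Skip (Set ''q'' (Num 0)))) \<Longrightarrow> s' a = upd s ''q'' (aval (Num 0) s) (aval (Num 1) s) a"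
  then show "run (If (Equal (Read ''in'' (Plus (Read ''tp'' (V ''j'')) (V ''k'')))
                  (Read ''in'' (Plus (Plus (V ''p'') (Num 1)) (V ''k''))))
         Skip (Set ''q'' (Num 0))) s' (\<lambda>n s''. n \<le> 2 \<and> s'' ''k'' 0 = int k \<and>
         upd s'' ''k'' 0 (int (Suc k)) ''q'' 0 = of_bool (\<forall>k'<Suc k. s ''in'' (s ''tp'' (s ''j'' 0) + int k') = s ''in'' (s ''p'' 0 + 1 + int k')))"
    by (auto simp: less_Suc_eq)
qed (use assms in \<open>auto simp: less_Suc_eq_le\<close>)

lemma run_find:
  fixes s :: state and N :: nat
  defines "M \<equiv> \<lambda>j. \<forall>k\<le>N. s ''in'' (s ''tp'' (int j) + int k) = s ''in'' (s ''p'' 0 + 1 + int k)"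
  assumes "s ''np'' 0 = int N" "s ''nt'' 0 = int nt"
  shows "run find_prog s (\<lambda>n s'. n \<le> nt * (4 * N + 11) + 3 \<and>
    (if \<exists>j<nt. M j then \<exists>j<nt. M j \<and> s' ''d'' 0 = int j else s' ''d'' 0 = int nt))"
  unfolding find_prog_def run_Seq run_Assign
  apply (rule run_conseq[OF run_For[where m = nt and T = "4 * N + 9" and I = "\<lambda>i s'.
    if \<exists>j<i. M j then \<exists>j<i. M j \<and> s' ''d'' 0 = int j else s' ''d'' 0 = int nt"]])
  subgoal using assms by simp
  subgoal using assms by simp
  subgoal for k s'
    unfolding run_Seq
    apply (rule run_conseq[OF run_frame[OF run_compare[where N = N]]])
    subgoal using assms by simp
    subgoal premises prems for n s''
    proof -
      have "s'' ''q'' 0 = of_bool (M k)" "s'' ''j'' 0 = int k" "s'' ''d'' = s' ''d''" "n \<le> 4 * N + 7"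
        using prems unfolding M_def by simp_all
      then show ?thesis using prems(2) by (cases "M k") (auto simp: less_Suc_eq split: if_splits)
    qed
    done
  subgoal by (simp add: algebra_simps)
  done


definition coef :: "nat set \<Rightarrow> lterm \<Rightarrow> int list" where
  "coef P t = map (fst t) (sorted_list_of_set P) @ [snd t]"

lemma length_coef [simp]: "length (coef P t) = Suc (card P)"
  by (simp add: coef_def)

lemma enc_constr_coef: "enc_constr P (r, t) = enc_rel r # coef P t"
  by (cases t) (simp add: coef_def)

lemma coef_inj:
  assumes "finite P" "term_over P t" "term_over P u" "coef P t = coef P u"
  shows "t = u"
proof -
  have "fst t p = fst u p" for p
    using assms by (cases "p \<in> P") (auto simp: coef_def term_over_def)
  then show ?thesis using assms(4) by (auto simp: coef_def prod_eq_iff)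
qed

lemma seg_coef_eq_iff:
  assumes "finite P" "term_over P t" "term_over P u" "seg f a (coef P t)" "seg f b (coef P u)"
  shows "(\<forall>k\<le>card P. f (a + int k) = f (b + int k)) \<longleftrightarrow> t = u"
proof -
  have "(\<forall>k\<le>card P. f (a + int k) = f (b + int k)) \<longleftrightarrow> (\<forall>k<Suc (card P). coef P t ! k = coef P u ! k)"
    using assms(4,5) unfolding seg_def by (simp add: less_Suc_eq_le)
  also have "\<dots> \<longleftrightarrow> coef P t = coef P u" by (simp add: list_eq_iff_nth_eq)
  also have "\<dots> \<longleftrightarrow> t = u" using coef_inj assms by blast
  finally show ?thesis .
qed

text \<open>The terms found so far are \<open>Ts\<close>, given by their positions in the input; the constraints
  found so far are \<open>Cs\<close>, each with the index of the location or edge that it belongs to.\<close>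

definition table :: "nat set \<Rightarrow> state \<Rightarrow> lterm list \<Rightarrow> (int \<times> rel \<times> lterm) list \<Rightarrow> bool" where
  "table P s Ts Cs \<longleftrightarrow>
     s ''nt'' 0 = int (length Ts) \<and> s ''nc'' 0 = int (length Cs) \<and>
     distinct Ts \<and> 0 < length Ts \<and> Ts ! 0 = zero_term \<and> (\<forall>t \<in> set Ts. term_over P t) \<and>
     (\<forall>j < length Ts. seg (s ''in'') (s ''tp'' (int j)) (coef P (Ts ! j))) \<and>
     (\<forall>k < length Cs. s ''cg'' (int k) = fst (Cs ! k) \<and> s ''cr'' (int k) = enc_rel (fst (snd (Cs ! k))) \<and>
        (\<exists>j < length Ts. s ''ct'' (int k) = int j \<and> Ts ! j = snd (snd (Cs ! k))))"

lemma table_add: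
  assumes tab: "table P s Ts Cs"
    and Ts': "Ts' = Ts \<and> s' ''tp'' = s ''tp'' \<or>
      Ts' = Ts @ [t] \<and> t \<notin> set Ts \<and> term_over P t \<and> seg (s ''in'') p (coef P t) \<and>
      s' ''tp'' = (s ''tp'')(int (length Ts) := p)"
    and "s' ''nt'' 0 = int (length Ts')" "s' ''nc'' 0 = int (Suc (length Cs))" "s' ''in'' = s ''in''"
    and upd: "s' ''cg'' = (s ''cg'')(int (length Cs) := g)"
      "s' ''cr'' = (s ''cr'')(int (length Cs) := enc_rel r)"
      "s' ''ct'' = (s ''ct'')(int (length Cs) := int j)"
    and j: "j < length Ts'" "Ts' ! j = t"
  shows "table P s' Ts' (Cs @ [(g, r, t)])"
proof -
  have old: "j < length Ts'" "Ts' ! j = Ts ! j" if "j < length Ts" for j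
    using Ts' that by (auto simp: nth_append)
  have cs: "s' ''cg'' (int k) = fst ((Cs @ [(g, r, t)]) ! k)"
    "s' ''cr'' (int k) = enc_rel (fst (snd ((Cs @ [(g, r, t)]) ! k)))"
    "\<exists>j < length Ts'. s' ''ct'' (int k) = int j \<and> Ts' ! j = snd (snd ((Cs @ [(g, r, t)]) ! k))"
    if "k < Suc (length Cs)" for k
  proof -
    have k: "k = length Cs \<or> k < length Cs" using that by auto
    show "s' ''cg'' (int k) = fst ((Cs @ [(g, r, t)]) ! k)"
      "s' ''cr'' (int k) = enc_rel (fst (snd ((Cs @ [(g, r, t)]) ! k)))"
      using tab k by (auto simp: upd nth_append table_def)
    show "\<exists>j < length Ts'. s' ''ct'' (int k) = int j \<and> Ts' ! j = snd (snd ((Cs @ [(g, r, t)]) ! k))"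
    proof (cases "k = length Cs")
      case True then show ?thesis using j by (auto simp: upd nth_append)
    next
      case False
      then obtain i where "i < length Ts" "s ''ct'' (int k) = int i" "Ts ! i = snd (snd (Cs ! k))"
        using tab k by (auto simp: table_def)
      then show ?thesis using False k old[of i] by (auto simp: upd nth_append)
    qed
  qed
  have ts: "seg (s' ''in'') (s' ''tp'' (int j)) (coef P (Ts' ! j))" if "j < length Ts'" for j
    using that Ts' tab assms(5) by (cases "j < length Ts") (auto simp: table_def nth_append less_Suc_eq)
  show ?thesis
    using assms(3,4) cs ts tab Ts' unfolding table_def by (auto simp: nth_append)
qed

lemma table_cong:
  assumes "\<And>a. a \<in> {''nt'', ''nc'', ''in'', ''tp'', ''cg'', ''cr'', ''ct''} \<Longrightarrow> s' a = s a"
  shows "table P s' Ts Cs = table P s Ts Cs"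
  using assms unfolding table_def by simp

lemma table_upd [simp]:
  "a \<notin> {''nt'', ''nc'', ''in'', ''tp'', ''cg'', ''cr'', ''ct''} \<Longrightarrow> table P (upd s a i x) Ts Cs = table P s Ts Cs"
  by (rule table_cong) auto

lemma run_constr:
  assumes "finite P" and np: "s ''np'' 0 = int (card P)" and tab: "table P s Ts Cs"
    and sg: "seg (s ''in'') (s ''p'' 0) (enc_constr P (r, t) @ rest)" and t: "term_over P t"
  shows "run constr_prog s (\<lambda>n s'. n \<le> length Ts * (4 * card P + 11) + 11 \<and>
    (\<exists>Ts'. table P s' Ts' (Cs @ [(s ''g'' 0, r, t)]) \<and> set Ts' = insert t (set Ts)) \<and>
    seg (s ''in'') (s' ''p'' 0) rest)"
proof -
  let ?M = "\<lambda>j. \<forall>k\<le>card P. s ''in'' (s ''tp'' (int j) + int k) = s ''in'' (s ''p'' 0 + 1 + int k)"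
  have nt: "s ''nt'' 0 = int (length Ts)" using tab by (simp add: table_def)
  have sg': "s ''in'' (s ''p'' 0) = enc_rel r" "seg (s ''in'') (s ''p'' 0 + 1) (coef P t)"
    "seg (s ''in'') (s ''p'' 0 + (int (card P) + 2)) rest"
    using sg by (simp_all add: enc_constr_coef seg_append algebra_simps)
  have M: "?M j \<longleftrightarrow> Ts ! j = t" if "j < length Ts" for j
    using tab that t sg'(2) assms(1) by (intro seg_coef_eq_iff) (auto simp: table_def)
  have ex: "(\<exists>j<length Ts. ?M j) \<longleftrightarrow> t \<in> set Ts"
    using M by (auto simp: in_set_conv_nth)
  have ex': "(\<exists>j<length Ts. ?M j \<and> x = int j) \<longleftrightarrow> (\<exists>j<length Ts. Ts ! j = t \<and> x = int j)" for x
    using M by auto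
  show ?thesis
    unfolding constr_prog_def run_Seq
  proof (rule run_conseq[OF run_frame[OF run_find[of s "card P" "length Ts", OF np nt]]], unfold ex ex' writes_find)
    fix n s'
    assume prems: "(n \<le> length Ts * (4 * card P + 11) + 3 \<and>
        (if t \<in> set Ts then \<exists>j<length Ts. Ts ! j = t \<and> s' ''d'' 0 = int j else s' ''d'' 0 = int (length Ts))) \<and>
      (\<forall>a. a \<notin> {''q'', ''k'', ''d'', ''j''} \<longrightarrow> s' a = s a)"
    have fr [simp]: "s' ''nt'' = s ''nt''" "s' ''nc'' = s ''nc''" "s' ''in'' = s ''in''" "s' ''tp'' = s ''tp''"
      "s' ''cg'' = s ''cg''" "s' ''cr'' = s ''cr''" "s' ''ct'' = s ''ct''" "s' ''p'' = s ''p''" "s' ''np'' = s ''np''"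
      "s' ''g'' = s ''g''"
      using prems by simp_all
    show "run (If (Equal (V ''d'') (V ''nt''))
         (Assign ''tp'' (V ''nt'') (Plus (V ''p'') (Num 1)) ;; Inc ''nt'') Skip) s'
      (\<lambda>na s'. run (Assign ''cr'' (V ''nc'') (Read ''in'' (V ''p''))) s'
      (\<lambda>nb s'. run (Assign ''ct'' (V ''nc'') (V ''d'')) s'
      (\<lambda>nc s'. run (Assign ''cg'' (V ''nc'') (V ''g'')) s'
      (\<lambda>nd s'. run (Inc ''nc'') s'
      (\<lambda>ne s'. run (Set ''p'' (Plus (V ''p'') (Plus (V ''np'') (Num 2)))) s'
      (\<lambda>nf s'. n + (na + (nb + (nc + (nd + (ne + nf))))) \<le> length Ts * (4 * card P + 11) + 11 \<and>
         (\<exists>Ts'. table P s' Ts' (Cs @ [(s ''g'' 0, r, t)]) \<and> set Ts' = insert t (set Ts)) \<and>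
         seg (s ''in'') (s' ''p'' 0) rest))))))"
    proof (cases "t \<in> set Ts")
      case True
      then obtain j where j: "j < length Ts" "Ts ! j = t" "s' ''d'' 0 = int j" using prems by auto
      have nc: "s ''nc'' 0 = int (length Cs)" using tab by (simp add: table_def)
      have T: "\<exists>Ts'. table P s2 Ts' (Cs @ [(s ''g'' 0, r, t)]) \<and> set Ts' = insert t (set Ts)"
        if "s2 ''tp'' = s ''tp''" "s2 ''nt'' 0 = int (length Ts)" "s2 ''nc'' 0 = int (Suc (length Cs))"
          "s2 ''in'' = s ''in''" "s2 ''cg'' = (s ''cg'')(int (length Cs) := s ''g'' 0)"
          "s2 ''cr'' = (s ''cr'')(int (length Cs) := enc_rel r)"
          "s2 ''ct'' = (s ''ct'')(int (length Cs) := int j)" for s2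
        using table_add[OF tab disjI1 that(2-7) j(1,2)] that True by auto
      have n: "n \<le> length Ts * (4 * card P + 11) + 3" using prems by simp
      have ne: "int j \<noteq> int (length Ts)" using j by simp
      show ?thesis
        using n ne by (simp add: nt np nc sg' j(3)) (rule T; simp add: nt fun_upd_def)
    next
      case False
      then have d: "s' ''d'' 0 = int (length Ts)" using prems by simp
      have nc: "s ''nc'' 0 = int (length Cs)" using tab by (simp add: table_def)
      have T: "\<exists>Ts'. table P s2 Ts' (Cs @ [(s ''g'' 0, r, t)]) \<and> set Ts' = insert t (set Ts)"
        if "s2 ''tp'' = (s ''tp'')(int (length Ts) := s ''p'' 0 + 1)"
          "s2 ''nt'' 0 = int (length (Ts @ [t]))" "s2 ''nc'' 0 = int (Suc (length Cs))"
          "s2 ''in'' = s ''in''" "s2 ''cg'' = (s ''cg'')(int (length Cs) := s ''g'' 0)"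
          "s2 ''cr'' = (s ''cr'')(int (length Cs) := enc_rel r)"
          "s2 ''ct'' = (s ''ct'')(int (length Cs) := int (length Ts))" for s2
      proof (intro exI conjI)
        show "table P s2 (Ts @ [t]) (Cs @ [(s ''g'' 0, r, t)])"
          by (rule table_add[OF tab disjI2 that(2-7)]) (use that(1) False t sg'(2) in \<open>blast | simp\<close>)+
      qed simp
      have n: "n \<le> length Ts * (4 * card P + 11) + 3" using prems by simp
      show ?thesis
        using n by (simp add: nt np nc sg' d) (rule T; simp add: nt fun_upd_def)
    qed
  qed
qed


lemma run_call:
  assumes "run c s P" "\<And>n s'. P n s' \<Longrightarrow> (\<And>a. a \<notin> writes c \<Longrightarrow> s' a = s a) \<Longrightarrow> Q n s'"
  shows "run c s Q"
  using run_conseq[OF run_frame[OF assms(1)]] assms(2) by blast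

lemma table_length_le:
  assumes "table P s Ts Cs" "finite U" "set Ts \<subseteq> U"
  shows "length Ts \<le> card U"
  using assms distinct_card[of Ts] card_mono[of U "set Ts"] by (simp add: table_def)

lemma run_constrs:
  fixes s :: state
  assumes P: "finite P" "s ''np'' 0 = int (card P)" and tab: "table P s Ts Cs"
    and sg: "seg (s ''in'') (s ''p'' 0) (enc_list (enc_constr P) cl @ rest)"
    and t: "\<And>r t. (r, t) \<in> set cl \<Longrightarrow> term_over P t"
    and U: "finite U" "set Ts \<union> snd ` set cl \<subseteq> U"
  shows "run constrs_prog s (\<lambda>n s'. n \<le> length cl * (card U * (4 * card P + 11) + 13) + 4 \<and>
    (\<exists>Ts'. table P s' Ts' (Cs @ map (Pair (s ''g'' 0)) cl) \<and> set Ts' = set Ts \<union> snd ` set cl) \<and>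
    seg (s ''in'') (s' ''p'' 0) rest)"
proof -
  let ?I = "\<lambda>k s'. (\<exists>Ts'. table P s' Ts' (Cs @ map (Pair (s ''g'' 0)) (take k cl)) \<and>
    set Ts' = set Ts \<union> snd ` set (take k cl)) \<and>
    seg (s ''in'') (s' ''p'' 0) (concat (map (enc_constr P) (drop k cl)) @ rest)"
  let ?s = "upd (upd s ''m'' 0 (int (length cl))) ''p'' 0 (s ''p'' 0 + 1)"
  have sg0: "s ''in'' (s ''p'' 0) = int (length cl)"
    "seg (s ''in'') (s ''p'' 0 + 1) (concat (map (enc_constr P) cl) @ rest)"
    using sg by (simp_all add: enc_list_def)
  have "run (For ''i'' (V ''m'') constr_prog) ?s
    (\<lambda>n s'. n \<le> length cl * ((card U * (4 * card P + 11) + 11) + 2) + 2 \<and> ?I (length cl) s' \<and>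
      s' ''i'' 0 = int (length cl) \<and> (\<forall>a. a \<notin> insert ''i'' (writes constr_prog) \<longrightarrow> s' a = ?s a))"
  proof (rule run_For)
    show "?I 0 (upd ?s ''i'' 0 0)" using tab sg0 by auto
    fix k s' assume fr: "\<And>a. a \<notin> insert ''i'' (writes constr_prog) \<Longrightarrow> s' a = ?s a"
    then show "aval (V ''m'') s' = int (length cl)" by simp
    assume k: "k < length cl" "s' ''i'' 0 = int k" and I: "?I k s'"
    obtain Ts' where Ts': "table P s' Ts' (Cs @ map (Pair (s ''g'' 0)) (take k cl))"
      "set Ts' = set Ts \<union> snd ` set (take k cl)" using I by blast
    obtain r u where c: "cl ! k = (r, u)" by (cases "cl ! k")
    have u: "(r, u) \<in> set cl" using c k(1) by (metis nth_mem)
    have dr: "concat (map (enc_constr P) (drop k cl)) @ rest =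
        enc_constr P (r, u) @ (concat (map (enc_constr P) (drop (Suc k) cl)) @ rest)"
      using k(1) c by (simp add: Cons_nth_drop_Suc[symmetric])
    have sg': "seg (s' ''in'') (s' ''p'' 0) (enc_constr P (r, u) @ (concat (map (enc_constr P) (drop (Suc k) cl)) @ rest))"
      using I fr[of "''in''"] unfolding dr by simp
    have len: "length Ts' \<le> card U"
      using table_length_le[OF Ts'(1) U(1)] Ts'(2) U(2) set_take_subset[of k cl] by blast
    have g: "s' ''g'' 0 = s ''g'' 0" "s' ''in'' = s ''in''" "s' ''np'' 0 = int (card P)" using fr P by simp_all
    show "run constr_prog s' (\<lambda>n s''. n \<le> card U * (4 * card P + 11) + 11 \<and> s'' ''i'' 0 = int k \<and>
      ?I (Suc k) (upd s'' ''i'' 0 (int (Suc k))))"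
    proof (rule run_call[OF run_constr[OF P(1) g(3) Ts'(1) sg' t[OF u]]])
      fix n s''
      assume *: "n \<le> length Ts' * (4 * card P + 11) + 11 \<and>
        (\<exists>Ts''. table P s'' Ts'' ((Cs @ map (Pair (s ''g'' 0)) (take k cl)) @ [(s' ''g'' 0, r, u)]) \<and>
          set Ts'' = insert u (set Ts')) \<and>
        seg (s' ''in'') (s'' ''p'' 0) (concat (map (enc_constr P) (drop (Suc k) cl)) @ rest)"
        and fr': "\<And>a. a \<notin> writes constr_prog \<Longrightarrow> s'' a = s' a"
      have "length Ts' * (4 * card P + 11) \<le> card U * (4 * card P + 11)" using len by (rule mult_le_mono1)
      then have n: "n \<le> card U * (4 * card P + 11) + 11" using * by linarith
      have tk: "take (Suc k) cl = take k cl @ [(r, u)]" using k(1) c by (simp add: take_Suc_conv_app_nth)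
      obtain Ts'' where Ts'': "table P s'' Ts'' (Cs @ map (Pair (s ''g'' 0)) (take (Suc k) cl))"
        "set Ts'' = set Ts \<union> snd ` set (take (Suc k) cl)"
        using * unfolding tk g Ts'(2) by auto
      have "table P (upd s'' ''i'' 0 (int (Suc k))) Ts'' (Cs @ map (Pair (s ''g'' 0)) (take (Suc k) cl))"
        using Ts''(1) by simp
      then show "n \<le> card U * (4 * card P + 11) + 11 \<and> s'' ''i'' 0 = int k \<and> ?I (Suc k) (upd s'' ''i'' 0 (int (Suc k)))"
        using n Ts''(2) * g k(2) fr'[of "''i''"] by auto
    qed
  qed
  then have F: "run (For ''i'' (V ''m'') constr_prog) ?s (\<lambda>n s'. 2 + n \<le> length cl * (card U * (4 * card P + 11) + 13) + 4 \<and>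
    (\<exists>Ts'. table P s' Ts' (Cs @ map (Pair (s ''g'' 0)) cl) \<and> set Ts' = set Ts \<union> snd ` set cl) \<and>
    seg (s ''in'') (s' ''p'' 0) rest)"
    by (rule run_conseq) (simp add: algebra_simps)
  show ?thesis unfolding constrs_prog_def using F by (simp add: sg0) (erule run_conseq, simp)
qed

definition collected :: "nat set \<Rightarrow> state \<Rightarrow> lterm set \<Rightarrow> (int \<times> rel \<times> lterm) set \<Rightarrow> nat \<Rightarrow> bool" where
  "collected P s T C L \<longleftrightarrow> (\<exists>Ts Cs. table P s Ts Cs \<and> set Ts = T \<and> set Cs = C \<and> length Cs \<le> L)"

lemma collected_upd [simp]:
  "a \<notin> {''nt'', ''nc'', ''in'', ''tp'', ''cg'', ''cr'', ''ct''} \<Longrightarrow> collected P (upd s a i x) T C L = collected P s T C L"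
  unfolding collected_def by simp

lemma run_constrs':
  fixes s :: state
  assumes P: "finite P" "s ''np'' 0 = int (card P)" and col: "collected P s T C L"
    and sg: "seg (s ''in'') (s ''p'' 0) (enc_list (enc_constr P) cl @ rest)"
    and t: "\<And>r t. (r, t) \<in> set cl \<Longrightarrow> term_over P t"
    and U: "finite U" "T \<union> snd ` set cl \<subseteq> U" and D: "length cl \<le> D"
  shows "run constrs_prog s (\<lambda>n s'. n \<le> D * (card U * (4 * card P + 11) + 13) + 4 \<and>
    collected P s' (T \<union> snd ` set cl) (C \<union> Pair (s ''g'' 0) ` set cl) (L + D) \<and>
    seg (s ''in'') (s' ''p'' 0) rest)"
proof -
  obtain Ts Cs where tab: "table P s Ts Cs" "set Ts = T" "set Cs = C" "length Cs \<le> L"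
    using col unfolding collected_def by blast
  have U': "set Ts \<union> snd ` set cl \<subseteq> U" using U tab by simp
  show ?thesis
  proof (rule run_conseq[OF run_constrs[OF P tab(1) sg t U(1) U']])
    fix n s'
    assume *: "n \<le> length cl * (card U * (4 * card P + 11) + 13) + 4 \<and>
      (\<exists>Ts'. table P s' Ts' (Cs @ map (Pair (s ''g'' 0)) cl) \<and> set Ts' = set Ts \<union> snd ` set cl) \<and>
      seg (s ''in'') (s' ''p'' 0) rest"
    have "length cl * (card U * (4 * card P + 11) + 13) \<le> D * (card U * (4 * card P + 11) + 13)"
      using D by (rule mult_le_mono1)
    moreover obtain Ts' where "table P s' Ts' (Cs @ map (Pair (s ''g'' 0)) cl)" "set Ts' = set Ts \<union> snd ` set cl"
      using * by blast
    then have "collected P s' (T \<union> snd ` set cl) (C \<union> Pair (s ''g'' 0) ` set cl) (L + D)"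
      unfolding collected_def using tab D
      by (intro exI[of _ Ts'] exI[of _ "Cs @ map (Pair (s ''g'' 0)) cl"]) auto
    ultimately show "n \<le> D * (card U * (4 * card P + 11) + 13) + 4 \<and>
      collected P s' (T \<union> snd ` set cl) (C \<union> Pair (s ''g'' 0) ` set cl) (L + D) \<and>
      seg (s ''in'') (s' ''p'' 0) rest" using * by linarith
  qed auto
qed

definition locs_prog :: com where
  "locs_prog =
     Set ''nl'' (Read ''in'' (V ''p'')) ;;
     Inc ''p'' ;;
     For ''g'' (V ''nl'')
       (Assign ''gi'' (Read ''in'' (V ''p'')) (V ''g'') ;; Inc ''p'' ;; constrs_prog)"

lemma writes_locs [simp]: "writes locs_prog = {''nl'', ''g'', ''gi''} \<union> writes constrs_prog"
  by (auto simp: locs_prog_def simp del: writes_constrs) (simp_all add: insert_commute)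

lemma run_locs:
  fixes s :: state
  assumes P: "finite P" "s ''np'' 0 = int (card P)" and col: "collected P s T C L"
    and sg: "seg (s ''in'') (s ''p'' 0) (enc_list (\<lambda>l. int l # enc_list (enc_constr P) (cl l)) ll @ rest)"
    and dist: "distinct ll"
    and t: "\<And>l r t. l \<in> set ll \<Longrightarrow> (r, t) \<in> set (cl l) \<Longrightarrow> term_over P t"
    and U: "finite U" "T \<subseteq> U" "\<And>l. l \<in> set ll \<Longrightarrow> snd ` set (cl l) \<subseteq> U"
    and D: "\<And>l. l \<in> set ll \<Longrightarrow> length (cl l) \<le> D"
  shows "run locs_prog s (\<lambda>n s'. n \<le> length ll * (D * (card U * (4 * card P + 11) + 13) + 8) + 4 \<and>
    collected P s' (T \<union> (\<Union>i<length ll. snd ` set (cl (ll ! i))))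
      (C \<union> (\<Union>i<length ll. Pair (int i) ` set (cl (ll ! i)))) (L + length ll * D) \<and>
    (\<forall>i<length ll. s' ''gi'' (int (ll ! i)) = int i) \<and> s' ''nl'' 0 = int (length ll) \<and>
    seg (s ''in'') (s' ''p'' 0) rest)"
proof -
  let ?e = "\<lambda>l. int l # enc_list (enc_constr P) (cl l)"
  let ?I = "\<lambda>k s'. collected P s' (T \<union> (\<Union>i<k. snd ` set (cl (ll ! i))))
      (C \<union> (\<Union>i<k. Pair (int i) ` set (cl (ll ! i)))) (L + k * D) \<and>
    (\<forall>i<k. s' ''gi'' (int (ll ! i)) = int i) \<and>
    seg (s ''in'') (s' ''p'' 0) (concat (map ?e (drop k ll)) @ rest)"
  let ?s = "upd (upd s ''nl'' 0 (int (length ll))) ''p'' 0 (s ''p'' 0 + 1)"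
  let ?c = "Assign ''gi'' (Read ''in'' (V ''p'')) (V ''g'') ;; Inc ''p'' ;; constrs_prog"
  have sg0: "s ''in'' (s ''p'' 0) = int (length ll)"
    "seg (s ''in'') (s ''p'' 0 + 1) (concat (map ?e ll) @ rest)"
    using sg by (simp_all add: enc_list_def)
  have "run (For ''g'' (V ''nl'') ?c) ?s
    (\<lambda>n s'. n \<le> length ll * ((D * (card U * (4 * card P + 11) + 13) + 6) + 2) + 2 \<and> ?I (length ll) s' \<and>
      s' ''g'' 0 = int (length ll) \<and> (\<forall>a. a \<notin> insert ''g'' (writes ?c) \<longrightarrow> s' a = ?s a))"
  proof (rule run_For)
    show "?I 0 (upd ?s ''g'' 0 0)" using col sg0 by simp
    fix k s' assume fr: "\<And>a. a \<notin> insert ''g'' (writes ?c) \<Longrightarrow> s' a = ?s a"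
    then show "aval (V ''nl'') s' = int (length ll)" by simp
    assume k: "k < length ll" "s' ''g'' 0 = int k" and I: "?I k s'"
    let ?l = "ll ! k"
    have l: "?l \<in> set ll" using k by simp
    have dr: "concat (map ?e (drop k ll)) @ rest =
        int ?l # enc_list (enc_constr P) (cl ?l) @ (concat (map ?e (drop (Suc k) ll)) @ rest)"
      using k(1) by (simp add: Cons_nth_drop_Suc[symmetric])
    have inp: "s' ''in'' = s ''in''" "s' ''np'' 0 = int (card P)" using fr P by simp_all
    have sg': "s ''in'' (s' ''p'' 0) = int ?l"
      "seg (s ''in'') (s' ''p'' 0 + 1) (enc_list (enc_constr P) (cl ?l) @ (concat (map ?e (drop (Suc k) ll)) @ rest))"
      using I unfolding dr by simp_all
    let ?s' = "upd (upd s' ''gi'' (int ?l) (int k)) ''p'' 0 (s' ''p'' 0 + 1)"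
    have U': "(T \<union> (\<Union>i<k. snd ` set (cl (ll ! i)))) \<union> snd ` set (cl ?l) \<subseteq> U"
      using U k by force
    have "run constrs_prog ?s' (\<lambda>n s''. n \<le> D * (card U * (4 * card P + 11) + 13) + 4 \<and>
      collected P s'' ((T \<union> (\<Union>i<k. snd ` set (cl (ll ! i)))) \<union> snd ` set (cl ?l))
        ((C \<union> (\<Union>i<k. Pair (int i) ` set (cl (ll ! i)))) \<union> Pair (?s' ''g'' 0) ` set (cl ?l)) (L + k * D + D) \<and>
      seg (?s' ''in'') (s'' ''p'' 0) (concat (map ?e (drop (Suc k) ll)) @ rest))"
      using I inp sg' t[OF l] D[OF l] by (intro run_constrs' P(1) U(1) U') simp_all
    then have "run constrs_prog ?s' (\<lambda>n s''. 2 + n \<le> D * (card U * (4 * card P + 11) + 13) + 6 \<and>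
      s'' ''g'' 0 = int k \<and> ?I (Suc k) (upd s'' ''g'' 0 (int (Suc k))))"
    proof (rule run_call)
      fix n s''
      assume *: "n \<le> D * (card U * (4 * card P + 11) + 13) + 4 \<and>
      collected P s'' ((T \<union> (\<Union>i<k. snd ` set (cl (ll ! i)))) \<union> snd ` set (cl ?l))
        ((C \<union> (\<Union>i<k. Pair (int i) ` set (cl (ll ! i)))) \<union> Pair (?s' ''g'' 0) ` set (cl ?l)) (L + k * D + D) \<and>
      seg (?s' ''in'') (s'' ''p'' 0) (concat (map ?e (drop (Suc k) ll)) @ rest)"
        and fr': "\<And>a. a \<notin> writes constrs_prog \<Longrightarrow> s'' a = ?s' a"
      have g: "s'' ''g'' 0 = int k" "s'' ''gi'' = (s' ''gi'')(int ?l := int k)"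
        using fr' k(2) by (simp_all add: fun_upd_def)
      have gi: "\<forall>i<Suc k. s'' ''gi'' (int (ll ! i)) = int i"
        using I dist k(1) unfolding g(2) by (auto simp: less_Suc_eq nth_eq_iff_index_eq)
      have "collected P s'' (T \<union> (\<Union>i<Suc k. snd ` set (cl (ll ! i))))
        (C \<union> (\<Union>i<Suc k. Pair (int i) ` set (cl (ll ! i)))) (L + Suc k * D)"
        using * k(2) by (simp add: lessThan_Suc Un_ac add_ac)
      then show "2 + n \<le> D * (card U * (4 * card P + 11) + 13) + 6 \<and>
        s'' ''g'' 0 = int k \<and> ?I (Suc k) (upd s'' ''g'' 0 (int (Suc k)))"
        using * g(1) gi inp(1) by simp
    qed
    then show "run ?c s' (\<lambda>n s''. n \<le> D * (card U * (4 * card P + 11) + 13) + 6 \<and> s'' ''g'' 0 = int k \<and>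
      ?I (Suc k) (upd s'' ''g'' 0 (int (Suc k))))"
      by (simp add: inp sg' k(2)) (erule run_conseq, simp)
  qed
  then have F: "run (For ''g'' (V ''nl'') ?c) ?s (\<lambda>n s'. 2 + n \<le> length ll * (D * (card U * (4 * card P + 11) + 13) + 8) + 4 \<and>
    collected P s' (T \<union> (\<Union>i<length ll. snd ` set (cl (ll ! i))))
      (C \<union> (\<Union>i<length ll. Pair (int i) ` set (cl (ll ! i)))) (L + length ll * D) \<and>
    (\<forall>i<length ll. s' ''gi'' (int (ll ! i)) = int i) \<and> s' ''nl'' 0 = int (length ll) \<and>
    seg (s ''in'') (s' ''p'' 0) rest)"
    by (rule run_conseq) (simp add: algebra_simps)
  show ?thesis unfolding locs_prog_def using F by (simp add: sg0) (erule run_conseq, simp)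
qed

definition edges_prog :: com where
  "edges_prog =
     Set ''ne'' (Read ''in'' (V ''p'')) ;;
     Inc ''p'' ;;
     Set ''ng'' (Plus (Plus (V ''nl'') (Num 1)) (V ''ne'')) ;;
     For ''h'' (V ''ne'')
       (Set ''g'' (Plus (Plus (V ''nl'') (Num 1)) (V ''h'')) ;;
        Assign ''sg'' (V ''g'') (Read ''gi'' (Read ''in'' (V ''p''))) ;;
        Inc ''p'' ;;
        constrs_prog ;;
        Assign ''rs'' (V ''g'') (Read ''in'' (Plus (V ''p'') (Num 1))) ;;
        Assign ''tg'' (V ''g'') (Read ''gi'' (Read ''in'' (Plus (V ''p'') (Num 2)))) ;;
        Assign ''nx'' (V ''g'') (Read ''fs'' (Read ''sg'' (V ''g''))) ;;
        Assign ''fs'' (Read ''sg'' (V ''g'')) (V ''g'') ;;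
        Set ''p'' (Plus (V ''p'') (Num 3)))"

lemmas writes_edges [simp] = arg_cong[OF edges_prog_def, of writes, simplified]

text \<open>The edges with a common source \<open>l\<close> form a linked list with head \<open>fs l\<close>, successor
  function \<open>nx\<close> and end marker \<open>0\<close>; new edges, which have larger indices, are added in front.\<close>

definition linked :: "int set \<Rightarrow> (int \<Rightarrow> int) \<Rightarrow> (int \<Rightarrow> int) \<Rightarrow> (int \<Rightarrow> int) \<Rightarrow> bool" where
  "linked J sg nx fs \<longleftrightarrow>
     (\<forall>q \<in> J. nx q = 0 \<or> nx q \<in> J \<and> sg (nx q) = sg q) \<and>
     (\<forall>l. fs l = 0 \<or> fs l \<in> J \<and> sg (fs l) = l) \<and>
     (\<forall>q \<in> J. fs (sg q) = q \<or> (\<exists>q' \<in> J. q < q' \<and> nx q' = q \<and> sg q' = sg q))"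

lemma linked_insert:
  assumes l: "linked J sg nx fs" and g: "\<And>q. q \<in> J \<Longrightarrow> q < g"
  shows "linked (insert g J) (sg(g := l)) (nx(g := fs l)) (fs(l := g))"
proof -
  have gJ: "g \<notin> J" using g by blast
  have 1: "nx q = 0 \<or> nx q \<in> J \<and> sg (nx q) = sg q" if "q \<in> J" for q
    using l that unfolding linked_def by blast
  have 2: "fs l = 0 \<or> fs l \<in> J \<and> sg (fs l) = l" for l
    using l unfolding linked_def by blast
  have 3: "fs (sg q) = q \<or> (\<exists>q' \<in> J. q < q' \<and> nx q' = q \<and> sg q' = sg q)" if "q \<in> J" for q
    using l that unfolding linked_def by blast
  have 3: "(fs(l := g)) (sg q) = q \<or> (\<exists>q' \<in> insert g J. q < q' \<and> (nx(g := fs l)) q' = q \<and> (sg(g := l)) q' = sg q)"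
    if q: "q \<in> J" for q
  proof (cases "fs (sg q) = q")
    case True
    then show ?thesis using g[OF q] by auto
  next
    case False
    then obtain q' where "q' \<in> J" "q < q'" "nx q' = q" "sg q' = sg q" using 3[OF q] by blast
    then show ?thesis using gJ by (metis fun_upd_other insertI2)
  qed
  show ?thesis
    unfolding linked_def
  proof (intro conjI ballI allI)
    fix q assume q: "q \<in> insert g J"
    show "(nx(g := fs l)) q = 0 \<or> (nx(g := fs l)) q \<in> insert g J \<and> (sg(g := l)) ((nx(g := fs l)) q) = (sg(g := l)) q"
      using q 1[of q] 2[of l] gJ by (cases "q = g") auto
    show "(fs(l := g)) ((sg(g := l)) q) = q \<or>
      (\<exists>q' \<in> insert g J. q < q' \<and> (nx(g := fs l)) q' = q \<and> (sg(g := l)) q' = (sg(g := l)) q)"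
      using q 3[of q] gJ by (cases "q = g") auto
  next
    fix l'
    show "(fs(l := g)) l' = 0 \<or> (fs(l := g)) l' \<in> insert g J \<and> (sg(g := l)) ((fs(l := g)) l') = l'"
      using 2[of l'] gJ by (cases "l' = l") auto
  qed
qed

lemma run_edges:
  fixes s :: state and es :: "lterm edge list" and cl :: "lterm edge \<Rightarrow> (rel \<times> lterm) list"
  assumes P: "finite P" "s ''np'' 0 = int (card P)" and col: "collected P s T C L"
    and nl: "s ''nl'' 0 = int nl"
    and gi: "\<And>l. l \<in> Ls \<Longrightarrow> s ''gi'' (int l) = li l"
    and es: "\<And>e. e \<in> set es \<Longrightarrow> src e \<in> Ls \<and> tgt e \<in> Ls"
    and link: "linked {} (s ''sg'') (s ''nx'') (s ''fs'')"
    and sg: "seg (s ''in'') (s ''p'' 0) (enc_list (\<lambda>e. int (src e) # enc_list (enc_constr P) (cl e) @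
                 [int (act e), of_bool (resets e), int (tgt e)]) es @ rest)"
    and t: "\<And>e r t. e \<in> set es \<Longrightarrow> (r, t) \<in> set (cl e) \<Longrightarrow> term_over P t"
    and U: "finite U" "T \<subseteq> U" "\<And>e. e \<in> set es \<Longrightarrow> snd ` set (cl e) \<subseteq> U"
    and D: "\<And>e. e \<in> set es \<Longrightarrow> length (cl e) \<le> D"
  defines "ix \<equiv> \<lambda>h. int nl + 1 + int h"
  shows "run edges_prog s (\<lambda>n s'. n \<le> length es * (D * (card U * (4 * card P + 11) + 13) + 14) + 5 \<and>
    collected P s' (T \<union> (\<Union>h<length es. snd ` set (cl (es ! h))))
      (C \<union> (\<Union>h<length es. Pair (ix h) ` set (cl (es ! h)))) (L + length es * D) \<and>
    (\<forall>h<length es. s' ''sg'' (ix h) = li (src (es ! h)) \<and> s' ''tg'' (ix h) = li (tgt (es ! h)) \<and>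
       s' ''rs'' (ix h) = of_bool (resets (es ! h))) \<and>
    linked (ix ` {..<length es}) (s' ''sg'') (s' ''nx'') (s' ''fs'') \<and>
    s' ''ng'' 0 = ix (length es) \<and> seg (s ''in'') (s' ''p'' 0) rest \<and>
    (\<forall>a \<in> {''sg'', ''tg'', ''rs'', ''nx''}. s' a (int nl) = s a (int nl)))"
proof -
  let ?e = "\<lambda>e. int (src e) # enc_list (enc_constr P) (cl e) @ [int (act e), of_bool (resets e), int (tgt e)]"
  let ?T = "\<lambda>k. T \<union> (\<Union>h<k. snd ` set (cl (es ! h)))"
  let ?C = "\<lambda>k. C \<union> (\<Union>h<k. Pair (ix h) ` set (cl (es ! h)))"
  let ?I = "\<lambda>k s'. collected P s' (?T k) (?C k) (L + k * D) \<and>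
    (\<forall>h<k. s' ''sg'' (ix h) = li (src (es ! h)) \<and> s' ''tg'' (ix h) = li (tgt (es ! h)) \<and>
       s' ''rs'' (ix h) = of_bool (resets (es ! h))) \<and>
    linked (ix ` {..<k}) (s' ''sg'') (s' ''nx'') (s' ''fs'') \<and>
    seg (s ''in'') (s' ''p'' 0) (concat (map ?e (drop k es)) @ rest) \<and>
    (\<forall>a \<in> {''sg'', ''tg'', ''rs'', ''nx''}. s' a (int nl) = s a (int nl))"
  let ?s = "upd (upd (upd s ''ne'' 0 (int (length es))) ''p'' 0 (s ''p'' 0 + 1)) ''ng'' 0 (ix (length es))"
  let ?c2 = "Assign ''rs'' (V ''g'') (Read ''in'' (Plus (V ''p'') (Num 1))) ;;
        Assign ''tg'' (V ''g'') (Read ''gi'' (Read ''in'' (Plus (V ''p'') (Num 2)))) ;;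
        Assign ''nx'' (V ''g'') (Read ''fs'' (Read ''sg'' (V ''g''))) ;;
        Assign ''fs'' (Read ''sg'' (V ''g'')) (V ''g'') ;;
        Set ''p'' (Plus (V ''p'') (Num 3))"
  let ?c = "Set ''g'' (Plus (Plus (V ''nl'') (Num 1)) (V ''h'')) ;;
        Assign ''sg'' (V ''g'') (Read ''gi'' (Read ''in'' (V ''p''))) ;;
        Inc ''p'' ;; constrs_prog ;; ?c2"
  have ixk: "int nl + 1 + int h = ix h" for h by (simp add: ix_def)
  have sg0: "s ''in'' (s ''p'' 0) = int (length es)"
    "seg (s ''in'') (s ''p'' 0 + 1) (concat (map ?e es) @ rest)"
    using sg by (simp_all add: enc_list_def)
  have "run (For ''h'' (V ''ne'') ?c) ?s
    (\<lambda>n s'. n \<le> length es * ((D * (card U * (4 * card P + 11) + 13) + 12) + 2) + 2 \<and> ?I (length es) s' \<and>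
      s' ''h'' 0 = int (length es) \<and> (\<forall>a. a \<notin> insert ''h'' (writes ?c) \<longrightarrow> s' a = ?s a))"
  proof (rule run_For)
    show "?I 0 (upd ?s ''h'' 0 0)" using col sg0 link by simp
    fix k s' assume fr: "\<And>a. a \<notin> insert ''h'' (writes ?c) \<Longrightarrow> s' a = ?s a"
    then show "aval (V ''ne'') s' = int (length es)" by simp
    assume k: "k < length es" "s' ''h'' 0 = int k" and I: "?I k s'"
    let ?l = "es ! k"
    have l: "?l \<in> set es" using k by simp
    let ?R = "concat (map ?e (drop (Suc k) es)) @ rest"
    let ?M = "[int (act ?l), of_bool (resets ?l), int (tgt ?l)] @ ?R"
    have dr: "concat (map ?e (drop k es)) @ rest = int (src ?l) # enc_list (enc_constr P) (cl ?l) @ ?M"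
      using k(1) by (simp add: Cons_nth_drop_Suc[symmetric])
    have inp: "s' ''in'' = s ''in''" "s' ''np'' 0 = int (card P)" "s' ''nl'' 0 = int nl" "s' ''gi'' = s ''gi''"
      using fr P nl by simp_all
    have sg': "s ''in'' (s' ''p'' 0) = int (src ?l)"
      "seg (s ''in'') (s' ''p'' 0 + 1) (enc_list (enc_constr P) (cl ?l) @ ?M)"
      using I unfolding dr by simp_all
    let ?s' = "upd (upd (upd s' ''g'' 0 (ix k)) ''sg'' (ix k) (li (src ?l))) ''p'' 0 (s' ''p'' 0 + 1)"
    have U': "?T k \<union> snd ` set (cl ?l) \<subseteq> U"
      using U k by force
    have gil: "s ''gi'' (int (src ?l)) = li (src ?l)" "s ''gi'' (int (tgt ?l)) = li (tgt ?l)"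
      using es[OF l] gi by auto
    have "run constrs_prog ?s' (\<lambda>n s''. n \<le> D * (card U * (4 * card P + 11) + 13) + 4 \<and>
      collected P s'' (?T k \<union> snd ` set (cl ?l)) (?C k \<union> Pair (?s' ''g'' 0) ` set (cl ?l)) (L + k * D + D) \<and>
      seg (?s' ''in'') (s'' ''p'' 0) ?M)"
      using I inp sg' t[OF l] D[OF l] by (intro run_constrs' P(1) U(1) U') simp_all
    then have "run constrs_prog ?s' (\<lambda>n s''. run ?c2 s'' (\<lambda>m u. 3 + (n + m) \<le> D * (card U * (4 * card P + 11) + 13) + 12 \<and>
      u ''h'' 0 = int k \<and> ?I (Suc k) (upd u ''h'' 0 (int (Suc k)))))"
    proof (rule run_call)
      fix n s''
      assume *: "n \<le> D * (card U * (4 * card P + 11) + 13) + 4 \<and>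
      collected P s'' (?T k \<union> snd ` set (cl ?l)) (?C k \<union> Pair (?s' ''g'' 0) ` set (cl ?l)) (L + k * D + D) \<and>
      seg (?s' ''in'') (s'' ''p'' 0) ?M"
        and fr': "\<And>a. a \<notin> writes constrs_prog \<Longrightarrow> s'' a = ?s' a"
      have col': "collected P s'' (?T (Suc k)) (?C (Suc k)) (L + Suc k * D)"
        using * k(2) by (simp add: lessThan_Suc Un_ac add_ac)
      have g: "s'' ''g'' 0 = ix k" "s'' ''h'' 0 = int k" "s'' ''in'' = s ''in''" "s'' ''gi'' = s ''gi''"
        "s'' ''rs'' = s' ''rs''" "s'' ''tg'' = s' ''tg''" "s'' ''nx'' = s' ''nx''" "s'' ''fs'' = s' ''fs''"
        "s'' ''sg'' = (s' ''sg'')(ix k := li (src ?l))"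
        using fr' k(2) inp by (simp_all add: fun_upd_def)
      have sg'': "s ''in'' (s'' ''p'' 0 + 1) = of_bool (resets ?l)" "s ''in'' (s'' ''p'' 0 + 2) = int (tgt ?l)"
        "seg (s ''in'') (s'' ''p'' 0 + 3) ?R"
        using * inp(1) by (simp_all add: algebra_simps)
      have n: "n \<le> D * (card U * (4 * card P + 11) + 13) + 4" using * by blast
      have ixe: "ix h = ix k \<longleftrightarrow> h = k" "ix h \<noteq> int nl" "int nl \<noteq> ix h" for h by (auto simp: ix_def)
      have "linked (insert (ix k) (ix ` {..<k})) ((s' ''sg'')(ix k := li (src ?l)))
          ((s' ''nx'')(ix k := s' ''fs'' (li (src ?l)))) ((s' ''fs'')(li (src ?l) := ix k))"
        using I by (intro linked_insert) (auto simp: ix_def)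
      then have lk: "linked (ix ` {..<Suc k}) ((s' ''sg'')(ix k := li (src ?l)))
          ((s' ''nx'')(ix k := s' ''fs'' (li (src ?l)))) ((s' ''fs'')(li (src ?l) := ix k))"
        by (simp add: lessThan_Suc)
      have fields: "\<forall>h<Suc k. (if h = k then li (src ?l) else s' ''sg'' (ix h)) = li (src (es ! h)) \<and>
          (if h = k then li (tgt ?l) else s' ''tg'' (ix h)) = li (tgt (es ! h)) \<and>
          (if h = k then of_bool (resets ?l) else s' ''rs'' (ix h)) = (of_bool (resets (es ! h)) :: int)"
        using I by (simp add: less_Suc_eq)
      have old: "\<forall>a \<in> {''sg'', ''tg'', ''rs'', ''nx''}. s' a (int nl) = s a (int nl)" using I by blast
      show "run ?c2 s'' (\<lambda>m u. 3 + (n + m) \<le> D * (card U * (4 * card P + 11) + 13) + 12 \<and>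
        u ''h'' 0 = int k \<and> ?I (Suc k) (upd u ''h'' 0 (int (Suc k))))"
        using n col' lk fields old sg''(3)
        by (simp add: g gil sg''(1,2) ixe fun_upd_def cong: if_cong del: lessThan_Suc UN_simps UN_insert)
    qed
    then show "run ?c s' (\<lambda>n s''. n \<le> D * (card U * (4 * card P + 11) + 13) + 12 \<and> s'' ''h'' 0 = int k \<and>
      ?I (Suc k) (upd s'' ''h'' 0 (int (Suc k))))"
      by (simp add: inp sg' k(2) gil ixk split del: split_of_bool) (erule run_conseq, erule run_conseq, simp)
  qed
  then have F: "run (For ''h'' (V ''ne'') ?c) ?s (\<lambda>n s'. 3 + n \<le> length es * (D * (card U * (4 * card P + 11) + 13) + 14) + 5 \<and>
    ?I (length es) s' \<and> s' ''ng'' 0 = ix (length es))"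
    by (rule run_conseq) (simp add: algebra_simps)
  show ?thesis unfolding edges_prog_def using F by (simp add: sg0 nl ixk) (erule run_conseq, simp)
qed

lemma card_guard_le:
  assumes "finite g" "finite T" "snd ` g \<subseteq> T"
  shows "card (g :: lterm guard) \<le> 5 * card T"
proof -
  have U: "(UNIV :: rel set) = {Lt, Le, Eq, Ge, Gt}"
    using rel.exhaust by blast
  have fin: "finite (UNIV :: rel set)" "card (UNIV :: rel set) = 5" unfolding U by simp_all
  have "g \<subseteq> UNIV \<times> T" using assms(3) by force
  then have "card g \<le> card ((UNIV :: rel set) \<times> T)" using assms(2) fin by (intro card_mono) auto
  then show ?thesis using fin by (simp add: card_cartesian_product)
qed

lemma UN_nth: "(\<Union>i<length zs. f (zs ! i)) = (\<Union>z \<in> set zs. f z)"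
  by (auto simp: set_conv_nth)

definition parse_prog :: com where
  "parse_prog =
     Set ''p'' (Plus (Read ''in'' (Num 0)) (Num 1)) ;;
     Set ''np'' (Read ''in'' (V ''p'')) ;;
     Set ''p'' (Plus (Plus (V ''p'') (V ''np'')) (Num 1)) ;;
     Assign ''tp'' (Num 0) (Minus (Num 0) (Plus (V ''np'') (Num 1))) ;;
     Set ''nt'' (Num 1) ;;
     Set ''nc'' (Num 0) ;;
     locs_prog ;;
     Assign ''tg'' (V ''nl'') (Read ''gi'' (Read ''in'' (V ''p''))) ;;
     Assign ''sg'' (V ''nl'') (V ''nl'') ;;
     Assign ''rs'' (V ''nl'') (Num 1) ;;
     Inc ''p'' ;;
     edges_prog"

locale pta_input =
  fixes A :: pta and v :: valuation and G :: "lterm guard \<Rightarrow> (rel \<times> lterm) list" and es :: "lterm edge list"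
  assumes wf: "wf_pta A" and det: "deterministic A" and v: "v \<in> valuations (params A)"
    and G: "\<And>g. finite g \<Longrightarrow> enumerates (G g) g" and es: "enumerates es (edges A)"
begin

definition "ll = sorted_list_of_set (locs A)"
definition "nl = length ll"
definition ix :: "nat \<Rightarrow> int" where "ix h = int nl + 1 + int h"
definition "I = ix ` {..<length es}"
definition "ed q = es ! nat (q - int nl - 1)"
definition "li l = int (inv_into {..<nl} ((!) ll) l)"
definition "xs = enc_nats (sorted_list_of_set (actions A)) @
             enc_nats (sorted_list_of_set (params A)) @
             enc_list (\<lambda>l. int l # enc_list (enc_constr (params A)) (G (invar A l))) ll @
             [int (init A)] @
             enc_list (\<lambda>e. int (src e) # enc_list (enc_constr (params A)) (G (guard e)) @
                 [int (act e), of_bool (resets e), int (tgt e)]) es @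
             enc_valuation (params A) v"

lemma ed_ix [simp]: "ed (ix h) = es ! h"
  by (simp add: ed_def ix_def)

lemma I_iff: "q \<in> I \<longleftrightarrow> int nl < q \<and> q < ix (length es)"
proof
  assume "int nl < q \<and> q < ix (length es)"
  then have "q = ix (nat (q - int nl - 1))" "nat (q - int nl - 1) < length es" by (auto simp: ix_def)
  then show "q \<in> I" unfolding I_def by blast
qed (auto simp: I_def ix_def)

sublocale indexed_pta A I "int nl" ed
proof
  have "bij_betw ix {..<length es} I" unfolding I_def bij_betw_def by (auto simp: inj_on_def ix_def)
  moreover have "bij_betw ((!) es) {..<length es} (edges A)"
    using es unfolding enumerates_def by (auto intro: bij_betw_nth)
  ultimately have "bij_betw ((!) es \<circ> inv_into {..<length es} ix) I (edges A)"
    by (blast intro: bij_betw_trans bij_betw_inv_into)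
  moreover have "((!) es \<circ> inv_into {..<length es} ix) q = ed q" if "q \<in> I" for q
    using that \<open>bij_betw ix {..<length es} I\<close> bij_betw_inv_into_right[of ix "{..<length es}" I q]
    by (metis comp_apply ed_ix)
  ultimately show "bij_betw ed I (edges A)" using bij_betw_cong by blast
  show "int nl \<notin> I" by (simp add: I_iff)
qed (rule wf, rule det)

lemma ll: "distinct ll" "set ll = locs A"
  using wf by (simp_all add: ll_def wf_pta_def)

lemma nl_card: "nl = card (locs A)"
  by (simp add: nl_def ll_def)

lemma nl_pos: "0 < nl"
  using wf unfolding nl_card wf_pta_def by (auto simp: card_gt_0_iff)

lemma li_nth: "i < nl \<Longrightarrow> li (ll ! i) = int i"
proof -
  have "inj_on ((!) ll) {..<nl}" using ll(1) by (auto simp: inj_on_def nl_def nth_eq_iff_index_eq)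
  then show "i < nl \<Longrightarrow> li (ll ! i) = int i" unfolding li_def by simp
qed

lemma li_ex:
  assumes "l \<in> locs A"
  obtains i where "i < nl" "ll ! i = l" "li l = int i"
proof -
  obtain i where "i < nl" "ll ! i = l" using assms ll(2) by (metis in_set_conv_nth nl_def)
  then show thesis using li_nth that by blast
qed

lemma li_inj: "l \<in> locs A \<Longrightarrow> l' \<in> locs A \<Longrightarrow> li l = li l' \<longleftrightarrow> l = l'"
  by (metis li_ex of_nat_eq_iff)

lemma li_range: "l \<in> locs A \<Longrightarrow> 0 \<le> li l \<and> li l < int nl"
  by (metis li_ex of_nat_0_le_iff of_nat_less_iff)

definition grp :: "int \<Rightarrow> lterm guard" where
  "grp g = (if 0 \<le> g \<and> g < int nl then invar A (ll ! nat g) else if g \<in> I then guard (ed g) else {})"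

lemma grp_li: "l \<in> locs A \<Longrightarrow> grp (li l) = invar A l"
  unfolding grp_def by (metis li_ex nat_int of_nat_0_le_iff of_nat_less_iff)

lemma grp_edge: "q \<in> I \<Longrightarrow> grp q = guard (ed q)"
  unfolding grp_def by (simp add: I_iff)

lemma edges_set: "set es = edges A" "distinct es"
  using es by (simp_all add: enumerates_def)

lemma edge_wf: "e \<in> edges A \<Longrightarrow> src e \<in> locs A \<and> tgt e \<in> locs A \<and> guard_over (params A) (guard e)"
  using wf unfolding wf_pta_def by blast

lemma invar_over: "l \<in> locs A \<Longrightarrow> guard_over (params A) (invar A l)"
  using wf unfolding wf_pta_def by blast

lemma params_finite: "finite (params A)"
  using wf by (simp add: wf_pta_def)

lemma set_G: "guard_over P g \<Longrightarrow> set (G g) = g"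
  using G[of g] by (simp add: guard_over_def enumerates_def)

lemma length_G:
  assumes "guard_over P g" "snd ` g \<subseteq> LT A"
  shows "length (G g) \<le> 5 * card (LT A)"
proof -
  have "length (G g) = card g"
    using assms(1) G[of g] by (metis distinct_card enumerates_def guard_over_def)
  then show ?thesis using card_guard_le[OF _ finite_LT[OF wf] assms(2)] assms(1) by (simp add: guard_over_def)
qed

lemma LT_subset: "l \<in> locs A \<Longrightarrow> snd ` invar A l \<subseteq> LT A" "e \<in> edges A \<Longrightarrow> snd ` guard e \<subseteq> LT A"
  unfolding LT_def by force+

definition "constraints = {(g, c). c \<in> grp g}"

definition parsed :: "state \<Rightarrow> lterm list \<Rightarrow> (int \<times> rel \<times> lterm) list \<Rightarrow> bool" where
  "parsed s Ts Cs \<longleftrightarrow>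
     table (params A) s Ts Cs \<and> set Ts = terms A \<and> set Cs = constraints \<and>
     length Cs \<le> (nl + length es) * (5 * card (LT A)) \<and>
     s ''nl'' 0 = int nl \<and> s ''ng'' 0 = ix (length es) \<and> s ''np'' 0 = int (card (params A)) \<and>
     (\<forall>q \<in> insert (int nl) I. s ''sg'' q = (if q = int nl then int nl else li (lsrc q)) \<and>
        s ''tg'' q = li (ltgt q) \<and> s ''rs'' q = of_bool (rst q)) \<and>
     s ''nx'' (int nl) = 0 \<and> linked I (s ''sg'') (s ''nx'') (s ''fs'')"

lemma input_state_other: "a \<noteq> ''in'' \<Longrightarrow> input_state zs a = (\<lambda>_. 0)"
  by (simp add: input_state_def fun_eq_iff)

lemma seg_input: "seg (input_state zs ''in'') 0 zs"
  by (simp add: input_state_def seg_def)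

lemma run_parse:
  "run parse_prog (input_state xs) (\<lambda>n s'.
     n \<le> (nl + length es) * (5 * card (LT A) * (card (terms A) * (4 * card (params A) + 11) + 13) + 14) + 19 \<and>
     (\<exists>Ts Cs. parsed s' Ts Cs) \<and>
     seg (s' ''in'') (s' ''p'' 0) (enc_valuation (params A) v) \<and> s' ''in'' = input_state xs ''in'')"
proof -
  let ?P = "params A"
  let ?D = "5 * card (LT A)"
  let ?K = "?D * (card (terms A) * (4 * card ?P + 11) + 13)"
  let ?f = "input_state xs ''in''"
  let ?na = "length (sorted_list_of_set (actions A))"
  define p where "p = 1 + int ?na + 1 + int (card ?P)"
  let ?V = "enc_valuation ?P v"
  let ?E = "enc_list (\<lambda>e. int (src e) # enc_list (enc_constr ?P) (G (guard e)) @
                 [int (act e), of_bool (resets e), int (tgt e)]) es"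
  let ?Lo = "enc_list (\<lambda>l. int l # enc_list (enc_constr ?P) (G (invar A l))) ll"
  have "seg ?f 0 xs" by (rule seg_input)
  then have f: "?f 0 = int ?na" "?f (int ?na + 1) = int (card ?P)"
    and sgL: "seg ?f p (?Lo @ (int (init A) # ?E @ ?V))"
    unfolding xs_def by (simp_all add: enc_nats_def enc_list_def seg_append p_def algebra_simps comp_def concat_map_singleton)
  have f': "?f (1 + int (card (actions A))) = int (card ?P)" using f(2) by (simp add: add.commute)
  define s0 where "s0 = upd (upd (upd (upd (upd (upd (input_state xs) ''p'' 0 (int ?na + 1)) ''np'' 0 (int (card ?P)))
      ''p'' 0 p) ''tp'' 0 (- 1 - int (card ?P))) ''nt'' 0 1) ''nc'' 0 0"
  have neg: "seg ?f (- 1 - int (card ?P)) (coef ?P zero_term)"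
    unfolding seg_def
  proof (intro allI impI)
    fix k assume "k < length (coef ?P zero_term)"
    then show "?f (- 1 - int (card ?P) + int k) = coef ?P zero_term ! k"
      by (auto simp: input_state_def coef_def zero_term_def nth_append)
  qed
  have tz: "term_over ?P zero_term" by (simp add: term_over_def zero_term_def)
  have s0: "s0 ''np'' 0 = int (card ?P)" "s0 ''p'' 0 = p" "s0 ''in'' = ?f"
    and s0z: "s0 ''fs'' = (\<lambda>_. 0)" "s0 ''nx'' = (\<lambda>_. 0)"
    by (simp_all add: s0_def input_state_other)
  have "table ?P s0 [zero_term] []"
    using neg tz by (simp add: table_def s0_def)
  then have col: "collected ?P s0 {zero_term} {} 0"
    unfolding collected_def by (intro exI[of _ "[zero_term]"] exI[of _ "[]"]) simp
  have over: "term_over ?P t" if "guard_over ?P g" "(r, t) \<in> set (G g)" for g r t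
    using that set_G[OF that(1)] by (auto simp: guard_over_def)
  have sgL': "seg (s0 ''in'') (s0 ''p'' 0) (?Lo @ (int (init A) # ?E @ ?V))" using sgL s0 by simp
  have U1: "finite (terms A)" "{zero_term} \<subseteq> terms A" using finite_terms[OF wf] by (simp_all add: terms_def)
  have U2: "snd ` set (G (invar A l)) \<subseteq> terms A" if "l \<in> set ll" for l
    using that LT_subset(1)[of l] set_G[OF invar_over] ll(2) by (auto simp: terms_def)
  have U3: "snd ` set (G (guard e)) \<subseteq> terms A" if "e \<in> set es" for e
    using that LT_subset(2)[of e] set_G edge_wf[of e] edges_set by (force simp: terms_def)
  let ?T1 = "{zero_term} \<union> (\<Union>i<length ll. snd ` set (G (invar A (ll ! i))))"
  let ?C1 = "{} \<union> (\<Union>i<length ll. Pair (int i) ` set (G (invar A (ll ! i))))"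
  have L: "run locs_prog s0 (\<lambda>n s'. n \<le> length ll * (?K + 8) + 4 \<and>
    collected ?P s' ?T1 ?C1 (0 + length ll * ?D) \<and>
    (\<forall>i<length ll. s' ''gi'' (int (ll ! i)) = int i) \<and> s' ''nl'' 0 = int (length ll) \<and>
    seg (s0 ''in'') (s' ''p'' 0) (int (init A) # ?E @ ?V))"
  proof (intro run_locs[where cl = "\<lambda>l. G (invar A l)"] params_finite s0(1) col sgL' U1 U2 ll(1))
    show "term_over ?P t" if "l \<in> set ll" "(r, t) \<in> set (G (invar A l))" for l r t
      using that over invar_over ll(2) by blast
    show "length (G (invar A l)) \<le> ?D" if "l \<in> set ll" for l
      using that length_G[OF invar_over LT_subset(1)] ll(2) by blast
  qed
  let ?c2 = "Assign ''tg'' (V ''nl'') (Read ''gi'' (Read ''in'' (V ''p''))) ;;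
     Assign ''sg'' (V ''nl'') (V ''nl'') ;;
     Assign ''rs'' (V ''nl'') (Num 1) ;;
     Inc ''p'' ;;
     edges_prog"
  let ?B = "(nl + length es) * (?K + 14) + 19"
  let ?Q = "\<lambda>n s'. n \<le> ?B \<and> (\<exists>Ts Cs. parsed s' Ts Cs) \<and> seg (s' ''in'') (s' ''p'' 0) ?V \<and> s' ''in'' = ?f"
  have "run locs_prog s0 (\<lambda>n s'. run ?c2 s' (\<lambda>m u. ?Q (6 + (n + m)) u))"
    using L
  proof (rule run_call)
    fix n s'
    assume *: "n \<le> length ll * (?K + 8) + 4 \<and>
      collected ?P s' ?T1 ?C1 (0 + length ll * ?D) \<and>
      (\<forall>i<length ll. s' ''gi'' (int (ll ! i)) = int i) \<and> s' ''nl'' 0 = int (length ll) \<and>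
      seg (s0 ''in'') (s' ''p'' 0) (int (init A) # ?E @ ?V)"
      and fr: "\<And>a. a \<notin> writes locs_prog \<Longrightarrow> s' a = s0 a"
    have nl: "s' ''nl'' 0 = int nl" using * by (simp add: nl_def)
    have gi: "s' ''gi'' (int l) = li l" if "l \<in> locs A" for l
    proof -
      have "\<forall>i<nl. s' ''gi'' (int (ll ! i)) = int i" using * unfolding nl_def by blast
      then show ?thesis using li_ex[OF that] by metis
    qed
    have init: "init A \<in> locs A" using wf by (simp add: wf_pta_def)
    have s': "s' ''in'' = ?f" "s' ''np'' 0 = int (card ?P)" "s' ''fs'' = (\<lambda>_. 0)" "s' ''nx'' = (\<lambda>_. 0)"
      using fr s0 s0z by simp_all
    have sgE: "?f (s' ''p'' 0) = int (init A)" "seg ?f (s' ''p'' 0 + 1) (?E @ ?V)"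
      using * s0(3) by simp_all
    let ?s1 = "upd (upd (upd (upd s' ''tg'' (int nl) (li (init A))) ''sg'' (int nl) (int nl)) ''rs'' (int nl) 1)
        ''p'' 0 (s' ''p'' 0 + 1)"
    let ?T2 = "?T1 \<union> (\<Union>h<length es. snd ` set (G (guard (es ! h))))"
    let ?C2 = "?C1 \<union> (\<Union>h<length es. Pair (ix h) ` set (G (guard (es ! h))))"
    have E: "run edges_prog ?s1 (\<lambda>n s'. n \<le> length es * (?K + 14) + 5 \<and>
      collected ?P s' ?T2 ?C2 (0 + length ll * ?D + length es * ?D) \<and>
      (\<forall>h<length es. s' ''sg'' (int nl + 1 + int h) = li (src (es ! h)) \<and> s' ''tg'' (int nl + 1 + int h) = li (tgt (es ! h)) \<and>
         s' ''rs'' (int nl + 1 + int h) = of_bool (resets (es ! h))) \<and>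
      linked ((\<lambda>h. int nl + 1 + int h) ` {..<length es}) (s' ''sg'') (s' ''nx'') (s' ''fs'') \<and>
      s' ''ng'' 0 = int nl + 1 + int (length es) \<and> seg (?s1 ''in'') (s' ''p'' 0) ?V \<and>
      (\<forall>a \<in> {''sg'', ''tg'', ''rs'', ''nx''}. s' a (int nl) = ?s1 a (int nl)))"
      unfolding ix_def
    proof (rule run_edges[where cl = "\<lambda>e. G (guard e)" and Ls = "locs A" and L = "0 + length ll * ?D"])
      show "?s1 ''gi'' (int l) = li l" if "l \<in> locs A" for l using gi[OF that] by simp
      show "?T1 \<subseteq> terms A" using U1(2) U2[OF nth_mem] by blast
      show "linked {} (?s1 ''sg'') (?s1 ''nx'') (?s1 ''fs'')" using s'(3) by (simp add: linked_def)
      show "length (G (guard e)) \<le> ?D" if "e \<in> set es" for e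
        using that edges_set(1) edge_wf[of e] length_G[OF _ LT_subset(2)] by blast
      show "term_over ?P t" if "e \<in> set es" "(r, t) \<in> set (G (guard e))" for e r t
        using that over edge_wf[of e] edges_set(1) by blast
    qed (use * nl s' sgE U1 U3 params_finite edge_wf edges_set(1) in simp_all)
    have "run edges_prog ?s1 (\<lambda>m u. ?Q (10 + (n + m)) u)"
      using E
    proof (rule run_call)
      fix m u
      assume **: "m \<le> length es * (?K + 14) + 5 \<and>
        collected ?P u ?T2 ?C2 (0 + length ll * ?D + length es * ?D) \<and>
        (\<forall>h<length es. u ''sg'' (int nl + 1 + int h) = li (src (es ! h)) \<and> u ''tg'' (int nl + 1 + int h) = li (tgt (es ! h)) \<and>
           u ''rs'' (int nl + 1 + int h) = of_bool (resets (es ! h))) \<and>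
        linked ((\<lambda>h. int nl + 1 + int h) ` {..<length es}) (u ''sg'') (u ''nx'') (u ''fs'') \<and>
        u ''ng'' 0 = int nl + 1 + int (length es) \<and> seg (?s1 ''in'') (u ''p'' 0) ?V \<and>
        (\<forall>a \<in> {''sg'', ''tg'', ''rs'', ''nx''}. u a (int nl) = ?s1 a (int nl))"
        and fr': "\<And>a. a \<notin> writes edges_prog \<Longrightarrow> u a = ?s1 a"
      have Gi: "set (G (invar A (ll ! i))) = invar A (ll ! i)" if "i < length ll" for i
        using that set_G[OF invar_over] ll(2) by (metis nth_mem)
      have Ge: "set (G (guard (es ! h))) = guard (es ! h)" if "h < length es" for h
        using that set_G edge_wf[of "es ! h"] edges_set(1) nth_mem by blast
      have T2: "?T2 = terms A"
      proof -
        have "(\<Union>i<length ll. snd ` set (G (invar A (ll ! i)))) = (\<Union>i<length ll. snd ` invar A (ll ! i))"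
          by (rule SUP_cong) (simp_all add: Gi)
        also have "\<dots> = (\<Union>l \<in> locs A. snd ` invar A l)"
          unfolding ll(2)[symmetric] by (rule UN_nth)
        finally have 1: "(\<Union>i<length ll. snd ` set (G (invar A (ll ! i)))) = (\<Union>l \<in> locs A. snd ` invar A l)" .
        have "(\<Union>h<length es. snd ` set (G (guard (es ! h)))) = (\<Union>h<length es. snd ` guard (es ! h))"
          by (rule SUP_cong) (simp_all add: Ge)
        also have "\<dots> = (\<Union>e \<in> edges A. snd ` guard e)"
          unfolding edges_set(1)[symmetric] by (rule UN_nth)
        finally show ?thesis unfolding 1 terms_def LT_def by auto
      qed
      have C2: "?C2 = constraints"
      proof -
        have "(g, c) \<in> ?C2 \<longleftrightarrow> (\<exists>i<nl. g = int i \<and> c \<in> invar A (ll ! i)) \<or>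
            (\<exists>h<length es. g = ix h \<and> c \<in> guard (es ! h))" for g c
          using Gi Ge by (auto simp: nl_def ix_def)
        moreover have "(\<exists>i<nl. g = int i \<and> c \<in> invar A (ll ! i)) \<or>
            (\<exists>h<length es. g = ix h \<and> c \<in> guard (es ! h)) \<longleftrightarrow> c \<in> grp g" for g c
        proof (cases "0 \<le> g \<and> g < int nl")
          case True
          then obtain i where "g = int i" "i < nl" by (metis nonneg_int_cases of_nat_less_iff)
          then show ?thesis by (auto simp: grp_def ix_def)
        next
          case False
          then have "(\<exists>i<nl. g = int i \<and> c \<in> invar A (ll ! i)) \<longleftrightarrow> False" by auto
          moreover have "c \<in> grp g \<longleftrightarrow> g \<in> I \<and> c \<in> guard (ed g)" using False unfolding grp_def by auto
          moreover have "g \<in> I \<and> c \<in> guard (ed g) \<longleftrightarrow> (\<exists>h<length es. g = ix h \<and> c \<in> guard (es ! h))"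
            unfolding I_def by auto
          ultimately show ?thesis by blast
        qed
        ultimately have eq: "(g, c) \<in> ?C2 \<longleftrightarrow> (g, c) \<in> constraints" for g c
          unfolding constraints_def by simp
        show ?thesis
        proof (rule set_eqI)
          fix z show "z \<in> ?C2 \<longleftrightarrow> z \<in> constraints" by (cases z) (simp only: eq)
        qed
      qed
      obtain Ts Cs where tab: "table ?P u Ts Cs" "set Ts = terms A" "set Cs = constraints"
        "length Cs \<le> length ll * ?D + length es * ?D"
        using ** unfolding collected_def T2 C2 by auto
      have "parsed u Ts Cs"
        unfolding parsed_def
      proof (intro conjI ballI)
        show "length Cs \<le> (nl + length es) * (5 * card (LT A))" using tab(4) by (simp add: nl_def algebra_simps)
        show "u ''nl'' 0 = int nl" "u ''np'' 0 = int (card ?P)" using fr' nl s' by simp_all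
        show "u ''ng'' 0 = ix (length es)" using ** by (simp add: ix_def)
        show "u ''nx'' (int nl) = 0" using ** s'(4) by simp
        show "linked I (u ''sg'') (u ''nx'') (u ''fs'')" using ** by (simp add: I_def ix_def[abs_def])
        fix q assume q: "q \<in> insert (int nl) I"
        consider "q = int nl" | h where "h < length es" "q = ix h" "q \<noteq> int nl"
          using q unfolding I_def by (auto simp: ix_def)
        note c = this
        show "u ''sg'' q = (if q = int nl then int nl else li (lsrc q))"
          by (cases rule: c) (use ** in \<open>auto simp: lsrc_def ix_def[symmetric]\<close>)
        show "u ''tg'' q = li (ltgt q)"
          by (cases rule: c) (use ** in \<open>auto simp: ltgt_def ix_def[symmetric]\<close>)
        show "u ''rs'' q = of_bool (rst q)"
          by (cases rule: c) (use ** in \<open>auto simp: rst_def ix_def[symmetric]\<close>)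
      qed (use tab in simp_all)
      moreover have "10 + (n + m) \<le> ?B" using * ** by (simp add: algebra_simps nl_def)
      moreover have "u ''in'' = ?f" using fr' s' by simp
      ultimately show "?Q (10 + (n + m)) u" using ** s' by auto
    qed
    then show "run ?c2 s' (\<lambda>m u. ?Q (6 + (n + m)) u)"
      by (simp add: nl sgE s' gi[OF init]) (erule run_conseq, auto)
  qed
  then show ?thesis
    unfolding parse_prog_def s0_def p_def
    by (simp add: f f' algebra_simps split del: split_of_bool) (erule run_conseq, erule run_conseq, auto simp: algebra_simps)
qed

end

subsection \<open>Firing intervals for a given ranking of the terms\<close>

definition shrink_prog :: com where
  "shrink_prog =
     Set ''g'' (Read ''cg'' (V ''k'')) ;;
     Set ''x'' (Times (Num 2) (Read ''r'' (Read ''ct'' (V ''k'')))) ;;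
     Set ''y'' (Read ''cr'' (V ''k'')) ;;
     If (Less (V ''y'') (Num 3))
       (If (Less (V ''y'') (Num 1)) (Set ''z'' (Minus (V ''x'') (Num 1))) (Set ''z'' (V ''x'')) ;;
        If (Less (V ''z'') (Read ''hi'' (V ''g''))) (Assign ''hi'' (V ''g'') (V ''z'')) Skip)
       Skip ;;
     If (Less (Num 1) (V ''y''))
       (If (Less (Num 3) (V ''y'')) (Set ''z'' (Plus (V ''x'') (Num 1))) (Set ''z'' (V ''x'')) ;;
        If (Less (Read ''lo'' (V ''g'')) (V ''z'')) (Assign ''lo'' (V ''g'') (V ''z'')) Skip)
       Skip"

definition meet_prog :: com where
  "meet_prog =
     Set ''e'' (Plus (V ''nl'') (V ''h'')) ;;
     Set ''x'' (Read ''sg'' (V ''e'')) ;;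
     Set ''y'' (Read ''tg'' (V ''e'')) ;;
     If (Less (Read ''lo'' (V ''e'')) (Read ''lo'' (V ''x''))) (Assign ''lo'' (V ''e'') (Read ''lo'' (V ''x''))) Skip ;;
     If (Less (Read ''hi'' (V ''x'')) (Read ''hi'' (V ''e''))) (Assign ''hi'' (V ''e'') (Read ''hi'' (V ''x''))) Skip ;;
     If (Equal (Read ''rs'' (V ''e'')) (Num 1))
       (If (And (Not (Less (V ''b'') (Read ''lo'' (V ''y'')))) (Not (Less (Read ''hi'' (V ''y'')) (V ''b''))))
          Skip (Assign ''lo'' (V ''e'') (Plus (Read ''hi'' (V ''e'')) (Num 1))))
       (If (Less (Read ''lo'' (V ''e'')) (Read ''lo'' (V ''y''))) (Assign ''lo'' (V ''e'') (Read ''lo'' (V ''y''))) Skip ;;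
        If (Less (Read ''hi'' (V ''y'')) (Read ''hi'' (V ''e''))) (Assign ''hi'' (V ''e'') (Read ''hi'' (V ''y''))) Skip)"

definition last_prog :: com where
  "last_prog =
     If (And (Not (Less (Read ''hi'' (V ''e'')) (Read ''lo'' (V ''e''))))
             (Less (Read ''ml'' (V ''x'')) (Read ''hi'' (V ''e''))))
       (Assign ''ml'' (V ''x'') (Read ''hi'' (V ''e''))) Skip"

definition intervals_prog :: com where
  "intervals_prog =
     Set ''b'' (Times (Num 2) (Read ''r'' (Num 0))) ;;
     For ''g'' (V ''ng'')
       (Assign ''lo'' (V ''g'') (V ''b'') ;;
        Assign ''hi'' (V ''g'') (Minus (Times (Num 2) (V ''nt'')) (Num 1)) ;;
        Assign ''ml'' (V ''g'') (Num (- 1))) ;;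
     For ''k'' (V ''nc'') shrink_prog ;;
     For ''h'' (Minus (V ''ng'') (V ''nl'')) (meet_prog ;; last_prog)"

lemmas writes_shrink [simp] = arg_cong[OF shrink_prog_def, of writes, simplified]
lemmas writes_meet [simp] = arg_cong[OF meet_prog_def, of writes, simplified]
lemmas writes_last [simp] = arg_cong[OF last_prog_def, of writes, simplified]
lemmas writes_intervals [simp] = arg_cong[OF intervals_prog_def, of writes, simplified]

abbreviation between :: "state \<Rightarrow> int \<Rightarrow> int \<Rightarrow> bool" where
  "between s g n \<equiv> s ''lo'' g \<le> n \<and> n \<le> s ''hi'' g"

lemma run_shrink:
  assumes "s ''cg'' (s ''k'' 0) = g" "s ''cr'' (s ''k'' 0) = enc_rel r" "2 * s ''r'' (s ''ct'' (s ''k'' 0)) = x"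
  shows "run shrink_prog s (\<lambda>n s'. n \<le> 13 \<and>
    (\<forall>g' m. between s' g' m \<longleftrightarrow> between s g' m \<and> (g' = g \<longrightarrow> rel_holds r m x)))"
  unfolding shrink_prog_def by (cases r; simp add: assms) auto

lemma run_meet:
  assumes e: "e = s ''nl'' 0 + s ''h'' 0" and x: "x = s ''sg'' e" and y: "y = s ''tg'' e" "y \<noteq> e"
  shows "run meet_prog s (\<lambda>n s'. n \<le> 13 \<and>
    (\<forall>m. between s' e m \<longleftrightarrow> between s e m \<and> between s x m \<and>
       between s y (if s ''rs'' e = 1 then s ''b'' 0 else m)) \<and>
    (\<forall>g'. g' \<noteq> e \<longrightarrow> s' ''lo'' g' = s ''lo'' g' \<and> s' ''hi'' g' = s ''hi'' g') \<and>
    s' ''e'' 0 = e \<and> s' ''x'' 0 = x)"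
proof -
  have [simp]: "s ''nl'' 0 + s ''h'' 0 = e" "s ''sg'' e = x" "s ''tg'' e = y" "y \<noteq> e" "e \<noteq> y"
    using assms by auto
  show ?thesis
    by (cases "x = e"; simp add: meet_prog_def) auto
qed

lemma run_last:
  "run last_prog s (\<lambda>n s'. n \<le> 2 \<and>
    (\<forall>l m. s' ''ml'' l < m \<longleftrightarrow> s ''ml'' l < m \<and>
       (l = s ''x'' 0 \<longrightarrow> (\<forall>m' \<ge> m. \<not> between s (s ''e'' 0) m'))))"
proof -
  have *: "(\<forall>m' \<ge> m. \<not> between s e m') \<longleftrightarrow> s ''hi'' e < s ''lo'' e \<or> s ''hi'' e < m" for e m
    by (auto simp: not_le)
  show ?thesis unfolding * by (simp add: last_prog_def) auto
qed

context pta_input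
begin

lemma parsed_cong:
  assumes "\<And>a. a \<in> {''nt'', ''nc'', ''in'', ''tp'', ''cg'', ''cr'', ''ct'', ''nl'', ''ng'', ''np'', ''sg'', ''tg'', ''rs'', ''nx'', ''fs''} \<Longrightarrow> s' a = s a"
  shows "parsed s' Ts Cs = parsed s Ts Cs"
proof -
  have "table (params A) s' Ts Cs = table (params A) s Ts Cs" by (rule table_cong) (use assms in auto)
  then show ?thesis unfolding parsed_def using assms by simp
qed

definition base_fire :: "(lterm \<Rightarrow> int) \<Rightarrow> int \<Rightarrow> int \<Rightarrow> int \<Rightarrow> bool" where
  "base_fire R M g m \<longleftrightarrow> 2 * R zero_term \<le> m \<and> m \<le> M \<and> isat R (grp g) m"

definition sgx :: "int \<Rightarrow> int" where "sgx q = (if q = int nl then int nl else li (lsrc q))"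

lemma lsrc_locs: "q \<in> I \<Longrightarrow> lsrc q \<in> locs A"
  using bij edge_wf unfolding bij_betw_def lsrc_def by blast

lemma ifire_base_fire:
  assumes "q \<in> insert (int nl) I" "2 * R zero_term \<le> M"
  shows "base_fire R M q m \<and> base_fire R M (sgx q) m \<and>
     base_fire R M (li (ltgt q)) (if rst q then 2 * R zero_term else m) \<longleftrightarrow> ifire R M q m"
proof (cases "q = int nl")
  case True
  have "grp (int nl) = {}" by (simp add: grp_def I_iff)
  moreover have "grp (li (init A)) = invar A (init A)" by (rule grp_li) (use wf in \<open>simp add: wf_pta_def\<close>)
  ultimately show ?thesis
    using True assms(2) by (auto simp: base_fire_def ifire_def sgx_def rst_def ltgt_def isat_def)
next
  case False
  then have q: "q \<in> I" using assms by simp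
  show ?thesis
    using False assms(2) grp_edge[OF q] grp_li[OF lsrc_locs[OF q]] grp_li[OF ltgt_locs[of q]] q
    by (auto simp: base_fire_def ifire_def sgx_def)
qed

lemma sgx_li: "q \<in> I \<Longrightarrow> l \<in> locs A \<Longrightarrow> sgx q = li l \<longleftrightarrow> lsrc q = l"
  using li_inj[OF lsrc_locs] by (auto simp: sgx_def I_iff)

lemma sgx_e0: "l \<in> locs A \<Longrightarrow> sgx (int nl) \<noteq> li l"
  using li_range[of l] by (auto simp: sgx_def)

lemma isat_constraints:
  assumes "set Cs = constraints"
  shows "(\<forall>k<length Cs. fst (Cs ! k) = g \<longrightarrow> rel_holds (fst (snd (Cs ! k))) m (2 * R (snd (snd (Cs ! k))))) \<longleftrightarrow>
    isat R (grp g) m"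
proof -
  have "(\<forall>k<length Cs. fst (Cs ! k) = g \<longrightarrow> rel_holds (fst (snd (Cs ! k))) m (2 * R (snd (snd (Cs ! k))))) \<longleftrightarrow>
    (\<forall>c \<in> constraints. fst c = g \<longrightarrow> rel_holds (fst (snd c)) m (2 * R (snd (snd c))))"
    unfolding assms[symmetric] by (auto simp: all_set_conv_all_nth)
  also have "\<dots> \<longleftrightarrow> isat R (grp g) m" unfolding constraints_def isat_def by auto
  finally show ?thesis .
qed

lemma run_intervals:
  assumes par: "parsed s Ts Cs" and R: "\<And>j. j < length Ts \<Longrightarrow> s ''r'' (int j) = R (Ts ! j)"
    and R0: "\<And>t. t \<in> terms A \<Longrightarrow> 0 \<le> R t \<and> R t < int (length Ts)"
  shows "run intervals_prog s (\<lambda>n s'. n \<le> 22 * (nl + length es + 1) + 15 * length Cs + 7 \<and>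
    s' ''b'' 0 = 2 * R zero_term \<and>
    (\<forall>q \<in> insert (int nl) I. \<forall>m. between s' q m \<longleftrightarrow> ifire R (2 * int (length Ts) - 1) q m) \<and>
    (\<forall>l \<in> locs A. \<forall>m \<ge> 0. s' ''ml'' (li l) < m \<longleftrightarrow> stuck (s' ''lo'') (s' ''hi'') l m))"
proof -
  let ?b = "2 * R zero_term" and ?M = "2 * int (length Ts) - 1"
  let ?ng = "nl + 1 + length es"
  have tab: "table (params A) s Ts Cs" and Cs: "set Cs = constraints" and Ts: "set Ts = terms A"
    using par by (auto simp: parsed_def)
  have nt: "s ''nt'' 0 = int (length Ts)" "s ''nc'' 0 = int (length Cs)" "Ts ! 0 = zero_term" "0 < length Ts"
    using tab by (auto simp: table_def)
  have ng: "s ''ng'' 0 = int ?ng" "s ''nl'' 0 = int nl" using par by (auto simp: parsed_def ix_def)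
  have r0: "s ''r'' 0 = R zero_term" using R[of 0] nt by simp
  have bM: "?b \<le> ?M" using R0[of zero_term] by (simp add: terms_def)
  have b0: "0 \<le> ?b" using R0[of zero_term] by (simp add: terms_def)
  let ?c1 = "Assign ''lo'' (V ''g'') (V ''b'') ;;
        Assign ''hi'' (V ''g'') (Minus (Times (Num 2) (V ''nt'')) (Num 1)) ;;
        Assign ''ml'' (V ''g'') (Num (- 1))"
  let ?s0 = "upd s ''b'' 0 ?b"
  let ?I1 = "\<lambda>k s'. \<forall>g. 0 \<le> g \<and> g < int k \<longrightarrow> s' ''lo'' g = ?b \<and> s' ''hi'' g = ?M \<and> s' ''ml'' g = - 1"
  have 1: "run (For ''g'' (V ''ng'') ?c1) ?s0 (\<lambda>n s'. n \<le> ?ng * (3 + 2) + 2 \<and> ?I1 ?ng s' \<and> s' ''g'' 0 = int ?ng \<and>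
    (\<forall>a. a \<notin> insert ''g'' (writes ?c1) \<longrightarrow> s' a = ?s0 a))"
  proof (rule run_For)
    show "?I1 0 (upd ?s0 ''g'' 0 0)" by simp
    fix k s' assume fr: "\<And>a. a \<notin> insert ''g'' (writes ?c1) \<Longrightarrow> s' a = ?s0 a"
    then show "aval (V ''ng'') s' = int ?ng" using ng by simp
    assume "k < ?ng" "?I1 k s'" "s' ''g'' 0 = int k"
    then show "run ?c1 s' (\<lambda>n s''. n \<le> 3 \<and> s'' ''g'' 0 = int k \<and> ?I1 (Suc k) (upd s'' ''g'' 0 (int (Suc k))))"
      using fr nt by simp
  qed
  let ?I2 = "\<lambda>k s'. \<forall>g. 0 \<le> g \<and> g < int ?ng \<longrightarrow> (\<forall>m. between s' g m \<longleftrightarrow> ?b \<le> m \<and> m \<le> ?M \<and>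
    (\<forall>k'<k. fst (Cs ! k') = g \<longrightarrow> rel_holds (fst (snd (Cs ! k'))) m (2 * R (snd (snd (Cs ! k'))))))"
  have 2: "run (For ''k'' (V ''nc'') shrink_prog) s1 (\<lambda>n s'. n \<le> length Cs * (13 + 2) + 2 \<and> ?I2 (length Cs) s' \<and>
      s' ''k'' 0 = int (length Cs) \<and> (\<forall>a. a \<notin> insert ''k'' (writes shrink_prog) \<longrightarrow> s' a = s1 a))"
    if I1: "?I1 ?ng s1" and fr1: "\<And>a. a \<notin> insert ''g'' (writes ?c1) \<Longrightarrow> s1 a = ?s0 a" for s1
  proof (rule run_For)
    show "?I2 0 (upd s1 ''k'' 0 0)" using I1 by simp
    fix k s' assume fr: "\<And>a. a \<notin> insert ''k'' (writes shrink_prog) \<Longrightarrow> s' a = s1 a"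
    show "aval (V ''nc'') s' = int (length Cs)" using fr fr1 nt by simp
    assume k: "k < length Cs" "s' ''k'' 0 = int k" and I: "?I2 k s'"
    obtain j where j: "j < length Ts" "s ''ct'' (int k) = int j" "Ts ! j = snd (snd (Cs ! k))"
      using tab k(1) by (auto simp: table_def)
    have c: "s ''cg'' (int k) = fst (Cs ! k)" "s ''cr'' (int k) = enc_rel (fst (snd (Cs ! k)))"
      using tab k(1) by (auto simp: table_def)
    have s': "s' ''cg'' = s ''cg''" "s' ''cr'' = s ''cr''" "s' ''ct'' = s ''ct''" "s' ''r'' = s ''r''" using fr fr1 by simp_all
    have "run shrink_prog s' (\<lambda>n s''. n \<le> 13 \<and>
      (\<forall>g' m. between s'' g' m \<longleftrightarrow> between s' g' m \<and>
         (g' = fst (Cs ! k) \<longrightarrow> rel_holds (fst (snd (Cs ! k))) m (2 * R (snd (snd (Cs ! k)))))))"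
      by (rule run_shrink) (use c j k(2) s' R[OF j(1)] in simp_all)
    then show "run shrink_prog s' (\<lambda>n s''. n \<le> 13 \<and> s'' ''k'' 0 = int k \<and> ?I2 (Suc k) (upd s'' ''k'' 0 (int (Suc k))))"
    proof (rule run_call)
      fix n :: nat and s''
      assume *: "n \<le> 13 \<and> (\<forall>g' m. between s'' g' m \<longleftrightarrow> between s' g' m \<and>
         (g' = fst (Cs ! k) \<longrightarrow> rel_holds (fst (snd (Cs ! k))) m (2 * R (snd (snd (Cs ! k))))))"
        and fr': "\<And>a. a \<notin> writes shrink_prog \<Longrightarrow> s'' a = s' a"
      have "s'' ''k'' 0 = int k" using fr' k(2) by simp
      moreover have "?I2 (Suc k) s''"
      proof (intro allI impI)
        fix g m assume g: "0 \<le> g \<and> g < int ?ng"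
        have "between s'' g m \<longleftrightarrow> between s' g m \<and>
         (g = fst (Cs ! k) \<longrightarrow> rel_holds (fst (snd (Cs ! k))) m (2 * R (snd (snd (Cs ! k)))))" using * by blast
        also have "between s' g m \<longleftrightarrow> ?b \<le> m \<and> m \<le> ?M \<and>
          (\<forall>k'<k. fst (Cs ! k') = g \<longrightarrow> rel_holds (fst (snd (Cs ! k'))) m (2 * R (snd (snd (Cs ! k')))))"
          using I g by blast
        finally show "between s'' g m \<longleftrightarrow> ?b \<le> m \<and> m \<le> ?M \<and>
          (\<forall>k'<Suc k. fst (Cs ! k') = g \<longrightarrow> rel_holds (fst (snd (Cs ! k'))) m (2 * R (snd (snd (Cs ! k')))))"
          by (auto simp: less_Suc_eq)
      qed
      ultimately show "n \<le> 13 \<and> s'' ''k'' 0 = int k \<and> ?I2 (Suc k) (upd s'' ''k'' 0 (int (Suc k)))"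
        using * by simp
    qed
  qed
  let ?c3 = "meet_prog ;; last_prog"
  let ?J = "insert (int nl) I"
  let ?I3 = "\<lambda>h s'. (\<forall>g. 0 \<le> g \<and> g < int ?ng \<longrightarrow> (\<forall>m. between s' g m \<longleftrightarrow>
      (if int nl \<le> g \<and> g < int nl + int h then ifire R ?M g m else base_fire R ?M g m))) \<and>
    (\<forall>l. 0 \<le> l \<and> l < int nl \<longrightarrow> (\<forall>m \<ge> 0. s' ''ml'' l < m \<longleftrightarrow>
      (\<forall>q \<in> ?J. q < int nl + int h \<longrightarrow> sgx q = l \<longrightarrow> (\<forall>m' \<ge> m. \<not> ifire R ?M q m'))))"
  have 3: "run (For ''h'' (Minus (V ''ng'') (V ''nl'')) ?c3) s2 (\<lambda>n s'. n \<le> (length es + 1) * (15 + 2) + 2 \<and> ?I3 (length es + 1) s' \<and>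
      s' ''h'' 0 = int (length es + 1) \<and> (\<forall>a. a \<notin> insert ''h'' (writes ?c3) \<longrightarrow> s' a = s2 a))"
    if I2: "?I2 (length Cs) s2" and ml2: "\<And>g. 0 \<le> g \<Longrightarrow> g < int ?ng \<Longrightarrow> s2 ''ml'' g = - 1"
      and fr2: "\<And>a. a \<in> {''ng'', ''nl'', ''sg'', ''tg'', ''rs'', ''b''} \<Longrightarrow> s2 a = ?s0 a" for s2
  proof (rule run_For)
    have "between s2 g m \<longleftrightarrow> base_fire R ?M g m" if "0 \<le> g \<and> g < int ?ng" for g m
      using I2[rule_format, OF that, of m] isat_constraints[OF Cs, of g m R] unfolding base_fire_def by blast
    moreover have "q \<in> ?J \<Longrightarrow> \<not> q < int nl" for q by (auto simp: I_iff)
    ultimately show "?I3 0 (upd s2 ''h'' 0 0)" using ml2 by auto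
    fix h s' assume fr: "\<And>a. a \<notin> insert ''h'' (writes ?c3) \<Longrightarrow> s' a = s2 a"
    show "aval (Minus (V ''ng'') (V ''nl'')) s' = int (length es + 1)" using fr fr2 ng by simp
    assume h: "h < length es + 1" "s' ''h'' 0 = int h" and I: "?I3 h s'"
    let ?e = "int nl + int h"
    have e: "?e \<in> ?J" using h(1) by (auto simp: I_iff ix_def)
    have fields: "s ''sg'' ?e = sgx ?e" "s ''tg'' ?e = li (ltgt ?e)" "s ''rs'' ?e = of_bool (rst ?e)"
      using par e by (auto simp: parsed_def sgx_def)
    have s': "s' ''sg'' = s ''sg''" "s' ''tg'' = s ''tg''" "s' ''rs'' = s ''rs''" "s' ''b'' 0 = ?b" "s' ''nl'' 0 = int nl"
      using fr fr2 ng by simp_all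
    have tg: "0 \<le> li (ltgt ?e)" "li (ltgt ?e) < int nl" using li_range[of "ltgt ?e"] ltgt_locs[of ?e] e by auto
    have sx: "0 \<le> sgx ?e" "sgx ?e < int nl \<or> sgx ?e = ?e"
      using li_range[OF lsrc_locs[of ?e]] e by (auto simp: sgx_def)
    have bt: "between s' g m \<longleftrightarrow> base_fire R ?M g m" if "0 \<le> g" "g < int nl \<or> g = ?e" for g m
    proof -
      have "0 \<le> g \<and> g < int ?ng" "\<not> (int nl \<le> g \<and> g < int nl + int h)" using that h(1) by auto
      then show ?thesis using I by presburger
    qed
    have "run meet_prog s' (\<lambda>n s''. n \<le> 13 \<and>
      (\<forall>m. between s'' ?e m \<longleftrightarrow> between s' ?e m \<and> between s' (sgx ?e) m \<and>
         between s' (li (ltgt ?e)) (if s' ''rs'' ?e = 1 then s' ''b'' 0 else m)) \<and>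
      (\<forall>g'. g' \<noteq> ?e \<longrightarrow> s'' ''lo'' g' = s' ''lo'' g' \<and> s'' ''hi'' g' = s' ''hi'' g') \<and>
      s'' ''e'' 0 = ?e \<and> s'' ''x'' 0 = sgx ?e)"
      by (rule run_meet) (use s' h fields tg in simp_all)
    then have "run meet_prog s' (\<lambda>n s''. run last_prog s'' (\<lambda>n' u. n + n' \<le> 15 \<and> u ''h'' 0 = int h \<and> ?I3 (Suc h) (upd u ''h'' 0 (int (Suc h)))))"
    proof (rule run_call)
      fix n :: nat and s''
      assume *: "n \<le> 13 \<and>
        (\<forall>m. between s'' ?e m \<longleftrightarrow> between s' ?e m \<and> between s' (sgx ?e) m \<and>
           between s' (li (ltgt ?e)) (if s' ''rs'' ?e = 1 then s' ''b'' 0 else m)) \<and>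
        (\<forall>g'. g' \<noteq> ?e \<longrightarrow> s'' ''lo'' g' = s' ''lo'' g' \<and> s'' ''hi'' g' = s' ''hi'' g') \<and>
        s'' ''e'' 0 = ?e \<and> s'' ''x'' 0 = sgx ?e"
        and fr': "\<And>a. a \<notin> writes meet_prog \<Longrightarrow> s'' a = s' a"
      have fe: "between s'' ?e m \<longleftrightarrow> ifire R ?M ?e m" for m
      proof -
        have "between s'' ?e m \<longleftrightarrow> between s' ?e m \<and> between s' (sgx ?e) m \<and>
          between s' (li (ltgt ?e)) (if rst ?e then ?b else m)" using * s' fields by simp
        also have "\<dots> \<longleftrightarrow> base_fire R ?M ?e m \<and> base_fire R ?M (sgx ?e) m \<and>
          base_fire R ?M (li (ltgt ?e)) (if rst ?e then ?b else m)"
          using bt[of ?e] bt[OF sx] bt[OF tg(1)] tg(2) by simp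
        also have "\<dots> \<longleftrightarrow> ifire R ?M ?e m" by (rule ifire_base_fire[of ?e R ?M m, OF e bM])
        finally show ?thesis .
      qed
      have ml: "s'' ''ml'' = s' ''ml''" "s'' ''h'' 0 = int h" using fr' h(2) by simp_all
      show "run last_prog s'' (\<lambda>n' u. n + n' \<le> 15 \<and> u ''h'' 0 = int h \<and> ?I3 (Suc h) (upd u ''h'' 0 (int (Suc h))))"
      proof (rule run_call[OF run_last])
        fix n' :: nat and u
        assume **: "n' \<le> 2 \<and> (\<forall>l m. u ''ml'' l < m \<longleftrightarrow> s'' ''ml'' l < m \<and>
          (l = s'' ''x'' 0 \<longrightarrow> (\<forall>m' \<ge> m. \<not> between s'' (s'' ''e'' 0) m')))"
          and fr'': "\<And>a. a \<notin> writes last_prog \<Longrightarrow> u a = s'' a"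
        have u: "u ''lo'' = s'' ''lo''" "u ''hi'' = s'' ''hi''" "u ''h'' 0 = int h" using fr'' ml by simp_all
        have "between u g m \<longleftrightarrow>
          (if int nl \<le> g \<and> g < int nl + int (Suc h) then ifire R ?M g m else base_fire R ?M g m)"
          if g: "0 \<le> g \<and> g < int ?ng" for g m
        proof (cases "g = ?e")
          case True then show ?thesis using fe u by simp
        next
          case False
          then have "between u g m \<longleftrightarrow> between s' g m" using * u by simp
          also have "\<dots> \<longleftrightarrow> (if int nl \<le> g \<and> g < int nl + int h then ifire R ?M g m else base_fire R ?M g m)"
            using I g by blast
          finally show ?thesis using False by simp
        qed
        moreover have "u ''ml'' l < m \<longleftrightarrow>
            (\<forall>q \<in> ?J. q < int nl + int (Suc h) \<longrightarrow> sgx q = l \<longrightarrow> (\<forall>m' \<ge> m. \<not> ifire R ?M q m'))"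
          if l: "0 \<le> l \<and> l < int nl" and m: "m \<ge> 0" for l m
        proof -
          have "u ''ml'' l < m \<longleftrightarrow> s' ''ml'' l < m \<and> (l = sgx ?e \<longrightarrow> (\<forall>m' \<ge> m. \<not> ifire R ?M ?e m'))"
            using ** * ml(1) fe by simp
          also have "s' ''ml'' l < m \<longleftrightarrow>
            (\<forall>q \<in> ?J. q < int nl + int h \<longrightarrow> sgx q = l \<longrightarrow> (\<forall>m' \<ge> m. \<not> ifire R ?M q m'))"
            using I l m by blast
          also have "\<dots> \<and> (l = sgx ?e \<longrightarrow> (\<forall>m' \<ge> m. \<not> ifire R ?M ?e m')) \<longleftrightarrow>
            (\<forall>q \<in> ?J. q < int nl + int h \<or> q = ?e \<longrightarrow> sgx q = l \<longrightarrow> (\<forall>m' \<ge> m. \<not> ifire R ?M q m'))"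
            using e by blast
          also have "\<dots> \<longleftrightarrow> (\<forall>q \<in> ?J. q < int nl + int (Suc h) \<longrightarrow> sgx q = l \<longrightarrow> (\<forall>m' \<ge> m. \<not> ifire R ?M q m'))"
          proof -
            have "q < int nl + int h \<or> q = ?e \<longleftrightarrow> q < int nl + int (Suc h)" for q by auto
            then show ?thesis by simp
          qed
          finally show ?thesis .
        qed
        ultimately show "n + n' \<le> 15 \<and> u ''h'' 0 = int h \<and> ?I3 (Suc h) (upd u ''h'' 0 (int (Suc h)))"
          using * ** u(3) by simp
      qed
    qed
    then show "run ?c3 s' (\<lambda>n u. n \<le> 15 \<and> u ''h'' 0 = int h \<and> ?I3 (Suc h) (upd u ''h'' 0 (int (Suc h))))"
      by simp
  qed
  have fin: "run (For ''h'' (Minus (V ''ng'') (V ''nl'')) ?c3) s2 (\<lambda>n s'. n \<le> (length es + 1) * 17 + 2 \<and>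
      s' ''b'' 0 = ?b \<and>
      (\<forall>q \<in> ?J. \<forall>m. between s' q m \<longleftrightarrow> ifire R ?M q m) \<and>
      (\<forall>l \<in> locs A. \<forall>m \<ge> 0. s' ''ml'' (li l) < m \<longleftrightarrow> stuck (s' ''lo'') (s' ''hi'') l m))"
    if I2: "?I2 (length Cs) s2" and ml2: "\<And>g. 0 \<le> g \<Longrightarrow> g < int ?ng \<Longrightarrow> s2 ''ml'' g = - 1"
      and fr2: "\<And>a. a \<in> {''ng'', ''nl'', ''sg'', ''tg'', ''rs'', ''b''} \<Longrightarrow> s2 a = ?s0 a" for s2
  proof (rule run_conseq[OF 3[OF that]])
    fix n s'
    assume *: "n \<le> (length es + 1) * (15 + 2) + 2 \<and> ?I3 (length es + 1) s' \<and>
      s' ''h'' 0 = int (length es + 1) \<and> (\<forall>a. a \<notin> insert ''h'' (writes ?c3) \<longrightarrow> s' a = s2 a)"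
    have J: "0 \<le> q \<and> q < int ?ng \<and> int nl \<le> q \<and> q < int nl + int (length es + 1)" if "q \<in> ?J" for q
      using that by (auto simp: I_iff ix_def)
    have f: "between s' q m \<longleftrightarrow> ifire R ?M q m" if "q \<in> ?J" for q m
      using * J[OF that] by presburger
    have "s' ''b'' 0 = ?b" using * fr2 by simp
    moreover have "s' ''ml'' (li l) < m \<longleftrightarrow> stuck (s' ''lo'') (s' ''hi'') l m" if l: "l \<in> locs A" "0 \<le> m" for l m
    proof -
      have "s' ''ml'' (li l) < m \<longleftrightarrow>
        (\<forall>q \<in> ?J. q < int nl + int (length es + 1) \<longrightarrow> sgx q = li l \<longrightarrow> (\<forall>m' \<ge> m. \<not> ifire R ?M q m'))"
        using conjunct2[OF conjunct1[OF conjunct2[OF *]], rule_format, OF li_range[OF l(1)] l(2)] .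
      also have "\<dots> \<longleftrightarrow> (\<forall>q \<in> I. lsrc q = l \<longrightarrow> (\<forall>m' \<ge> m. \<not> between s' q m'))"
      proof -
        have a: "q < int nl + int (length es + 1)" "sgx q = li l \<longleftrightarrow> lsrc q = l"
          "\<And>m. between s' q m \<longleftrightarrow> ifire R ?M q m" if "q \<in> I" for q
          using J[of q] f[of q] sgx_li[OF that l(1)] that by auto
        have "(\<forall>q \<in> ?J. q < int nl + int (length es + 1) \<longrightarrow> sgx q = li l \<longrightarrow> (\<forall>m' \<ge> m. \<not> ifire R ?M q m')) \<longleftrightarrow>
          (\<forall>q \<in> I. q < int nl + int (length es + 1) \<longrightarrow> sgx q = li l \<longrightarrow> (\<forall>m' \<ge> m. \<not> ifire R ?M q m'))"
          using sgx_e0[OF l(1)] by blast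
        also have "\<dots> \<longleftrightarrow> (\<forall>q \<in> I. lsrc q = l \<longrightarrow> (\<forall>m' \<ge> m. \<not> between s' q m'))"
          by (rule ball_cong[OF refl]) (use a in blast)
        finally show ?thesis .
      qed
      finally show ?thesis unfolding stuck_def .
    qed
    ultimately show "n \<le> (length es + 1) * 17 + 2 \<and> s' ''b'' 0 = ?b \<and>
      (\<forall>q \<in> ?J. \<forall>m. between s' q m \<longleftrightarrow> ifire R ?M q m) \<and>
      (\<forall>l \<in> locs A. \<forall>m \<ge> 0. s' ''ml'' (li l) < m \<longleftrightarrow> stuck (s' ''lo'') (s' ''hi'') l m)"
      using * f by simp
  qed
  let ?Q = "\<lambda>n s'. n \<le> 22 * (nl + length es + 1) + 15 * length Cs + 7 \<and>
    s' ''b'' 0 = ?b \<and>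
    (\<forall>q \<in> ?J. \<forall>m. between s' q m \<longleftrightarrow> ifire R ?M q m) \<and>
    (\<forall>l \<in> locs A. \<forall>m \<ge> 0. s' ''ml'' (li l) < m \<longleftrightarrow> stuck (s' ''lo'') (s' ''hi'') l m)"
  have "run (For ''g'' (V ''ng'') ?c1) ?s0 (\<lambda>n1 s1. run (For ''k'' (V ''nc'') shrink_prog) s1
    (\<lambda>n2 s2. run (For ''h'' (Minus (V ''ng'') (V ''nl'')) ?c3) s2 (\<lambda>n3 s3. ?Q (1 + (n1 + (n2 + n3))) s3)))"
  proof (rule run_conseq[OF 1])
    fix n1 s1 assume A1: "n1 \<le> ?ng * (3 + 2) + 2 \<and> ?I1 ?ng s1 \<and> s1 ''g'' 0 = int ?ng \<and>
      (\<forall>a. a \<notin> insert ''g'' (writes ?c1) \<longrightarrow> s1 a = ?s0 a)"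
    then have A1': "?I1 ?ng s1" "\<And>a. a \<notin> insert ''g'' (writes ?c1) \<Longrightarrow> s1 a = ?s0 a" by blast+
    show "run (For ''k'' (V ''nc'') shrink_prog) s1
      (\<lambda>n2 s2. run (For ''h'' (Minus (V ''ng'') (V ''nl'')) ?c3) s2 (\<lambda>n3 s3. ?Q (1 + (n1 + (n2 + n3))) s3))"
    proof (rule run_conseq[OF 2[OF A1']])
      fix n2 s2 assume A2: "n2 \<le> length Cs * (13 + 2) + 2 \<and> ?I2 (length Cs) s2 \<and>
        s2 ''k'' 0 = int (length Cs) \<and> (\<forall>a. a \<notin> insert ''k'' (writes shrink_prog) \<longrightarrow> s2 a = s1 a)"
      then have I2: "?I2 (length Cs) s2" and F: "\<And>a. a \<notin> insert ''k'' (writes shrink_prog) \<Longrightarrow> s2 a = s1 a"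
        by blast+
      have fr2: "s2 a = ?s0 a" if "a \<in> {''ng'', ''nl'', ''sg'', ''tg'', ''rs'', ''b''}" for a
        using that by (elim insertE emptyE; simp add: F A1'(2))
      have ml2: "s2 ''ml'' g = - 1" if "0 \<le> g" "g < int ?ng" for g
        using that A1'(1) by (simp add: F)
      show "run (For ''h'' (Minus (V ''ng'') (V ''nl'')) ?c3) s2 (\<lambda>n3 s3. ?Q (1 + (n1 + (n2 + n3))) s3)"
      proof (rule run_conseq[OF fin[OF I2 ml2 fr2]])
        fix n3 s3 assume A3: "n3 \<le> (length es + 1) * 17 + 2 \<and> s3 ''b'' 0 = ?b \<and>
          (\<forall>q \<in> ?J. \<forall>m. between s3 q m \<longleftrightarrow> ifire R ?M q m) \<and>
          (\<forall>l \<in> locs A. \<forall>m \<ge> 0. s3 ''ml'' (li l) < m \<longleftrightarrow> stuck (s3 ''lo'') (s3 ''hi'') l m)"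
        have "1 + (n1 + (n2 + n3)) \<le> 22 * (nl + length es + 1) + 15 * length Cs + 7"
          using A1 A2 A3 by (auto simp: algebra_simps)
        then show "?Q (1 + (n1 + (n2 + n3))) s3" using A3 by blast
      qed assumption+
    qed
  qed
  note H = this
  have s0: "upd s ''b'' (aval (Num 0) s) (aval (Times (Num 2) (Read ''r'' (Num 0))) s) = ?s0"
    by (simp add: r0)
  show ?thesis
    unfolding intervals_prog_def run_Seq run_Assign s0
    by (rule H)
qed

end

subsection \<open>Exploring the product of two interval automata\<close>

definition push_prog :: com where
  "push_prog =
     If (Less (Num 0) (V ''u''))
       (Set ''m'' (Plus (Times (Plus (Times (V ''u'') (V ''K'')) (V ''x'')) (V ''K'')) (V ''y'')) ;;
        If (Equal (Read ''mk'' (V ''m'')) (V ''st'')) Skip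
          (Assign ''mk'' (V ''m'') (V ''st'') ;;
           Assign ''qe'' (V ''t'') (V ''u'') ;;
           Assign ''qi'' (V ''t'') (V ''x'') ;;
           Assign ''qj'' (V ''t'') (V ''y'') ;;
           Inc ''t''))
       Skip"

definition sibling_prog :: com where
  "sibling_prog =
     Set ''e'' (Read ''qe'' (V ''h'')) ;;
     Set ''i'' (Read ''qi'' (V ''h'')) ;;
     Set ''j'' (Read ''qj'' (V ''h'')) ;;
     Inc ''h'' ;;
     Set ''u'' (Read ''nx'' (V ''e'')) ;;
     Set ''x'' (V ''i'') ;;
     Set ''y'' (V ''j'')"

definition bounds_prog :: com where
  "bounds_prog =
     Set ''u'' (Num 0) ;;
     If (Less (V ''i'') (Read ''lo1'' (V ''e''))) (Set ''x'' (Read ''lo1'' (V ''e''))) (Set ''x'' (V ''i'')) ;;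
     If (Less (V ''j'') (Read ''lo'' (V ''e''))) (Set ''y'' (Read ''lo'' (V ''e''))) (Set ''y'' (V ''j''))"

definition step_prog :: com where
  "step_prog =
     If (Less (Read ''hi1'' (V ''e'')) (V ''x''))
       (If (Less (Read ''hi'' (V ''e'')) (V ''y'')) Skip (Set ''ok'' (Num 0)))
       (If (Less (Read ''hi'' (V ''e'')) (V ''y'')) (Set ''ok'' (Num 0))
          (Set ''f'' (Read ''tg'' (V ''e'')) ;;
           If (Equal (Read ''rs'' (V ''e'')) (Num 1))
             (Set ''x'' (V ''b1'') ;; Set ''y'' (V ''b'') ;; Set ''c'' (V ''b1'') ;; Set ''d'' (V ''b''))
             (Set ''c'' (Read ''hi1'' (V ''e'')) ;; Set ''d'' (Read ''hi'' (V ''e''))) ;;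
           If (Less (Read ''ml1'' (V ''f'')) (V ''c''))
             (If (Less (Read ''ml'' (V ''f'')) (V ''d'')) Skip (Set ''ok'' (Num 0)))
             (If (Less (Read ''ml'' (V ''f'')) (V ''d'')) (Set ''ok'' (Num 0)) Skip) ;;
           Set ''u'' (Read ''fs'' (V ''f''))))"

definition product_prog :: com where
  "product_prog =
     Inc ''st'' ;;
     Set ''K'' (Times (Num 2) (V ''nt'')) ;;
     Set ''h'' (Num 0) ;;
     Set ''t'' (Num 0) ;;
     Set ''ok'' (Num 1) ;;
     Set ''u'' (V ''nl'') ;;
     Set ''x'' (V ''b1'') ;;
     Set ''y'' (V ''b'') ;;
     push_prog ;;
     While (Less (V ''h'') (V ''t'')) (sibling_prog ;; push_prog ;; (bounds_prog ;; step_prog) ;; push_prog)"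

lemmas writes_push [simp] = arg_cong[OF push_prog_def, of writes, simplified]
lemmas writes_sibling [simp] = arg_cong[OF sibling_prog_def, of writes, simplified]
lemmas writes_bounds [simp] = arg_cong[OF bounds_prog_def, of writes, simplified]
lemmas writes_step [simp] = arg_cong[OF step_prog_def, of writes, simplified]
lemmas writes_product [simp] = arg_cong[OF product_prog_def, of writes, simplified]

type_synonym node = "int \<times> int \<times> int"

definition code :: "int \<Rightarrow> node \<Rightarrow> int" where
  "code K = (\<lambda>(u, x, y). (u * K + x) * K + y)"

lemma digit_inj:
  fixes K :: int
  assumes "u * K + x = u' * K + x'" "0 \<le> x" "x < K" "0 \<le> x'" "x' < K"
  shows "u = u' \<and> x = x'"
proof -
  have "K \<noteq> 0" "x div K = 0" "x' div K = 0" using assms(2-5) by simp_all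
  then have "(u * K + x) div K = u" "(u' * K + x') div K = u'" by simp_all
  then show ?thesis using assms(1) by auto
qed

definition box :: "int set \<Rightarrow> int \<Rightarrow> node set" where
  "box J K = J \<times> {0..<K} \<times> {0..<K}"

lemma code_inj: "n \<in> box J K \<Longrightarrow> n' \<in> box J K \<Longrightarrow> code K n = code K n' \<Longrightarrow> n = n'"
  unfolding box_def code_def by (auto dest!: digit_inj)

definition queue :: "int set \<Rightarrow> int \<Rightarrow> state \<Rightarrow> node list \<Rightarrow> bool" where
  "queue J K s ts \<longleftrightarrow> s ''t'' 0 = int (length ts) \<and> s ''K'' 0 = K \<and>
     (\<forall>k<length ts. (s ''qe'' (int k), s ''qi'' (int k), s ''qj'' (int k)) = ts ! k) \<and>
     distinct ts \<and> set ts \<subseteq> box J K \<and>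
     (\<forall>n \<in> box J K. s ''mk'' (code K n) = s ''st'' 0 \<longleftrightarrow> n \<in> set ts) \<and>
     (\<forall>m. s ''mk'' m \<le> s ''st'' 0)"

lemma queue_cong:
  assumes "\<And>a. a \<in> {''t'', ''K'', ''qe'', ''qi'', ''qj'', ''mk'', ''st''} \<Longrightarrow> s' a = s a"
  shows "queue J K s' ts = queue J K s ts"
  unfolding queue_def using assms by simp

lemma queue_add:
  assumes q: "queue J K s ts" and n: "(u, x, y) \<in> box J K" "(u, x, y) \<notin> set ts"
    and s': "s' ''t'' 0 = int (Suc (length ts))" "s' ''K'' 0 = K" "s' ''st'' 0 = s ''st'' 0"
      "\<And>m. s' ''mk'' m = (if m = code K (u, x, y) then s ''st'' 0 else s ''mk'' m)"
      "\<And>k. s' ''qe'' k = (if k = int (length ts) then u else s ''qe'' k)"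
      "\<And>k. s' ''qi'' k = (if k = int (length ts) then x else s ''qi'' k)"
      "\<And>k. s' ''qj'' k = (if k = int (length ts) then y else s ''qj'' k)"
  shows "queue J K s' (ts @ [(u, x, y)])"
  unfolding queue_def
proof (intro conjI ballI allI impI)
  fix k assume "k < length (ts @ [(u, x, y)])"
  then show "(s' ''qe'' (int k), s' ''qi'' (int k), s' ''qj'' (int k)) = (ts @ [(u, x, y)]) ! k"
    using q unfolding queue_def s' by (auto simp: nth_append less_Suc_eq)
next
  fix z assume z: "z \<in> box J K"
  have "code K z = code K (u, x, y) \<longleftrightarrow> z = (u, x, y)" using code_inj[OF z n(1)] by blast
  then show "s' ''mk'' (code K z) = s' ''st'' 0 \<longleftrightarrow> z \<in> set (ts @ [(u, x, y)])"
    using q z unfolding queue_def s' by auto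
qed (use q n s' in \<open>auto simp: queue_def\<close>)

lemma run_push:
  assumes q: "queue J K s ts" and u: "s ''u'' 0 = u" "s ''x'' 0 = x" "s ''y'' 0 = y"
    and bx: "0 < u \<Longrightarrow> (u, x, y) \<in> box J K"
  shows "run push_prog s (\<lambda>n s'. n \<le> 8 \<and>
    queue J K s' (if 0 < u \<and> (u, x, y) \<notin> set ts then ts @ [(u, x, y)] else ts))"
proof -
  have K: "s ''K'' 0 = K" "s ''t'' 0 = int (length ts)" using q by (simp_all add: queue_def)
  have c: "(u * K + x) * K + y = code K (u, x, y)" by (simp add: code_def)
  consider "\<not> 0 < u" | "0 < u" "(u, x, y) \<in> set ts" | "0 < u" "(u, x, y) \<notin> set ts" by blast
  then show ?thesis
  proof cases
    case 1 then show ?thesis using q by (simp add: push_prog_def u)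
  next
    case 2
    then have "s ''mk'' (code K (u, x, y)) = s ''st'' 0" using q bx by (auto simp: queue_def)
    moreover have "queue J K (upd s ''m'' 0 (code K (u, x, y))) ts"
      using q by (subst queue_cong[of _ s]) auto
    ultimately show ?thesis using 2 by (simp add: push_prog_def u K c)
  next
    case 3
    then have "s ''mk'' (code K (u, x, y)) \<noteq> s ''st'' 0" using q bx by (auto simp: queue_def)
    moreover have "queue J K (upd (upd (upd (upd (upd (upd s ''m'' 0 (code K (u, x, y))) ''mk'' (code K (u, x, y)) (s ''st'' 0))
      ''qe'' (int (length ts)) u) ''qi'' (int (length ts)) x) ''qj'' (int (length ts)) y) ''t'' 0 (int (length ts) + 1))
      (ts @ [(u, x, y)])"
      by (rule queue_add[OF q bx[OF 3(1)] 3(2)]) (simp_all add: K)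
    ultimately show ?thesis using 3 by (simp add: push_prog_def u K c)
  qed
qed

locale product = pta_input A v G es
  for A :: pta and v :: valuation and G :: "lterm guard \<Rightarrow> (rel \<times> lterm) list" and es :: "lterm edge list" +
  fixes lo1 hi1 ml1 lo2 hi2 ml2 sg nx fs :: "int \<Rightarrow> int" and b1 b2 K :: int
  assumes linked: "linked I sg nx fs" and nx0: "nx (int nl) = 0" and sg: "\<And>q. q \<in> I \<Longrightarrow> sg q = li (lsrc q)"
    and b: "0 \<le> b1" "b1 < K" "0 \<le> b2" "b2 < K"
    and range: "\<And>q m. q \<in> insert (int nl) I \<Longrightarrow> lo1 q \<le> m \<Longrightarrow> m \<le> hi1 q \<Longrightarrow> 0 \<le> m \<and> m < K"
      "\<And>q m. q \<in> insert (int nl) I \<Longrightarrow> lo2 q \<le> m \<Longrightarrow> m \<le> hi2 q \<Longrightarrow> 0 \<le> m \<and> m < K"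
    and ml: "\<And>l m. l \<in> locs A \<Longrightarrow> 0 \<le> m \<Longrightarrow> ml1 (li l) < m \<longleftrightarrow> stuck lo1 hi1 l m"
      "\<And>l m. l \<in> locs A \<Longrightarrow> 0 \<le> m \<Longrightarrow> ml2 (li l) < m \<longleftrightarrow> stuck lo2 hi2 l m"
begin

abbreviation "J \<equiv> insert (int nl) I"
abbreviation "rch \<equiv> reach lo1 hi1 b1 lo2 hi2 b2"
abbreviation "agr \<equiv> agree lo1 hi1 b1 lo2 hi2 b2"
definition "en q i j \<longleftrightarrow> enabled lo1 hi1 q i \<and> enabled lo2 hi2 q j"
definition "succ1 q i = (if rst q then b1 else max i (lo1 q))"
definition "succ2 q j = (if rst q then b2 else max j (lo2 q))"

definition closed :: "node set \<Rightarrow> node \<Rightarrow> bool" where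
  "closed S = (\<lambda>(q, i, j). (0 < nx q \<longrightarrow> (nx q, i, j) \<in> S) \<and>
     (en q i j \<longrightarrow> 0 < fs (li (ltgt q)) \<longrightarrow> (fs (li (ltgt q)), succ1 q i, succ2 q j) \<in> S))"

lemma J_pos: "q \<in> J \<Longrightarrow> 0 < q"
  using nl_pos by (auto simp: I_iff)

lemma rch_J: "rch q i j \<Longrightarrow> q \<in> J"
  by (induction rule: reach.induct) auto

lemma rch_box: "rch q i j \<Longrightarrow> (q, i, j) \<in> box J K"
proof (induction rule: reach.induct)
  case start
  then show ?case using b by (simp add: box_def)
next
  case (move q i j q')
  have q: "q \<in> J" using rch_J[OF move(1)] .
  have "0 \<le> max i (lo1 q) \<and> max i (lo1 q) < K"
    by (rule range(1)[OF q max.cobounded2]) (use move(2) in \<open>simp add: enabled_def\<close>)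
  moreover have "0 \<le> max j (lo2 q) \<and> max j (lo2 q) < K"
    by (rule range(2)[OF q max.cobounded2]) (use move(3) in \<open>simp add: enabled_def\<close>)
  ultimately show ?case using b move by (auto simp: box_def)
qed

lemma rch_sibling:
  assumes "rch q i j" "0 < nx q"
  shows "rch (nx q) i j"
  using assms(1)
proof cases
  case start
  then show ?thesis using assms(2) nx0 by simp
next
  case (move q0 i0 j0)
  have qI: "q \<in> I" using move(6) .
  have n: "nx q \<in> I \<and> sg (nx q) = sg q" using linked qI assms(2) unfolding linked_def by force
  have "li (lsrc (nx q)) = li (lsrc q)" using n sg[OF qI] sg[of "nx q"] by simp
  then have "lsrc (nx q) = lsrc q" using n qI li_inj[OF lsrc_locs lsrc_locs] by blast
  then show ?thesis using n move(1,2,7) reach.move[OF move(3-5), of "nx q"] by simp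
qed

lemma fs_in: "l \<in> locs A \<Longrightarrow> 0 < fs (li l) \<Longrightarrow> fs (li l) \<in> I \<and> lsrc (fs (li l)) = l"
proof -
  assume l: "l \<in> locs A" "0 < fs (li l)"
  have "fs (li l) = 0 \<or> fs (li l) \<in> I \<and> sg (fs (li l)) = li l" using linked unfolding linked_def by blast
  then have f: "fs (li l) \<in> I" "sg (fs (li l)) = li l" using l(2) by auto
  then have "li (lsrc (fs (li l))) = li l" using sg by simp
  then show ?thesis using f(1) li_inj[OF lsrc_locs l(1)] by blast
qed

lemma ltgt_J: "q \<in> J \<Longrightarrow> ltgt q \<in> locs A"
  using ltgt_locs by auto

lemma rch_child:
  assumes "rch q i j" "en q i j" "0 < fs (li (ltgt q))"
  shows "rch (fs (li (ltgt q))) (succ1 q i) (succ2 q j)"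
  using reach.move[OF assms(1), of "fs (li (ltgt q))"] assms(2,3) fs_in[OF ltgt_J[OF rch_J[OF assms(1)]]]
  unfolding en_def succ1_def succ2_def by blast

lemma siblings_closed:
  assumes S: "\<And>n. n \<in> S \<Longrightarrow> closed S n" and f: "0 < fs (li l) \<Longrightarrow> (fs (li l), i, j) \<in> S"
    and q: "q \<in> I" "lsrc q = l"
  shows "(q, i, j) \<in> S"
  using q
proof (induction "nat (ix (length es) - q)" arbitrary: q rule: less_induct)
  case less
  have s: "sg q = li l" using sg less by simp
  consider "fs (li l) = q" | q' where "q' \<in> I" "q < q'" "nx q' = q" "sg q' = li l"
  proof -
    have "fs (sg q) = q \<or> (\<exists>q' \<in> I. q < q' \<and> nx q' = q \<and> sg q' = sg q)"
      using linked less(2) unfolding linked_def by blast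
    then show thesis using that unfolding s by blast
  qed
  then show ?case
  proof cases
    case 1 then show ?thesis using f J_pos[of q] less by simp
  next
    case 2
    have "li (lsrc q') = li (lsrc q)" using sg[OF 2(1)] 2(4) less(3) by simp
    then have "lsrc q' = l" using li_inj[OF lsrc_locs[OF 2(1)] lsrc_locs[OF less(2)]] less(3) by simp
    then have "(q', i, j) \<in> S" using less(1)[of q'] 2 by (auto simp: I_iff)
    then show ?thesis using S[of "(q', i, j)"] 2 J_pos[of q] less(2) by (auto simp: closed_def)
  qed
qed

lemma rch_complete:
  assumes S: "\<And>n. n \<in> S \<Longrightarrow> closed S n" and st: "(int nl, b1, b2) \<in> S" and r: "rch q i j"
  shows "(q, i, j) \<in> S"
  using r
proof (induction rule: reach.induct)
  case start then show ?case by (rule st)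
next
  case (move q i j q')
  have "0 < fs (li (ltgt q)) \<Longrightarrow> (fs (li (ltgt q)), succ1 q i, succ2 q j) \<in> S"
    using S[OF move.IH] move(2,3) by (auto simp: closed_def en_def)
  then have "(q', succ1 q i, succ2 q j) \<in> S" using siblings_closed[OF S _ move(4,5)] by blast
  then show ?case by (simp add: succ1_def succ2_def)
qed

lemma card_box: "card (box J K) = (length es + 1) * (nat K * nat K)"
proof -
  have "card I = length es" unfolding I_def by (subst card_image) (auto simp: inj_on_def ix_def)
  moreover have "int nl \<notin> I" by (simp add: I_iff)
  moreover have "finite I" by (simp add: I_def)
  ultimately show ?thesis by (simp add: box_def card_cartesian_product)
qed

lemma finite_box: "finite (box J K)"
  by (simp add: box_def I_def)

definition fixed :: "state \<Rightarrow> bool" where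
  "fixed s \<longleftrightarrow> s ''lo1'' = lo1 \<and> s ''hi1'' = hi1 \<and> s ''ml1'' = ml1 \<and> s ''lo'' = lo2 \<and> s ''hi'' = hi2 \<and> s ''ml'' = ml2 \<and>
     s ''nx'' = nx \<and> s ''fs'' = fs \<and> s ''b1'' 0 = b1 \<and> s ''b'' 0 = b2 \<and> s ''nl'' 0 = int nl \<and> 2 * s ''nt'' 0 = K \<and>
     (\<forall>q \<in> J. s ''tg'' q = li (ltgt q) \<and> s ''rs'' q = of_bool (rst q))"

lemma run_child:
  assumes f: "fixed s" and e: "s ''e'' 0 = q" "s ''i'' 0 = i" "s ''j'' 0 = j" "q \<in> J"
  shows "run (bounds_prog ;; step_prog) s (\<lambda>n s'. n \<le> 17 \<and>
    s' ''ok'' 0 = (if agr q i j then s ''ok'' 0 else 0) \<and>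
    (if en q i j then s' ''u'' 0 = fs (li (ltgt q)) \<and> s' ''x'' 0 = succ1 q i \<and> s' ''y'' 0 = succ2 q j
     else s' ''u'' 0 = 0))"
proof -
  let ?x = "max i (lo1 q)" and ?y = "max j (lo2 q)"
  have [simp]: "s ''lo1'' = lo1" "s ''hi1'' = hi1" "s ''ml1'' = ml1" "s ''lo'' = lo2" "s ''hi'' = hi2" "s ''ml'' = ml2"
    "s ''fs'' = fs" "s ''b1'' 0 = b1" "s ''b'' 0 = b2" "s ''tg'' q = li (ltgt q)" "s ''rs'' q = of_bool (rst q)"
    "s ''e'' 0 = q" "s ''i'' 0 = i" "s ''j'' 0 = j"
    using f e by (auto simp: fixed_def)
  have E: "enabled lo1 hi1 q i \<longleftrightarrow> \<not> hi1 q < ?x" "enabled lo2 hi2 q j \<longleftrightarrow> \<not> hi2 q < ?y"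
    by (auto simp: enabled_def)
  have h1: "0 \<le> hi1 q" if "\<not> hi1 q < ?x" using range(1)[OF e(4), of "hi1 q"] that by auto
  have h2: "0 \<le> hi2 q" if "\<not> hi2 q < ?y" using range(2)[OF e(4), of "hi2 q"] that by auto
  have M1: "may_stop lo1 hi1 b1 q \<longleftrightarrow> ml1 (li (ltgt q)) < (if rst q then b1 else hi1 q)" if "\<not> hi1 q < ?x"
    unfolding may_stop_def by (rule ml(1)[OF ltgt_J[OF e(4)], symmetric]) (use h1[OF that] b in simp)
  have M2: "may_stop lo2 hi2 b2 q \<longleftrightarrow> ml2 (li (ltgt q)) < (if rst q then b2 else hi2 q)" if "\<not> hi2 q < ?y"
    unfolding may_stop_def by (rule ml(2)[OF ltgt_J[OF e(4)], symmetric]) (use h2[OF that] b in simp)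
  define s1 where "s1 = upd (upd (upd s ''u'' 0 0) ''x'' 0 (if i < lo1 q then lo1 q else i))
    ''y'' 0 (if j < lo2 q then lo2 q else j)"
  have B: "run bounds_prog s (\<lambda>n s'. n \<le> 5 \<and> s' = s1)"
    unfolding bounds_prog_def by (cases "i < lo1 q"; cases "j < lo2 q") (simp_all add: s1_def)
  have s1f: "s1 ''x'' 0 = ?x" "s1 ''y'' 0 = ?y" "s1 ''u'' 0 = 0" "\<And>a. a \<notin> {''u'', ''x'', ''y''} \<Longrightarrow> s1 a = s a"
    by (simp_all add: s1_def)
  let ?Q = "\<lambda>n s'. n \<le> 12 \<and> s' ''ok'' 0 = (if agr q i j then s ''ok'' 0 else 0) \<and>
    (if en q i j then s' ''u'' 0 = fs (li (ltgt q)) \<and> s' ''x'' 0 = succ1 q i \<and> s' ''y'' 0 = succ2 q j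
     else s' ''u'' 0 = 0)"
  have rest: "run step_prog s1 ?Q"
  proof (cases "hi1 q < ?x"; cases "hi2 q < ?y")
    assume a: "\<not> hi1 q < ?x" "\<not> hi2 q < ?y"
    have en: "en q i j" and ag: "agr q i j \<longleftrightarrow> (may_stop lo1 hi1 b1 q \<longleftrightarrow> may_stop lo2 hi2 b2 q)"
      using a E by (auto simp: en_def agree_def)
    show ?thesis
      unfolding step_prog_def ag M1[OF a(1)] M2[OF a(2)]
      using a en
      by (cases "rst q"; simp add: s1f succ1_def succ2_def del: max_less_iff_conj less_max_iff_disj)
  qed (use E in \<open>simp_all add: step_prog_def s1f en_def agree_def del: max_less_iff_conj less_max_iff_disj\<close>)
  show ?thesis
    unfolding run_Seq
  proof (rule run_conseq[OF B])
    fix n :: nat and s' assume "n \<le> 5 \<and> s' = s1"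
    then show "run step_prog s' (\<lambda>m s'. n + m \<le> 17 \<and> s' ''ok'' 0 = (if agr q i j then s ''ok'' 0 else 0) \<and>
      (if en q i j then s' ''u'' 0 = fs (li (ltgt q)) \<and> s' ''x'' 0 = succ1 q i \<and> s' ''y'' 0 = succ2 q j
       else s' ''u'' 0 = 0))"
      using rest by (elim conjE) (simp only:, erule run_conseq, linarith)
  qed
qed

lemma fixed_cong:
  assumes "fixed s" "\<And>a. a \<in> {''lo1'', ''hi1'', ''ml1'', ''lo'', ''hi'', ''ml'', ''nx'', ''fs'', ''b1'', ''b'', ''nl'', ''nt'', ''tg'', ''rs''} \<Longrightarrow> s' a = s a"
  shows "fixed s'"
  using assms unfolding fixed_def by simp

lemma closed_mono: "closed S n \<Longrightarrow> S \<subseteq> S' \<Longrightarrow> closed S' n"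
  unfolding closed_def by (cases n) auto

definition explored :: "state \<Rightarrow> node list \<Rightarrow> nat \<Rightarrow> bool" where
  "explored s ts k \<longleftrightarrow> queue J K s ts \<and> s ''h'' 0 = int k \<and> k \<le> length ts \<and> (int nl, b1, b2) \<in> set ts \<and>
     (\<forall>q i j. (q, i, j) \<in> set ts \<longrightarrow> rch q i j) \<and> (\<forall>k'<k. closed (set ts) (ts ! k')) \<and>
     (s ''ok'' 0 \<noteq> 0 \<longleftrightarrow> (\<forall>k'<k. \<forall>q i j. ts ! k' = (q, i, j) \<longrightarrow> agr q i j))"

lemma queue_length: "queue J K s ts \<Longrightarrow> length ts \<le> card (box J K)"
  using card_mono[OF finite_box, of "set ts"] distinct_card[of ts] by (simp add: queue_def)

lemma run_explore:
  assumes f: "fixed s" and x: "explored s ts k" and k: "k < length ts"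
  shows "run (sibling_prog ;; push_prog ;; (bounds_prog ;; step_prog) ;; push_prog) s
    (\<lambda>n s'. n \<le> 40 \<and> (\<exists>ts'. explored s' ts' (Suc k)))"
proof -
  obtain q i j where n: "ts ! k = (q, i, j)" by (cases "ts ! k")
  have q: "queue J K s ts" and h: "s ''h'' 0 = int k" using x by (auto simp: explored_def)
  have nd: "s ''qe'' (int k) = q" "s ''qi'' (int k) = i" "s ''qj'' (int k) = j"
    using q k n by (auto simp: queue_def)
  have r: "rch q i j" using x k n nth_mem[OF k] unfolding explored_def by metis
  have qJ: "q \<in> J" using rch_J[OF r] .
  have bx: "0 \<le> i \<and> i < K \<and> 0 \<le> j \<and> j < K" using rch_box[OF r] by (simp add: box_def)
  have nx: "s ''nx'' q = nx q" using f by (simp add: fixed_def)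
  let ?s1 = "upd (upd (upd (upd (upd (upd (upd s ''e'' 0 q) ''i'' 0 i) ''j'' 0 j) ''h'' 0 (int k + 1)) ''u'' 0 (nx q)) ''x'' 0 i) ''y'' 0 j"
  have S: "run sibling_prog s (\<lambda>n s'. n = 7 \<and> s' = ?s1)"
    unfolding sibling_prog_def by (simp add: h nd nx)
  let ?ts1 = "if 0 < nx q \<and> (nx q, i, j) \<notin> set ts then ts @ [(nx q, i, j)] else ts"
  have q1: "queue J K ?s1 ts" using q by (subst queue_cong[of _ s]) auto
  have P1: "run push_prog ?s1 (\<lambda>n s'. n \<le> 8 \<and> queue J K s' ?ts1)"
    by (rule run_push[OF q1]) (use rch_box[OF rch_sibling[OF r]] in auto)
  let ?Q = "\<lambda>n s'. n \<le> 40 \<and> (\<exists>ts'. explored s' ts' (Suc k))"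
  have "run push_prog ?s1 (\<lambda>n2 s2. run (bounds_prog ;; step_prog) s2 (\<lambda>n3 s3. run push_prog s3 (\<lambda>n4. ?Q (7 + (n2 + (n3 + n4))))))"
  proof (rule run_call[OF P1])
    fix n2 :: nat and s2
    assume A2: "n2 \<le> 8 \<and> queue J K s2 ?ts1" and fr2: "\<And>a. a \<notin> writes push_prog \<Longrightarrow> s2 a = ?s1 a"
    have f2: "fixed s2" by (rule fixed_cong[OF f], elim insertE emptyE; simp add: fr2)
    have e2: "s2 ''e'' 0 = q" "s2 ''i'' 0 = i" "s2 ''j'' 0 = j" "s2 ''ok'' = s ''ok''" "s2 ''h'' 0 = int k + 1"
      using fr2 by simp_all
    show "run (bounds_prog ;; step_prog) s2 (\<lambda>n3 s3. run push_prog s3 (\<lambda>n4. ?Q (7 + (n2 + (n3 + n4)))))"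
    proof (rule run_call[OF run_child[OF f2 e2(1-3) qJ]])
      fix n3 :: nat and s3
      assume A3: "n3 \<le> 17 \<and> s3 ''ok'' 0 = (if agr q i j then s2 ''ok'' 0 else 0) \<and>
        (if en q i j then s3 ''u'' 0 = fs (li (ltgt q)) \<and> s3 ''x'' 0 = succ1 q i \<and> s3 ''y'' 0 = succ2 q j
         else s3 ''u'' 0 = 0)"
        and fr3: "\<And>a. a \<notin> writes (bounds_prog ;; step_prog) \<Longrightarrow> s3 a = s2 a"
      have "queue J K s3 ?ts1 = queue J K s2 ?ts1"
        by (rule queue_cong, elim insertE emptyE; simp add: fr3)
      then have q3: "queue J K s3 ?ts1" using A2 by blast
      have u3: "en q i j \<and> s3 ''u'' 0 = fs (li (ltgt q)) \<and> s3 ''x'' 0 = succ1 q i \<and> s3 ''y'' 0 = succ2 q j"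
        if "0 < s3 ''u'' 0" using A3 that by (auto split: if_splits)
      have r3: "rch (s3 ''u'' 0) (s3 ''x'' 0) (s3 ''y'' 0)" if "0 < s3 ''u'' 0"
        using rch_child[OF r] u3[OF that] that by auto
      let ?c = "(s3 ''u'' 0, s3 ''x'' 0, s3 ''y'' 0)"
      let ?ts2 = "if 0 < s3 ''u'' 0 \<and> ?c \<notin> set ?ts1 then ?ts1 @ [?c] else ?ts1"
      have ok3: "s3 ''ok'' 0 = (if agr q i j then s ''ok'' 0 else 0)" "s3 ''h'' 0 = int (Suc k)"
        using A3 e2 fr3 by simp_all
      have n3: "n3 \<le> 17" and en3: "en q i j \<Longrightarrow> s3 ''u'' 0 = fs (li (ltgt q)) \<and> s3 ''x'' 0 = succ1 q i \<and> s3 ''y'' 0 = succ2 q j"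
        using A3 by auto
      show "run push_prog s3 (\<lambda>n4. ?Q (7 + (n2 + (n3 + n4))))"
      proof (rule run_call[OF run_push[OF q3 refl refl refl rch_box[OF r3]]])
        fix n4 :: nat and s4
        assume A4: "n4 \<le> 8 \<and> queue J K s4 ?ts2" and fr4: "\<And>a. a \<notin> writes push_prog \<Longrightarrow> s4 a = s3 a"
        have pre: "\<exists>zs. ?ts2 = ts @ zs" by auto
        then obtain zs where zs: "?ts2 = ts @ zs" ..
        have sub: "set ts \<subseteq> set ?ts2" unfolding zs by simp
        have nth: "?ts2 ! k' = ts ! k'" if "k' < Suc k" for k' unfolding zs using that k by (simp add: nth_append)
        have "explored s4 ?ts2 (Suc k)"
          unfolding explored_def
        proof (intro conjI allI impI)
          show "queue J K s4 ?ts2" using A4 by blast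
          show "s4 ''h'' 0 = int (Suc k)" using fr4 ok3 by simp
          show "Suc k \<le> length ?ts2" unfolding zs using k by simp
          show "(int nl, b1, b2) \<in> set ?ts2" using x sub by (auto simp: explored_def)
          show "rch q' i' j'" if "(q', i', j') \<in> set ?ts2" for q' i' j'
          proof -
            have "(q', i', j') \<in> set ts \<or> 0 < nx q \<and> (q', i', j') = (nx q, i, j) \<or> 0 < s3 ''u'' 0 \<and> (q', i', j') = ?c"
              using that by (auto split: if_splits)
            then show ?thesis using x rch_sibling[OF r] r3 unfolding explored_def by auto
          qed
          show "closed (set ?ts2) (?ts2 ! k')" if "k' < Suc k" for k'
          proof (cases "k' = k")
            case False
            then show ?thesis using x that nth[OF that] closed_mono[OF _ sub] by (auto simp: explored_def)
          next
            case True
            have c1: "(nx q, i, j) \<in> set ?ts2" if "0 < nx q" using that by auto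
            have c2: "(fs (li (ltgt q)), succ1 q i, succ2 q j) \<in> set ?ts2" if "en q i j" "0 < fs (li (ltgt q))"
            proof -
              have "?c = (fs (li (ltgt q)), succ1 q i, succ2 q j)" using en3[OF that(1)] by simp
              moreover have "?c \<in> set ?ts2" using en3[OF that(1)] that(2) by simp
              ultimately show ?thesis by metis
            qed
            show ?thesis unfolding True nth[OF lessI] n closed_def using c1 c2 by blast
          qed
          have "s4 ''ok'' 0 = (if agr q i j then s ''ok'' 0 else 0)" using fr4 ok3 by simp
          moreover have "s ''ok'' 0 \<noteq> 0 \<longleftrightarrow> (\<forall>k'<k. \<forall>q i j. ts ! k' = (q, i, j) \<longrightarrow> agr q i j)"
            using x by (simp add: explored_def)
          moreover have "(\<forall>k'<Suc k. \<forall>q i j. ?ts2 ! k' = (q, i, j) \<longrightarrow> agr q i j) \<longleftrightarrow>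
            (\<forall>k'<Suc k. \<forall>q i j. ts ! k' = (q, i, j) \<longrightarrow> agr q i j)"
            using nth by metis
          moreover have "\<dots> \<longleftrightarrow> (\<forall>k'<k. \<forall>q i j. ts ! k' = (q, i, j) \<longrightarrow> agr q i j) \<and> agr q i j"
            using n by (auto simp: less_Suc_eq)
          ultimately show "s4 ''ok'' 0 \<noteq> 0 \<longleftrightarrow> (\<forall>k'<Suc k. \<forall>q i j. ?ts2 ! k' = (q, i, j) \<longrightarrow> agr q i j)" by presburger
        qed
        then show "?Q (7 + (n2 + (n3 + n4))) s4" using A2 n3 A4 by (intro conjI exI) linarith+
      qed
    qed
  qed
  note H = this
  show ?thesis
    apply (subst run_Seq)
    apply (rule run_conseq[OF S])
    apply (elim conjE)
    apply (simp only: run_Seq[of push_prog] run_Seq[of "bounds_prog ;; step_prog"])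
    using H by (simp only: run_Seq[of push_prog] run_Seq[of "bounds_prog ;; step_prog"])
qed

end

context product
begin

lemma run_product:
  assumes f: "fixed s" and mk: "\<And>m. s ''mk'' m \<le> s ''st'' 0"
  shows "run product_prog s (\<lambda>n s'. n \<le> (length es + 1) * (nat K * nat K) * 41 + 18 \<and>
    (s' ''ok'' 0 \<noteq> 0 \<longleftrightarrow> (\<forall>q i j. rch q i j \<longrightarrow> agr q i j)) \<and> (\<forall>m. s' ''mk'' m \<le> s' ''st'' 0))"
proof -
  have fs: "s ''b1'' 0 = b1" "s ''b'' 0 = b2" "s ''nl'' 0 = int nl" "2 * s ''nt'' 0 = K"
    using f by (simp_all add: fixed_def)
  let ?n0 = "(int nl, b1, b2)"
  define s1 where "s1 = upd (upd (upd (upd (upd (upd (upd (upd s ''st'' 0 (s ''st'' 0 + 1)) ''K'' 0 K) ''h'' 0 0) ''t'' 0 0)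
    ''ok'' 0 1) ''u'' 0 (int nl)) ''x'' 0 b1) ''y'' 0 b2"
  have mk1: "s ''mk'' m \<noteq> s ''st'' 0 + 1" "s ''mk'' m \<le> s ''st'' 0 + 1" for m using mk[of m] by linarith+
  have q1: "queue J K s1 []" by (simp add: queue_def s1_def mk1)
  have u1: "s1 ''u'' 0 = int nl" "s1 ''x'' 0 = b1" "s1 ''y'' 0 = b2" by (simp_all add: s1_def)
  have n0: "?n0 \<in> box J K" using b by (simp add: box_def)
  have P: "run push_prog s1 (\<lambda>n s'. n \<le> 8 \<and> queue J K s' (if 0 < int nl \<and> ?n0 \<notin> set [] then [] @ [?n0] else []))"
    by (rule run_push[OF q1 u1 n0])
  let ?body = "sibling_prog ;; push_prog ;; (bounds_prog ;; step_prog) ;; push_prog"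
  let ?I = "\<lambda>s'. \<exists>ts k. explored s' ts k"
  let ?\<mu> = "\<lambda>s'. card (box J K) - nat (s' ''h'' 0)"
  have W: "run (While (Less (V ''h'') (V ''t'')) ?body) s2 (\<lambda>n s'. n \<le> ?\<mu> s2 * (40 + 1) + 1 \<and>
      ?I s' \<and> \<not> bval (Less (V ''h'') (V ''t'')) s' \<and> (\<forall>a. a \<notin> writes ?body \<longrightarrow> s' a = s2 a))"
    if f2: "fixed s2" and x2: "?I s2" for s2
  proof (rule run_While)
    fix s' assume x: "?I s'" and fr: "\<And>a. a \<notin> writes ?body \<Longrightarrow> s' a = s2 a" and bv: "bval (Less (V ''h'') (V ''t'')) s'"
    have f': "fixed s'" by (rule fixed_cong[OF f2], elim insertE emptyE; simp add: fr)
    obtain ts k where x: "explored s' ts k" using x by blast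
    then have q: "queue J K s' ts" and h: "s' ''h'' 0 = int k" by (simp_all add: explored_def)
    have k: "k < length ts" using bv q h by (simp add: queue_def)
    show "run ?body s' (\<lambda>n s''. n \<le> 40 \<and> ?I s'' \<and> ?\<mu> s'' < ?\<mu> s')"
    proof (rule run_conseq[OF run_explore[OF f' x k]])
      fix n :: nat and s'' assume *: "n \<le> 40 \<and> (\<exists>ts'. explored s'' ts' (Suc k))"
      then obtain ts' where "explored s'' ts' (Suc k)" by blast
      then have "s'' ''h'' 0 = int (Suc k)" by (simp add: explored_def)
      then have "?\<mu> s'' < ?\<mu> s'" using h k queue_length[OF q] by simp
      then show "n \<le> 40 \<and> ?I s'' \<and> ?\<mu> s'' < ?\<mu> s'" using * by blast
    qed
  qed (rule x2)
  let ?Q = "\<lambda>n s'. n \<le> (length es + 1) * (nat K * nat K) * 41 + 18 \<and>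
    (s' ''ok'' 0 \<noteq> 0 \<longleftrightarrow> (\<forall>q i j. rch q i j \<longrightarrow> agr q i j)) \<and> (\<forall>m. s' ''mk'' m \<le> s' ''st'' 0)"
  have H: "run push_prog s1 (\<lambda>n1 s2. run (While (Less (V ''h'') (V ''t'')) ?body) s2 (\<lambda>n2. ?Q (8 + (n1 + n2))))"
  proof (rule run_call[OF P])
    fix n1 :: nat and s2
    assume A: "n1 \<le> 8 \<and> queue J K s2 (if 0 < int nl \<and> ?n0 \<notin> set [] then [] @ [?n0] else [])"
      and fr: "\<And>a. a \<notin> writes push_prog \<Longrightarrow> s2 a = s1 a"
    have q2: "queue J K s2 [?n0]" using A nl_pos by simp
    have s2: "s2 ''h'' 0 = 0" "s2 ''ok'' 0 = 1" using fr by (simp_all add: s1_def)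
    have f2: "fixed s2" by (rule fixed_cong[OF f], elim insertE emptyE; simp add: fr s1_def)
    have x2: "explored s2 [?n0] 0"
      unfolding explored_def using q2 s2 by (auto intro: reach.start)
    show "run (While (Less (V ''h'') (V ''t'')) ?body) s2 (\<lambda>n2. ?Q (8 + (n1 + n2)))"
    proof (rule run_conseq[OF W[OF f2]])
      show "?I s2" using x2 by blast
      fix n2 s' assume B: "n2 \<le> ?\<mu> s2 * (40 + 1) + 1 \<and>
        ?I s' \<and> \<not> bval (Less (V ''h'') (V ''t'')) s' \<and> (\<forall>a. a \<notin> writes ?body \<longrightarrow> s' a = s2 a)"
      then obtain ts k where x: "explored s' ts k" by blast
      then have q: "queue J K s' ts" and h: "s' ''h'' 0 = int k" and kl: "k \<le> length ts" by (simp_all add: explored_def)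
      have k: "k = length ts" using B q h kl by (simp add: queue_def)
      have cl: "closed (set ts) n" if "n \<in> set ts" for n
        using that x k unfolding explored_def by (metis in_set_conv_nth)
      have rs: "rch q i j \<longleftrightarrow> (q, i, j) \<in> set ts" for q i j
        using x rch_complete[of "set ts", OF cl] unfolding explored_def by blast
      have "s' ''ok'' 0 \<noteq> 0 \<longleftrightarrow> (\<forall>k'<k. \<forall>q i j. ts ! k' = (q, i, j) \<longrightarrow> agr q i j)"
        using x by (simp add: explored_def)
      also have "\<dots> \<longleftrightarrow> (\<forall>q i j. (q, i, j) \<in> set ts \<longrightarrow> agr q i j)"
        unfolding k by (metis in_set_conv_nth)
      finally have "s' ''ok'' 0 \<noteq> 0 \<longleftrightarrow> (\<forall>q i j. rch q i j \<longrightarrow> agr q i j)" unfolding rs .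
      moreover have "\<forall>m. s' ''mk'' m \<le> s' ''st'' 0" using q by (simp add: queue_def)
      moreover have "8 + (n1 + n2) \<le> (length es + 1) * (nat K * nat K) * 41 + 18"
        using A B s2(1) unfolding card_box by simp
      ultimately show "?Q (8 + (n1 + n2)) s'" by blast
    qed
  qed
  show ?thesis
    unfolding product_prog_def
    using H by (simp add: s1_def fs) (erule run_conseq, erule run_conseq, simp)
qed

end

subsection \<open>The ranking of the terms under the given valuation\<close>

definition eval_prog :: com where
  "eval_prog =
     Set ''x'' (Num 0) ;;
     Set ''y'' (Num 1) ;;
     For ''k'' (V ''np'')
       (Set ''x'' (Plus (Times (V ''x'') (Read ''in'' (Plus (Plus (V ''p'') (Times (Num 2) (V ''k''))) (Num 1))))
          (Times (Times (Read ''in'' (Plus (Read ''tp'' (V ''i'')) (V ''k'')))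
             (Read ''in'' (Plus (V ''p'') (Times (Num 2) (V ''k''))))) (V ''y''))) ;;
        Set ''y'' (Times (V ''y'') (Read ''in'' (Plus (Plus (V ''p'') (Times (Num 2) (V ''k''))) (Num 1))))) ;;
     Assign ''w'' (V ''i'') (Plus (V ''x'') (Times (Read ''in'' (Plus (Read ''tp'' (V ''i'')) (V ''np''))) (V ''y'')))"

definition count_prog :: com where
  "count_prog =
     Assign ''r'' (V ''i'') (Num 0) ;;
     For ''j'' (V ''nt'')
       (If (Less (Read ''w'' (V ''j'')) (Read ''w'' (V ''i'')))
          (Assign ''r'' (V ''i'') (Plus (Read ''r'' (V ''i'')) (Num 1))) Skip)"

definition rank_prog :: com where
  "rank_prog = For ''i'' (V ''nt'') eval_prog ;; For ''i'' (V ''nt'') count_prog"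

lemmas writes_eval [simp] = arg_cong[OF eval_prog_def, of writes, simplified]
lemmas writes_count [simp] = arg_cong[OF count_prog_def, of writes, simplified]
lemmas writes_rank [simp] = arg_cong[OF rank_prog_def, of writes, simplified]

lemma seg_pairs:
  "seg f p (concat (map (\<lambda>z. [a z, b z]) zs)) \<Longrightarrow> k < length zs \<Longrightarrow>
    f (p + 2 * int k) = a (zs ! k) \<and> f (p + 2 * int k + 1) = b (zs ! k)"
proof (induction zs arbitrary: p k)
  case (Cons z zs)
  then show ?case
    by (cases k) (auto simp: algebra_simps dest: Cons.IH[of "p + 2"])
qed simp

lemma seg_nth: "seg f p ys \<Longrightarrow> k < length ys \<Longrightarrow> f (p + int k) = ys ! k"
  by (simp add: seg_def)

lemma card_Suc_filter:
  "card {j'. j' < Suc j \<and> Pr j'} = card {j'. j' < j \<and> Pr j'} + of_bool (Pr j)"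
proof -
  have "{j'. j' < Suc j \<and> Pr j'} = (if Pr j then insert j {j'. j' < j \<and> Pr j'} else {j'. j' < j \<and> Pr j'})"
    by (auto simp: less_Suc_eq)
  then show ?thesis by simp
qed

lemma run_eval:
  fixes s :: state and w :: valuation and P :: "nat set"
  defines "ps \<equiv> sorted_list_of_set P"
  defines "Y \<equiv> (\<Prod>m<card P. snd (quotient_of (w (ps ! m))))"
  assumes P: "finite P" "s ''np'' 0 = int (card P)"
    and t: "seg (s ''in'') (s ''tp'' (s ''i'' 0)) (coef P t)"
    and sv: "seg (s ''in'') (s ''p'' 0) (enc_valuation P w)"
  shows "run eval_prog s (\<lambda>n s'. n \<le> card P * 4 + 5 \<and>
    (\<forall>i. i \<noteq> s ''i'' 0 \<longrightarrow> s' ''w'' i = s ''w'' i) \<and>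
    of_int (s' ''w'' (s ''i'' 0)) = term_val P w t * of_int Y)"
proof -
  define num where "num m = fst (quotient_of (w (ps ! m)))" for m
  define den where "den m = snd (quotient_of (w (ps ! m)))" for m
  let ?f = "s ''in''" and ?p = "s ''p'' 0" and ?tp = "s ''tp'' (s ''i'' 0)"
  have len: "length ps = card P" by (simp add: ps_def)
  have nd: "?f (?p + 2 * int k) = num k" "?f (?p + 2 * int k + 1) = den k" if "k < card P" for k
    using seg_pairs[OF sv[unfolded enc_valuation_def]] that len by (auto simp: num_def den_def ps_def)
  have cf: "?f (?tp + int k) = fst t (ps ! k)" if "k < card P" for k
    using seg_nth[OF t, of k] that len by (simp add: coef_def ps_def nth_append)
  have cn: "?f (?tp + int (card P)) = snd t"
    using seg_nth[OF t, of "card P"] len by (simp add: coef_def ps_def nth_append)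
  have q: "w (ps ! m) * of_int (den m) = of_int (num m)" for m
  proof -
    have "quotient_of (w (ps ! m)) = (num m, den m)" by (simp add: num_def den_def)
    from quotient_of_div[OF this] quotient_of_denom_pos[OF this] show ?thesis by simp
  qed
  let ?S = "\<lambda>k. \<Sum>m<k. of_int (fst t (ps ! m)) * w (ps ! m)"
  let ?I = "\<lambda>k s'. s' ''y'' 0 = (\<Prod>m<k. den m) \<and> of_int (s' ''x'' 0) = ?S k * of_int (\<Prod>m<k. den m)"
  let ?c = "Set ''x'' (Plus (Times (V ''x'') (Read ''in'' (Plus (Plus (V ''p'') (Times (Num 2) (V ''k''))) (Num 1))))
          (Times (Times (Read ''in'' (Plus (Read ''tp'' (V ''i'')) (V ''k'')))
             (Read ''in'' (Plus (V ''p'') (Times (Num 2) (V ''k''))))) (V ''y''))) ;;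
        Set ''y'' (Times (V ''y'') (Read ''in'' (Plus (Plus (V ''p'') (Times (Num 2) (V ''k''))) (Num 1))))"
  let ?s = "upd (upd s ''x'' 0 0) ''y'' 0 1"
  have L: "run (For ''k'' (V ''np'') ?c) ?s (\<lambda>n s'. n \<le> card P * (2 + 2) + 2 \<and> ?I (card P) s' \<and> s' ''k'' 0 = int (card P) \<and>
    (\<forall>a. a \<notin> insert ''k'' (writes ?c) \<longrightarrow> s' a = ?s a))"
  proof (rule run_For)
    show "?I 0 (upd ?s ''k'' 0 0)" by simp
    fix k s' assume fr: "\<And>a. a \<notin> insert ''k'' (writes ?c) \<Longrightarrow> s' a = ?s a"
    show "aval (V ''np'') s' = int (card P)" using fr P by simp
    assume k: "k < card P" "s' ''k'' 0 = int k" and I: "?I k s'"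
    have fr': "s' ''in'' = ?f" "s' ''p'' 0 = ?p" "s' ''tp'' = s ''tp''" "s' ''i'' = s ''i''" using fr by simp_all
    have y: "s' ''y'' 0 = (\<Prod>m<k. den m)" and x: "of_int (s' ''x'' 0) = ?S k * of_int (\<Prod>m<k. den m)" using I by auto
    have "of_int (s' ''x'' 0 * den k + fst t (ps ! k) * num k * (\<Prod>m<k. den m)) =
      ?S (Suc k) * of_int ((\<Prod>m<k. den m) * den k)"
      by (simp add: x q[symmetric] algebra_simps)
    then show "run ?c s' (\<lambda>n s''. n \<le> 2 \<and> s'' ''k'' 0 = int k \<and> ?I (Suc k) (upd s'' ''k'' 0 (int (Suc k))))"
      using k by (simp add: fr' nd cf y del: of_int_mult of_int_add of_int_prod sum.lessThan_Suc)
  qed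
  have "distinct ps" "set ps = P" by (simp_all add: ps_def P(1))
  then have ps: "bij_betw ((!) ps) {..<card P} P"
    by (intro bij_betw_nth) (simp_all add: len)
  have tv: "term_val P w t = ?S (card P) + of_int (snd t)"
    unfolding term_val_def using sum.reindex_bij_betw[OF ps, of "\<lambda>p. of_int (fst t p) * w p"] by simp
  have Y: "Y = (\<Prod>m<card P. den m)" by (simp add: Y_def den_def)
  have H: "run (For ''k'' (V ''np'') ?c) ?s (\<lambda>n s'. 2 + (n + 1) \<le> card P * 4 + 5 \<and>
    (\<forall>i. i \<noteq> s ''i'' 0 \<longrightarrow> s' ''w'' i = s ''w'' i) \<and>
    of_int (s' ''x'' 0 + snd t * s' ''y'' 0) = term_val P w t * of_int Y \<and>
    s' ''i'' 0 = s ''i'' 0 \<and> s' ''in'' (s' ''tp'' (s ''i'' 0) + s' ''np'' 0) = snd t)"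
  proof (rule run_conseq[OF L])
    fix n s'
    assume *: "n \<le> card P * (2 + 2) + 2 \<and> ?I (card P) s' \<and> s' ''k'' 0 = int (card P) \<and>
      (\<forall>a. a \<notin> insert ''k'' (writes ?c) \<longrightarrow> s' a = ?s a)"
    then have fr: "\<And>a. a \<notin> insert ''k'' (writes ?c) \<Longrightarrow> s' a = ?s a"
      and x: "of_int (s' ''x'' 0) = ?S (card P) * of_int Y" and y: "s' ''y'' 0 = Y" unfolding Y by blast+
    have fr': "s' ''w'' = s ''w''" "s' ''i'' = s ''i''" "s' ''in'' = ?f" "s' ''tp'' = s ''tp''" "s' ''np'' 0 = int (card P)"
      using fr P by simp_all
    have "of_int (s' ''x'' 0 + snd t * s' ''y'' 0) = term_val P w t * of_int Y"
      unfolding tv of_int_add of_int_mult x y by (simp add: algebra_simps)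
    then show "2 + (n + 1) \<le> card P * 4 + 5 \<and>
      (\<forall>i. i \<noteq> s ''i'' 0 \<longrightarrow> s' ''w'' i = s ''w'' i) \<and>
      of_int (s' ''x'' 0 + snd t * s' ''y'' 0) = term_val P w t * of_int Y \<and>
      s' ''i'' 0 = s ''i'' 0 \<and> s' ''in'' (s' ''tp'' (s ''i'' 0) + s' ''np'' 0) = snd t"
      using * by (simp only: fr' cn) simp
  qed
  show ?thesis
    unfolding eval_prog_def
    using H by simp (erule run_conseq, simp)
qed

lemma run_count:
  assumes nt: "s ''nt'' 0 = int N"
  shows "run count_prog s (\<lambda>n s'. n \<le> N * 4 + 3 \<and>
    (\<forall>i. i \<noteq> s ''i'' 0 \<longrightarrow> s' ''r'' i = s ''r'' i) \<and>
    s' ''r'' (s ''i'' 0) = int (card {j. j < N \<and> s ''w'' (int j) < s ''w'' (s ''i'' 0)}))"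
proof -
  let ?i = "s ''i'' 0"
  let ?c = "If (Less (Read ''w'' (V ''j'')) (Read ''w'' (V ''i'')))
          (Assign ''r'' (V ''i'') (Plus (Read ''r'' (V ''i'')) (Num 1))) Skip"
  let ?s = "upd s ''r'' ?i 0"
  let ?I = "\<lambda>k s'. (\<forall>i. i \<noteq> ?i \<longrightarrow> s' ''r'' i = s ''r'' i) \<and>
    s' ''r'' ?i = int (card {j. j < k \<and> s ''w'' (int j) < s ''w'' ?i})"
  have "run (For ''j'' (V ''nt'') ?c) ?s (\<lambda>n s'. n \<le> N * (2 + 2) + 2 \<and> ?I N s' \<and> s' ''j'' 0 = int N \<and>
    (\<forall>a. a \<notin> insert ''j'' (writes ?c) \<longrightarrow> s' a = ?s a))"
  proof (rule run_For)
    show "?I 0 (upd ?s ''j'' 0 0)" by simp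
    fix k s' assume fr: "\<And>a. a \<notin> insert ''j'' (writes ?c) \<Longrightarrow> s' a = ?s a"
    show "aval (V ''nt'') s' = int N" using fr nt by simp
    assume k: "k < N" "s' ''j'' 0 = int k" and I: "?I k s'"
    have fr': "s' ''w'' = s ''w''" "s' ''i'' 0 = ?i" using fr by simp_all
    show "run ?c s' (\<lambda>n s''. n \<le> 2 \<and> s'' ''j'' 0 = int k \<and> ?I (Suc k) (upd s'' ''j'' 0 (int (Suc k))))"
      using I k by (simp add: fr' card_Suc_filter)
  qed
  then have H: "run (For ''j'' (V ''nt'') ?c) ?s (\<lambda>n s'. 1 + n \<le> N * 4 + 3 \<and> ?I N s')"
    by (rule run_conseq) simp
  show ?thesis unfolding count_prog_def using H by simp
qed


context pta_input
begin

definition rank_of :: "valuation \<Rightarrow> lterm \<Rightarrow> int" where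
  "rank_of w t = int (card {u \<in> terms A. term_val (params A) w u < term_val (params A) w t})"

lemma rank_of_less_iff:
  assumes "s \<in> terms A" "t \<in> terms A"
  shows "rank_of w s < rank_of w t \<longleftrightarrow> term_val (params A) w s < term_val (params A) w t"
proof
  let ?S = "\<lambda>t. {u \<in> terms A. term_val (params A) w u < term_val (params A) w t}"
  have fin: "finite (?S u)" for u using finite_terms[OF wf] by simp
  show "term_val (params A) w s < term_val (params A) w t" if "rank_of w s < rank_of w t"
  proof (rule ccontr)
    assume "\<not> ?thesis"
    then have "?S t \<subseteq> ?S s" by auto
    then have "card (?S t) \<le> card (?S s)" by (rule card_mono[OF fin])
    then show False using that by (simp add: rank_of_def)
  qed
  assume l: "term_val (params A) w s < term_val (params A) w t"
  then have "?S s \<subset> ?S t" using assms(1) by force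
  then show "rank_of w s < rank_of w t" unfolding rank_of_def using psubset_card_mono[OF fin] by simp
qed

lemma rank_of_consistent: "consistent A w (rank_of w)"
  unfolding consistent_def using rank_of_less_iff by simp

lemma rank_of_range:
  assumes "t \<in> terms A"
  shows "0 \<le> rank_of w t \<and> rank_of w t < int (card (terms A))"
proof -
  have "{u \<in> terms A. term_val (params A) w u < term_val (params A) w t} \<subset> terms A" using assms by blast
  then show ?thesis using psubset_card_mono[OF finite_terms[OF wf]] by (simp add: rank_of_def)
qed

lemma parsed_facts:
  assumes "parsed s Ts Cs"
  shows "s ''nt'' 0 = int (length Ts)" "distinct Ts" "set Ts = terms A" "length Ts = card (terms A)"
    "Ts ! 0 = zero_term" "0 < length Ts" "s ''np'' 0 = int (card (params A))"
    "\<And>j. j < length Ts \<Longrightarrow> seg (s ''in'') (s ''tp'' (int j)) (coef (params A) (Ts ! j))"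
  using assms distinct_card[of Ts] by (auto simp: parsed_def table_def)

lemma run_rank:
  assumes par: "parsed s Ts Cs" and sv: "seg (s ''in'') (s ''p'' 0) (enc_valuation (params A) v)"
  shows "run rank_prog s (\<lambda>n s'. n \<le> length Ts * (4 * card (params A) + 4 * length Ts + 12) + 4 \<and>
    (\<forall>j<length Ts. s' ''r'' (int j) = rank_of v (Ts ! j)))"
proof -
  let ?P = "params A" and ?N = "length Ts"
  note pf = parsed_facts[OF par]
  define Y where "Y = (\<Prod>m<card ?P. snd (quotient_of (v (sorted_list_of_set ?P ! m))))"
  have Y: "0 < Y" unfolding Y_def by (intro prod_pos ballI) (metis quotient_of_denom_pos prod.collapse)
  let ?I1 = "\<lambda>k s'. \<forall>j<k. of_int (s' ''w'' (int j)) = term_val ?P v (Ts ! j) * of_int Y"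
  have 1: "run (For ''i'' (V ''nt'') eval_prog) s (\<lambda>n s'. n \<le> ?N * ((card ?P * 4 + 5) + 2) + 2 \<and> ?I1 ?N s' \<and>
    s' ''i'' 0 = int ?N \<and> (\<forall>a. a \<notin> insert ''i'' (writes eval_prog) \<longrightarrow> s' a = s a))"
  proof (rule run_For)
    show "?I1 0 (upd s ''i'' 0 0)" by simp
    fix k s' assume fr: "\<And>a. a \<notin> insert ''i'' (writes eval_prog) \<Longrightarrow> s' a = s a"
    show "aval (V ''nt'') s' = int ?N" using fr pf by simp
    assume k: "k < ?N" "s' ''i'' 0 = int k" and I: "?I1 k s'"
    have fr': "s' ''in'' = s ''in''" "s' ''p'' = s ''p''" "s' ''tp'' = s ''tp''" "s' ''np'' = s ''np''" using fr by simp_all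
    have E: "run eval_prog s' (\<lambda>n s''. n \<le> card ?P * 4 + 5 \<and>
      (\<forall>i. i \<noteq> s' ''i'' 0 \<longrightarrow> s'' ''w'' i = s' ''w'' i) \<and>
      of_int (s'' ''w'' (s' ''i'' 0)) = term_val ?P v (Ts ! k) * of_int Y)"
      unfolding Y_def by (rule run_eval) (use pf k sv params_finite in \<open>simp_all add: fr'\<close>)
    show "run eval_prog s' (\<lambda>n s''. n \<le> card ?P * 4 + 5 \<and> s'' ''i'' 0 = int k \<and> ?I1 (Suc k) (upd s'' ''i'' 0 (int (Suc k))))"
    proof (rule run_call[OF E])
      fix n s'' assume *: "n \<le> card ?P * 4 + 5 \<and> (\<forall>i. i \<noteq> s' ''i'' 0 \<longrightarrow> s'' ''w'' i = s' ''w'' i) \<and>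
        of_int (s'' ''w'' (s' ''i'' 0)) = term_val ?P v (Ts ! k) * of_int Y"
        and fr'': "\<And>a. a \<notin> writes eval_prog \<Longrightarrow> s'' a = s' a"
      have "s'' ''i'' 0 = int k" using fr'' k by simp
      then show "n \<le> card ?P * 4 + 5 \<and> s'' ''i'' 0 = int k \<and> ?I1 (Suc k) (upd s'' ''i'' 0 (int (Suc k)))"
        using * I k by (simp add: less_Suc_eq)
    qed
  qed
  have less: "s' ''w'' (int i) < s' ''w'' (int j) \<longleftrightarrow> term_val ?P v (Ts ! i) < term_val ?P v (Ts ! j)"
    if "?I1 ?N s'" "i < ?N" "j < ?N" for s' i j
  proof -
    have "s' ''w'' (int i) < s' ''w'' (int j) \<longleftrightarrow> (of_int (s' ''w'' (int i)) :: rat) < of_int (s' ''w'' (int j))" by simp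
    also have "\<dots> \<longleftrightarrow> term_val ?P v (Ts ! i) < term_val ?P v (Ts ! j)" using that Y by simp
    finally show ?thesis .
  qed
  have rk: "int (card {j. j < ?N \<and> s' ''w'' (int j) < s' ''w'' (int k)}) = rank_of v (Ts ! k)"
    if I: "?I1 ?N s'" and k: "k < ?N" for s' k
  proof -
    have L: "s' ''w'' (int j) < s' ''w'' (int k) \<longleftrightarrow> term_val ?P v (Ts ! j) < term_val ?P v (Ts ! k)"
      if "j < ?N" for j using less[of s' j k] I k that by blast
    have "bij_betw ((!) Ts) {..<?N} (terms A)" by (rule bij_betw_nth) (simp_all add: pf(2,3))
    then have "inj_on ((!) Ts) {..<?N}" "((!) Ts) ` {..<?N} = terms A" by (auto simp: bij_betw_def)
    moreover have "{u \<in> terms A. term_val ?P v u < term_val ?P v (Ts ! k)} =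
      ((!) Ts) ` {j. j < ?N \<and> s' ''w'' (int j) < s' ''w'' (int k)}"
      unfolding calculation(2)[symmetric] using L by blast
    moreover have "inj_on ((!) Ts) {j. j < ?N \<and> s' ''w'' (int j) < s' ''w'' (int k)}"
      using calculation(1) by (rule inj_on_subset) auto
    ultimately show ?thesis by (simp add: rank_of_def card_image)
  qed
  let ?I2 = "\<lambda>k s'. \<forall>j<k. s' ''r'' (int j) = rank_of v (Ts ! j)"
  have 2: "run (For ''i'' (V ''nt'') count_prog) s1 (\<lambda>n s'. n \<le> ?N * ((?N * 4 + 3) + 2) + 2 \<and> ?I2 ?N s' \<and>
    s' ''i'' 0 = int ?N \<and> (\<forall>a. a \<notin> insert ''i'' (writes count_prog) \<longrightarrow> s' a = s1 a))"
    if I1: "?I1 ?N s1" and nt1: "s1 ''nt'' 0 = int ?N" for s1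
  proof (rule run_For)
    show "?I2 0 (upd s1 ''i'' 0 0)" by simp
    fix k s' assume fr: "\<And>a. a \<notin> insert ''i'' (writes count_prog) \<Longrightarrow> s' a = s1 a"
    show "aval (V ''nt'') s' = int ?N" using fr nt1 by simp
    assume k: "k < ?N" "s' ''i'' 0 = int k" and I: "?I2 k s'"
    have fr': "s' ''w'' = s1 ''w''" "s' ''nt'' 0 = int ?N" using fr nt1 by simp_all
    show "run count_prog s' (\<lambda>n s''. n \<le> ?N * 4 + 3 \<and> s'' ''i'' 0 = int k \<and> ?I2 (Suc k) (upd s'' ''i'' 0 (int (Suc k))))"
    proof (rule run_call[OF run_count[of s' ?N, OF fr'(2)]])
      fix n s'' assume *: "n \<le> ?N * 4 + 3 \<and>
        (\<forall>i. i \<noteq> s' ''i'' 0 \<longrightarrow> s'' ''r'' i = s' ''r'' i) \<and>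
        s'' ''r'' (s' ''i'' 0) = int (card {j. j < ?N \<and> s' ''w'' (int j) < s' ''w'' (s' ''i'' 0)})"
        and fr'': "\<And>a. a \<notin> writes count_prog \<Longrightarrow> s'' a = s' a"
      have "s'' ''i'' 0 = int k" using fr'' k by simp
      moreover have "s'' ''r'' (int k) = rank_of v (Ts ! k)" using * k rk[of s1 k, OF I1 k(1)] fr' by simp
      ultimately show "n \<le> ?N * 4 + 3 \<and> s'' ''i'' 0 = int k \<and> ?I2 (Suc k) (upd s'' ''i'' 0 (int (Suc k)))"
        using * I k by (simp add: less_Suc_eq)
    qed
  qed
  show ?thesis
    unfolding rank_prog_def run_Seq
  proof (rule run_conseq[OF 1])
    fix n s1 assume A: "n \<le> ?N * ((card ?P * 4 + 5) + 2) + 2 \<and> ?I1 ?N s1 \<and>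
      s1 ''i'' 0 = int ?N \<and> (\<forall>a. a \<notin> insert ''i'' (writes eval_prog) \<longrightarrow> s1 a = s a)"
    then have I1: "?I1 ?N s1" and fr: "\<And>a. a \<notin> insert ''i'' (writes eval_prog) \<Longrightarrow> s1 a = s a" by blast+
    have nt1: "s1 ''nt'' 0 = int ?N" using fr pf by simp
    show "run (For ''i'' (V ''nt'') count_prog) s1 (\<lambda>m s'. n + m \<le> ?N * (4 * card ?P + 4 * ?N + 12) + 4 \<and> ?I2 ?N s')"
    proof (rule run_conseq[OF 2[OF I1 nt1]])
      fix m s' assume B: "m \<le> ?N * ((?N * 4 + 3) + 2) + 2 \<and> ?I2 ?N s' \<and>
        s' ''i'' 0 = int ?N \<and> (\<forall>a. a \<notin> insert ''i'' (writes count_prog) \<longrightarrow> s' a = s1 a)"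
      have "n + m \<le> ?N * (4 * card ?P + 4 * ?N + 12) + 4" using A B by (simp add: algebra_simps)
      then show "n + m \<le> ?N * (4 * card ?P + 4 * ?N + 12) + 4 \<and> ?I2 ?N s'" using B by blast
    qed
  qed
qed

end

definition copy_prog :: com where
  "copy_prog =
     Set ''b1'' (V ''b'') ;;
     For ''g'' (V ''ng'')
       (Assign ''lo1'' (V ''g'') (Read ''lo'' (V ''g'')) ;;
        Assign ''hi1'' (V ''g'') (Read ''hi'' (V ''g'')) ;;
        Assign ''ml1'' (V ''g'') (Read ''ml'' (V ''g'')))"

lemmas writes_copy [simp] = arg_cong[OF copy_prog_def, of writes, simplified]

lemma run_copy:
  assumes ng: "s ''ng'' 0 = int N"
  shows "run copy_prog s (\<lambda>n s'. n \<le> N * 5 + 3 \<and> s' ''b1'' 0 = s ''b'' 0 \<and>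
    (\<forall>g. 0 \<le> g \<and> g < int N \<longrightarrow> s' ''lo1'' g = s ''lo'' g \<and> s' ''hi1'' g = s ''hi'' g \<and> s' ''ml1'' g = s ''ml'' g))"
proof -
  let ?c = "Assign ''lo1'' (V ''g'') (Read ''lo'' (V ''g'')) ;;
        Assign ''hi1'' (V ''g'') (Read ''hi'' (V ''g'')) ;;
        Assign ''ml1'' (V ''g'') (Read ''ml'' (V ''g''))"
  let ?s = "upd s ''b1'' 0 (s ''b'' 0)"
  let ?I = "\<lambda>k s'. \<forall>g. 0 \<le> g \<and> g < int k \<longrightarrow> s' ''lo1'' g = s ''lo'' g \<and> s' ''hi1'' g = s ''hi'' g \<and> s' ''ml1'' g = s ''ml'' g"
  have "run (For ''g'' (V ''ng'') ?c) ?s (\<lambda>n s'. n \<le> N * (3 + 2) + 2 \<and> ?I N s' \<and> s' ''g'' 0 = int N \<and>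
    (\<forall>a. a \<notin> insert ''g'' (writes ?c) \<longrightarrow> s' a = ?s a))"
  proof (rule run_For)
    show "?I 0 (upd ?s ''g'' 0 0)" by simp
    fix k s' assume fr: "\<And>a. a \<notin> insert ''g'' (writes ?c) \<Longrightarrow> s' a = ?s a"
    show "aval (V ''ng'') s' = int N" using fr ng by simp
    assume k: "k < N" "s' ''g'' 0 = int k" and I: "?I k s'"
    show "run ?c s' (\<lambda>n s''. n \<le> 3 \<and> s'' ''g'' 0 = int k \<and> ?I (Suc k) (upd s'' ''g'' 0 (int (Suc k))))"
      using I by (simp add: k fr)
  qed
  then have H: "run (For ''g'' (V ''ng'') ?c) ?s (\<lambda>n s'. 1 + n \<le> N * 5 + 3 \<and> ?I N s' \<and> s' ''b1'' 0 = s ''b'' 0)"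
    by (rule run_conseq) simp
  show ?thesis unfolding copy_prog_def using H by simp (erule run_conseq, simp)
qed

subsection \<open>Enumerating the rankings\<close>

definition numeral_of :: "nat \<Rightarrow> (nat \<Rightarrow> int) \<Rightarrow> nat \<Rightarrow> int" where
  "numeral_of B f n = (\<Sum>k<n. f k * int B ^ k)"

lemma numeral_of_bounds:
  assumes "\<And>k. k < n \<Longrightarrow> 0 \<le> f k \<and> f k < int B"
  shows "0 \<le> numeral_of B f n \<and> numeral_of B f n < int B ^ n"
  using assms
proof (induction n)
  case (Suc n)
  have f: "0 \<le> f n" "f n \<le> int B - 1" using Suc.prems[of n] by auto
  have "f n * int B ^ n \<le> (int B - 1) * int B ^ n" using f by (intro mult_right_mono) auto
  moreover have "0 \<le> f n * int B ^ n" using f by simp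
  moreover have "0 \<le> numeral_of B f n \<and> numeral_of B f n < int B ^ n" using Suc by simp
  ultimately show ?case by (simp add: numeral_of_def algebra_simps)
qed (simp add: numeral_of_def)

lemma numeral_of_inj:
  assumes "\<And>k. k < n \<Longrightarrow> 0 \<le> f k \<and> f k < int B" "\<And>k. k < n \<Longrightarrow> 0 \<le> g k \<and> g k < int B"
    and "numeral_of B f n = numeral_of B g n" "k < n"
  shows "f k = g k"
  using assms
proof (induction n)
  case (Suc n)
  have b: "0 \<le> numeral_of B f n \<and> numeral_of B f n < int B ^ n" "0 \<le> numeral_of B g n \<and> numeral_of B g n < int B ^ n"
    by (rule numeral_of_bounds, use Suc.prems in simp)+
  have "f n * int B ^ n + numeral_of B f n = g n * int B ^ n + numeral_of B g n"
    using Suc.prems(3) by (simp add: numeral_of_def)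
  then have "f n = g n \<and> numeral_of B f n = numeral_of B g n" using b by (intro digit_inj) auto
  then show ?case using Suc by (auto simp: less_Suc_eq)
qed simp

lemma numeral_of_upd:
  assumes "i < n" "\<And>k. k < n \<Longrightarrow> k \<noteq> i \<Longrightarrow> g k = f k"
  shows "numeral_of B g n = numeral_of B f n + (g i - f i) * int B ^ i"
proof -
  have "numeral_of B h n = h i * int B ^ i + (\<Sum>k \<in> {..<n} - {i}. h k * int B ^ k)" for h
    unfolding numeral_of_def using assms(1) by (intro sum.remove) auto
  moreover have "(\<Sum>k \<in> {..<n} - {i}. g k * int B ^ k) = (\<Sum>k \<in> {..<n} - {i}. f k * int B ^ k)"
    using assms(2) by (intro sum.cong) auto
  ultimately show ?thesis by (simp add: algebra_simps)
qed

definition next_prog :: com where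
  "next_prog =
     Set ''i'' (Num 0) ;;
     While (And (Less (V ''i'') (V ''nt'')) (Equal (Read ''r'' (V ''i'')) (Minus (V ''nt'') (Num 1))))
       (Assign ''r'' (V ''i'') (Num 0) ;; Inc ''i'') ;;
     If (Less (V ''i'') (V ''nt''))
       (Assign ''r'' (V ''i'') (Plus (Read ''r'' (V ''i'')) (Num 1)))
       (Set ''go'' (Num 0))"

lemmas writes_next [simp] = arg_cong[OF next_prog_def, of writes, simplified]

abbreviation digits :: "state \<Rightarrow> nat \<Rightarrow> int" where "digits s \<equiv> \<lambda>k. s ''r'' (int k)"

lemma run_next:
  assumes nt: "s ''nt'' 0 = int N" and r: "\<And>k. k < N \<Longrightarrow> 0 \<le> digits s k \<and> digits s k < int N"
  shows "run next_prog s (\<lambda>n s'. n \<le> 3 * N + 4 \<and>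
    (if numeral_of N (digits s) N + 1 < int N ^ N
     then s' ''go'' 0 = s ''go'' 0 \<and> numeral_of N (digits s') N = numeral_of N (digits s) N + 1 \<and>
       (\<forall>k<N. 0 \<le> digits s' k \<and> digits s' k < int N)
     else s' ''go'' 0 = 0))"
proof -
  let ?v = "numeral_of N (digits s) N"
  let ?b = "And (Less (V ''i'') (V ''nt'')) (Equal (Read ''r'' (V ''i'')) (Minus (V ''nt'') (Num 1)))"
  let ?c = "Assign ''r'' (V ''i'') (Num 0) ;; Inc ''i''"
  let ?s = "upd s ''i'' 0 0"
  let ?I = "\<lambda>s'. \<exists>i\<le>N. s' ''i'' 0 = int i \<and> (\<forall>k<i. digits s' k = 0) \<and>
    (\<forall>k<N. 0 \<le> digits s' k \<and> digits s' k < int N) \<and> numeral_of N (digits s') N + int N ^ i = ?v + 1"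
  have W: "run (While ?b ?c) ?s (\<lambda>n s'. n \<le> (N - nat (?s ''i'' 0)) * (2 + 1) + 1 \<and> ?I s' \<and> \<not> bval ?b s' \<and>
    (\<forall>a. a \<notin> writes ?c \<longrightarrow> s' a = ?s a))"
  proof (rule run_While)
    show "?I ?s" using r by (intro exI[of _ 0]) simp
    fix s' assume I: "?I s'" and fr: "\<And>a. a \<notin> writes ?c \<Longrightarrow> s' a = ?s a" and bv: "bval ?b s'"
    obtain i where i: "i \<le> N" "s' ''i'' 0 = int i" "\<And>k. k < i \<Longrightarrow> digits s' k = 0"
      "\<And>k. k < N \<Longrightarrow> 0 \<le> digits s' k \<and> digits s' k < int N" "numeral_of N (digits s') N + int N ^ i = ?v + 1"
      using I by blast
    have nt': "s' ''nt'' 0 = int N" using fr nt by simp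
    have iN: "i < N" and ri: "digits s' i = int N - 1" using bv i(2) nt' by auto
    let ?s2 = "upd (upd s' ''r'' (int i) 0) ''i'' 0 (int i + 1)"
    have "numeral_of N (digits ?s2) N = numeral_of N (digits s') N + (digits ?s2 i - digits s' i) * int N ^ i"
      by (rule numeral_of_upd[OF iN]) simp
    then have "numeral_of N (digits ?s2) N + int N ^ Suc i = ?v + 1"
      using i(5) ri by (simp add: algebra_simps)
    moreover have "\<forall>k<Suc i. digits ?s2 k = 0" using i(3) by (simp add: less_Suc_eq)
    moreover have "\<forall>k<N. 0 \<le> digits ?s2 k \<and> digits ?s2 k < int N" using i(4) iN by simp
    moreover have "?s2 ''i'' 0 = int (Suc i)" by simp
    ultimately have "?I ?s2" using iN by (intro exI[of _ "Suc i"]) simp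
    moreover have "N - nat (?s2 ''i'' 0) < N - nat (s' ''i'' 0)" using i(2) iN by simp
    ultimately have "2 \<le> (2::nat) \<and> ?I ?s2 \<and> N - nat (?s2 ''i'' 0) < N - nat (s' ''i'' 0)" by blast
    then show "run ?c s' (\<lambda>n s''. n \<le> 2 \<and> ?I s'' \<and> N - nat (s'' ''i'' 0) < N - nat (s' ''i'' 0))"
      unfolding run_Seq run_Assign by (simp only: aval.simps i(2) upd_other upd_same fun_upd_same list.inject char.inject simp_thms)
  qed
  let ?Q = "\<lambda>n s'. n \<le> 3 * N + 4 \<and>
    (if ?v + 1 < int N ^ N
     then s' ''go'' 0 = s ''go'' 0 \<and> numeral_of N (digits s') N = ?v + 1 \<and>
       (\<forall>k<N. 0 \<le> digits s' k \<and> digits s' k < int N)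
     else s' ''go'' 0 = 0)"
  let ?d = "If (Less (V ''i'') (V ''nt''))
       (Assign ''r'' (V ''i'') (Plus (Read ''r'' (V ''i'')) (Num 1))) (Set ''go'' (Num 0))"
  have "run (While ?b ?c) ?s (\<lambda>n s'. run ?d s' (\<lambda>m. ?Q (1 + (n + m))))"
  proof (rule run_conseq[OF W])
    fix n s' assume *: "n \<le> (N - nat (?s ''i'' 0)) * (2 + 1) + 1 \<and> ?I s' \<and> \<not> bval ?b s' \<and>
      (\<forall>a. a \<notin> writes ?c \<longrightarrow> s' a = ?s a)"
    then have fr: "\<And>a. a \<notin> writes ?c \<Longrightarrow> s' a = ?s a" and nb: "\<not> bval ?b s'" by blast+
    have n: "n \<le> N * 3 + 1" using conjunct1[OF *] by simp
    have I: "?I s'" using conjunct1[OF conjunct2[OF *]] .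
    obtain i where i: "i \<le> N" "s' ''i'' 0 = int i" "\<And>k. k < i \<Longrightarrow> digits s' k = 0"
      "\<And>k. k < N \<Longrightarrow> 0 \<le> digits s' k \<and> digits s' k < int N" "numeral_of N (digits s') N + int N ^ i = ?v + 1"
      using I by blast
    have nt': "s' ''nt'' 0 = int N" "s' ''go'' = s ''go''" using fr nt by simp_all
    show "run ?d s' (\<lambda>m. ?Q (1 + (n + m)))"
    proof (cases "i < N")
      case True
      then have ri: "digits s' i < int N - 1" using nb i(2) i(4)[OF True] nt' by auto
      let ?s2 = "upd s' ''r'' (int i) (digits s' i + 1)"
      have "numeral_of N (digits ?s2) N = numeral_of N (digits s') N + (digits ?s2 i - digits s' i) * int N ^ i"
        by (rule numeral_of_upd[OF True]) simp
      then have v: "numeral_of N (digits ?s2) N = ?v + 1" using i(5) by simp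
      have d: "\<forall>k<N. 0 \<le> digits ?s2 k \<and> digits ?s2 k < int N" using i(4) ri True by auto
      have "?v + 1 < int N ^ N" using numeral_of_bounds[of N "digits ?s2" N] d v by auto
      then have "?Q (3 + n) ?s2" using n v d nt' by simp
      moreover have "1 + (n + Suc 1) = 3 + n" by simp
      ultimately have Q: "?Q (1 + (n + Suc 1)) ?s2" by metis
      have b: "bval (Less (V ''i'') (V ''nt'')) s'" using True by (simp add: i(2) nt')
      have s2: "upd s' ''r'' (aval (V ''i'') s') (aval (Plus (Read ''r'' (V ''i'')) (Num 1)) s') = ?s2"
        by (simp add: i(2))
      show ?thesis unfolding run_If run_Assign s2 if_P[OF b] by (rule Q)
    next
      case False
      then have "i = N" using i(1) by simp
      then have "digits s' k = 0" if "k < N" for k using i(3) that by blast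
      then have "numeral_of N (digits s') N = 0" by (simp add: numeral_of_def)
      then have "?v + 1 = int N ^ N" using i(5) \<open>i = N\<close> by simp
      then show ?thesis using n \<open>i = N\<close> by (simp add: i(2) nt')
    qed
  qed
  then show ?thesis
    unfolding next_prog_def by simp
qed

subsection \<open>Writing the output\<close>

definition cmp :: "int \<Rightarrow> int \<Rightarrow> rel" where
  "cmp x y = (if x < y then Lt else if y < x then Gt else Eq)"

definition tdiff :: "lterm \<Rightarrow> lterm \<Rightarrow> lterm" where
  "tdiff t u = (\<lambda>p. fst t p - fst u p, snd t - snd u)"

definition emit_prog :: com where
  "emit_prog =
     If (Less (Read ''r'' (V ''i'')) (Read ''r'' (V ''j''))) (Assign ''out'' (V ''o'') (Num 0))
       (If (Less (Read ''r'' (V ''j'')) (Read ''r'' (V ''i''))) (Assign ''out'' (V ''o'') (Num 4))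
          (Assign ''out'' (V ''o'') (Num 2))) ;;
     Inc ''o'' ;;
     For ''k'' (Plus (V ''np'') (Num 1))
       (Assign ''out'' (V ''o'') (Minus (Read ''in'' (Plus (Read ''tp'' (V ''i'')) (V ''k'')))
          (Read ''in'' (Plus (Read ''tp'' (V ''j'')) (V ''k'')))) ;;
        Inc ''o'')"

definition output_prog :: com where
  "output_prog =
     Assign ''out'' (Num 0) (Plus (Read ''out'' (Num 0)) (Num 1)) ;;
     Assign ''out'' (V ''o'') (Times (V ''nt'') (V ''nt'')) ;;
     Inc ''o'' ;;
     For ''i'' (V ''nt'') (For ''j'' (V ''nt'') emit_prog)"

lemmas writes_emit [simp] = arg_cong[OF emit_prog_def, of writes, simplified]
lemmas writes_output [simp] = arg_cong[OF output_prog_def, of writes, simplified]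

text \<open>Cell \<open>0\<close> of the output holds the number of disjuncts written so far, and the disjuncts
  themselves occupy the cells from \<open>1\<close> on.\<close>

definition written :: "state \<Rightarrow> int \<Rightarrow> int list \<Rightarrow> bool" where
  "written s c ys \<longleftrightarrow> s ''out'' 0 = c \<and> seg (s ''out'') 1 ys \<and> s ''o'' 0 = 1 + int (length ys)"

lemma written_upd [simp]: "a \<noteq> ''out'' \<Longrightarrow> a \<noteq> ''o'' \<Longrightarrow> written (upd s a i x) c ys = written s c ys"
  by (simp add: written_def)

lemma written_snoc:
  assumes w: "written s c ys" and i: "i = s ''o'' 0" and x: "x = i + 1"
  shows "written (upd (upd s ''out'' i y) ''o'' 0 x) c (ys @ [y])"
  using w unfolding i x written_def seg_def by (auto simp: nth_append less_Suc_eq)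

lemma run_emit:
  assumes P: "finite P" "s ''np'' 0 = int (card P)"
    and t: "seg (s ''in'') (s ''tp'' (s ''i'' 0)) (coef P t)" and u: "seg (s ''in'') (s ''tp'' (s ''j'' 0)) (coef P u)"
    and w: "written s c ys"
  shows "run emit_prog s (\<lambda>n s'. n \<le> 4 * card P + 10 \<and>
    written s' c (ys @ enc_constr P (cmp (s ''r'' (s ''i'' 0)) (s ''r'' (s ''j'' 0)), tdiff t u)))"
proof -
  let ?e = "enc_rel (cmp (s ''r'' (s ''i'' 0)) (s ''r'' (s ''j'' 0)))"
  let ?d = "coef P (tdiff t u)"
  have d: "?d ! k = s ''in'' (s ''tp'' (s ''i'' 0) + int k) - s ''in'' (s ''tp'' (s ''j'' 0) + int k)" if "k < Suc (card P)" for k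
  proof -
    have "?d ! k = coef P t ! k - coef P u ! k" using that by (auto simp: coef_def tdiff_def nth_append)
    then show ?thesis using seg_nth[OF t, of k] seg_nth[OF u, of k] that by simp
  qed
  let ?s1 = "upd (upd s ''out'' (s ''o'' 0) ?e) ''o'' 0 (s ''o'' 0 + 1)"
  let ?c = "Assign ''out'' (V ''o'') (Minus (Read ''in'' (Plus (Read ''tp'' (V ''i'')) (V ''k'')))
          (Read ''in'' (Plus (Read ''tp'' (V ''j'')) (V ''k'')))) ;; Inc ''o''"
  let ?I = "\<lambda>k s'. written s' c ((ys @ [?e]) @ take k ?d)"
  have L: "run (For ''k'' (Plus (V ''np'') (Num 1)) ?c) ?s1 (\<lambda>n s'. n \<le> Suc (card P) * (2 + 2) + 2 \<and> ?I (Suc (card P)) s' \<and>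
    s' ''k'' 0 = int (Suc (card P)) \<and> (\<forall>a. a \<notin> insert ''k'' (writes ?c) \<longrightarrow> s' a = ?s1 a))"
  proof (rule run_For)
    have "written ?s1 c (ys @ [?e])" by (rule written_snoc[OF w refl refl])
    then show "?I 0 (upd ?s1 ''k'' 0 0)" by simp
    fix k s' assume fr: "\<And>a. a \<notin> insert ''k'' (writes ?c) \<Longrightarrow> s' a = ?s1 a"
    show "aval (Plus (V ''np'') (Num 1)) s' = int (Suc (card P))" using fr P by simp
    assume k: "k < Suc (card P)" "s' ''k'' 0 = int k" and I: "?I k s'"
    have fr': "s' ''in'' = s ''in''" "s' ''tp'' = s ''tp''" "s' ''i'' = s ''i''" "s' ''j'' = s ''j''" using fr by simp_all
    have "take (Suc k) ?d = take k ?d @ [?d ! k]" using k by (simp add: take_Suc_conv_app_nth)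
    then have "?I (Suc k) (upd (upd s' ''out'' (s' ''o'' 0) (?d ! k)) ''o'' 0 (s' ''o'' 0 + 1))"
      using written_snoc[OF I refl refl, of "?d ! k"] by simp
    then show "run ?c s' (\<lambda>n s''. n \<le> 2 \<and> s'' ''k'' 0 = int k \<and> ?I (Suc k) (upd s'' ''k'' 0 (int (Suc k))))"
      using k by (simp add: fr' d)
  qed
  have H: "run (For ''k'' (Plus (V ''np'') (Num 1)) ?c) ?s1 (\<lambda>n s'. 4 + n \<le> 4 * card P + 10 \<and>
      written s' c (ys @ enc_constr P (cmp (s ''r'' (s ''i'' 0)) (s ''r'' (s ''j'' 0)), tdiff t u)))"
    by (rule run_conseq[OF L]) (simp add: enc_constr_coef)
  show ?thesis
    unfolding emit_prog_def
    using H by (cases "s ''r'' (s ''i'' 0) < s ''r'' (s ''j'' 0)"; cases "s ''r'' (s ''j'' 0) < s ''r'' (s ''i'' 0)")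
      (simp_all add: cmp_def, (erule run_conseq, simp)+)
qed

definition order_conj :: "(lterm \<Rightarrow> int) \<Rightarrow> lterm list \<Rightarrow> (rel \<times> lterm) list" where
  "order_conj R Ts = concat (map (\<lambda>i. map (\<lambda>j. (cmp (R (Ts ! i)) (R (Ts ! j)), tdiff (Ts ! i) (Ts ! j)))
     [0..<length Ts]) [0..<length Ts])"

lemma concat_map_concat: "concat (map f (concat zss)) = concat (map (\<lambda>zs. concat (map f zs)) zss)"
  by (induction zss) simp_all

lemma length_order_conj: "length (order_conj R Ts) = length Ts * length Ts"
  by (simp add: order_conj_def length_concat comp_def sum_list_triv)

lemma run_output:
  assumes P: "finite P" "s ''np'' 0 = int (card P)" and nt: "s ''nt'' 0 = int (length Ts)"
    and t: "\<And>j. j < length Ts \<Longrightarrow> seg (s ''in'') (s ''tp'' (int j)) (coef P (Ts ! j))"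
    and r: "\<And>j. j < length Ts \<Longrightarrow> s ''r'' (int j) = R (Ts ! j)"
    and w: "written s c ys"
  shows "run output_prog s (\<lambda>n s'. n \<le> length Ts * (length Ts * (4 * card P + 12) + 4) + 5 \<and>
    written s' (c + 1) (ys @ enc_list (enc_constr P) (order_conj R Ts)))"
proof -
  let ?N = "length Ts"
  let ?e = "\<lambda>i j. enc_constr P (cmp (R (Ts ! i)) (R (Ts ! j)), tdiff (Ts ! i) (Ts ! j))"
  let ?row = "\<lambda>i m. concat (map (\<lambda>j. ?e i j) [0..<m])"
  let ?rows = "\<lambda>m. concat (map (\<lambda>i. ?row i ?N) [0..<m])"
  let ?y1 = "ys @ [int (?N * ?N)]"
  have w0: "written (upd s ''out'' 0 (c + 1)) (c + 1) ys" using w by (auto simp: written_def seg_def)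
  let ?s1 = "upd (upd (upd s ''out'' 0 (c + 1)) ''out'' (s ''o'' 0) (int (?N * ?N))) ''o'' 0 (s ''o'' 0 + 1)"
  have w1: "written ?s1 (c + 1) ?y1" by (rule written_snoc[OF w0]) simp_all
  have J: "run (For ''j'' (V ''nt'') emit_prog) s1 (\<lambda>n s'. n \<le> ?N * ((4 * card P + 10) + 2) + 2 \<and>
      written s' (c + 1) (zs @ ?row i ?N) \<and> s' ''j'' 0 = int ?N \<and>
      (\<forall>a. a \<notin> insert ''j'' (writes emit_prog) \<longrightarrow> s' a = s1 a))"
    if fr1: "\<And>a. a \<in> {''in'', ''tp'', ''np'', ''nt'', ''r''} \<Longrightarrow> s1 a = s a" and i: "s1 ''i'' 0 = int i" "i < ?N"
      and wz: "written s1 (c + 1) zs" for s1 zs i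
  proof (rule run_For[where I = "\<lambda>k s'. written s' (c + 1) (zs @ ?row i k)"])
    show "written (upd s1 ''j'' 0 0) (c + 1) (zs @ ?row i 0)" using wz by simp
    fix k s' assume fr: "\<And>a. a \<notin> insert ''j'' (writes emit_prog) \<Longrightarrow> s' a = s1 a"
    show "aval (V ''nt'') s' = int ?N" using fr fr1 nt by simp
    assume k: "k < ?N" "s' ''j'' 0 = int k" and I: "written s' (c + 1) (zs @ ?row i k)"
    have fr': "s' ''in'' = s ''in''" "s' ''tp'' = s ''tp''" "s' ''np'' = s ''np''" "s' ''r'' = s ''r''" "s' ''i'' 0 = int i"
      using fr fr1 i by simp_all
    have E: "run emit_prog s' (\<lambda>n s''. n \<le> 4 * card P + 10 \<and>
      written s'' (c + 1) ((zs @ ?row i k) @ enc_constr P (cmp (s' ''r'' (s' ''i'' 0)) (s' ''r'' (s' ''j'' 0)), tdiff (Ts ! i) (Ts ! k))))"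
      by (rule run_emit[OF P(1) _ _ _ I]) (use P k t i in \<open>simp_all add: fr'\<close>)
    show "run emit_prog s' (\<lambda>n s''. n \<le> 4 * card P + 10 \<and> s'' ''j'' 0 = int k \<and>
      written (upd s'' ''j'' 0 (int (Suc k))) (c + 1) (zs @ ?row i (Suc k)))"
      by (rule run_call[OF E]) (use k i r in \<open>simp add: fr'\<close>)
  qed
  have I: "run (For ''i'' (V ''nt'') (For ''j'' (V ''nt'') emit_prog)) ?s1
    (\<lambda>n s'. n \<le> ?N * ((?N * (4 * card P + 12) + 2) + 2) + 2 \<and> written s' (c + 1) (?y1 @ ?rows ?N) \<and> s' ''i'' 0 = int ?N \<and>
      (\<forall>a. a \<notin> insert ''i'' (writes (For ''j'' (V ''nt'') emit_prog)) \<longrightarrow> s' a = ?s1 a))"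
  proof (rule run_For[where I = "\<lambda>k s'. written s' (c + 1) (?y1 @ ?rows k)"])
    show "written (upd ?s1 ''i'' 0 0) (c + 1) (?y1 @ ?rows 0)" using w1 by simp
    fix k s' assume fr: "\<And>a. a \<notin> insert ''i'' (writes (For ''j'' (V ''nt'') emit_prog)) \<Longrightarrow> s' a = ?s1 a"
    show "aval (V ''nt'') s' = int ?N" using fr nt by simp
    assume k: "k < ?N" "s' ''i'' 0 = int k" and wk: "written s' (c + 1) (?y1 @ ?rows k)"
    have fr1: "s' a = s a" if "a \<in> {''in'', ''tp'', ''np'', ''nt'', ''r''}" for a
      using that by (elim insertE emptyE; simp add: fr)
    show "run (For ''j'' (V ''nt'') emit_prog) s' (\<lambda>n s''. n \<le> ?N * (4 * card P + 12) + 2 \<and> s'' ''i'' 0 = int k \<and>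
      written (upd s'' ''i'' 0 (int (Suc k))) (c + 1) (?y1 @ ?rows (Suc k)))"
      by (rule run_conseq[OF J[OF fr1 k(2,1) wk]]) (use k in \<open>simp_all add: add_ac\<close>)
  qed
  have enc: "?y1 @ ?rows ?N = ys @ enc_list (enc_constr P) (order_conj R Ts)"
    by (simp add: enc_list_def length_order_conj) (simp add: order_conj_def concat_map_concat comp_def)
  have H: "run (For ''i'' (V ''nt'') (For ''j'' (V ''nt'') emit_prog)) ?s1
    (\<lambda>n s'. 3 + n \<le> ?N * (?N * (4 * card P + 12) + 4) + 5 \<and> written s' (c + 1) (ys @ enc_list (enc_constr P) (order_conj R Ts)))"
    unfolding enc[symmetric]
  proof (rule run_conseq[OF I])
    fix n s' assume *: "n \<le> ?N * ((?N * (4 * card P + 12) + 2) + 2) + 2 \<and> written s' (c + 1) (?y1 @ ?rows ?N) \<and>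
      s' ''i'' 0 = int ?N \<and> (\<forall>a. a \<notin> insert ''i'' (writes (For ''j'' (V ''nt'') emit_prog)) \<longrightarrow> s' a = ?s1 a)"
    have "3 + n \<le> ?N * (?N * (4 * card P + 12) + 4) + 5" using conjunct1[OF *] by (simp add: algebra_simps)
    then show "3 + n \<le> ?N * (?N * (4 * card P + 12) + 4) + 5 \<and> written s' (c + 1) (?y1 @ ?rows ?N)"
      using * by blast
  qed
  have "s ''out'' 0 = c" "s ''o'' 0 \<noteq> 0" using w by (auto simp: written_def)
  then show ?thesis
    unfolding output_prog_def using H by (simp add: nt) (erule run_conseq, simp)
qed

lemma term_val_tdiff: "term_val P w (tdiff t u) = term_val P w t - term_val P w u"
  by (simp add: term_val_def tdiff_def sum_subtractf left_diff_distrib)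

lemma ball_order_conj:
  "(\<forall>c \<in> set (order_conj R Ts). Pr c) \<longleftrightarrow> (\<forall>t \<in> set Ts. \<forall>u \<in> set Ts. Pr (cmp (R t) (R u), tdiff t u))"
proof -
  let ?J = "{0..<length Ts}"
  have "set (order_conj R Ts) =
    (\<Union>i\<in>?J. (\<lambda>j. (cmp (R (Ts ! i)) (R (Ts ! j)), tdiff (Ts ! i) (Ts ! j))) ` ?J)"
    by (simp add: order_conj_def)
  then have "(\<forall>c \<in> set (order_conj R Ts). Pr c) \<longleftrightarrow>
    (\<forall>i \<in> ?J. \<forall>j \<in> ?J. Pr (cmp (R (Ts ! i)) (R (Ts ! j)), tdiff (Ts ! i) (Ts ! j)))"
    by (simp only: ball_UN ball_simps)
  then show ?thesis unfolding all_set_conv_all_nth[of Ts] by (simp add: Ball_def)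
qed

lemma order_conj_consistent:
  assumes "set Ts = terms A"
  shows "(\<forall>(r, t) \<in> set (order_conj R Ts). rel_holds r (term_val (params A) w t) 0) \<longleftrightarrow> consistent A w R"
proof -
  let ?v = "term_val (params A) w"
  have c: "rel_holds (cmp (R t) (R u)) (?v (tdiff t u)) 0 \<longleftrightarrow>
    (?v t < ?v u \<longleftrightarrow> R t < R u) \<and> (?v u < ?v t \<longleftrightarrow> R u < R t)" for t u
    by (auto simp: term_val_tdiff cmp_def)
  have "(\<forall>(r, t) \<in> set (order_conj R Ts). rel_holds r (?v t) 0) \<longleftrightarrow>
    (\<forall>t \<in> terms A. \<forall>u \<in> terms A. rel_holds (cmp (R t) (R u)) (?v (tdiff t u)) 0)"
    unfolding ball_order_conj assms by simp
  also have "\<dots> \<longleftrightarrow> consistent A w R" unfolding c consistent_def by blast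
  finally show ?thesis .
qed

lemma square_le_power2: "(m + 1)^2 \<le> 2 ^ (m + 2)" for m :: nat
proof (induction m)
  case (Suc m)
  show ?case
  proof (cases "m \<le> 1")
    case False
    then obtain k where "m = k + 2" using le_Suc_ex[of 2 m] by auto
    then have "(Suc m + 1)^2 \<le> 2 * (m + 1)^2" by (simp add: power2_eq_square)
    also have "\<dots> \<le> 2 * 2 ^ (m + 2)" using Suc.IH by simp
    finally show ?thesis by simp
  qed (auto simp: le_Suc_eq power2_eq_square)
qed simp

text \<open>Squaring both sides avoids half-integral exponents.\<close>

lemma power_self_le_power2: "(m + 1) ^ (m + 3) \<le> 16 * 2 ^ (m * (m + 1))" for m :: nat
proof (rule power2_le_imp_le)
  have e: "(m + 2) * (m + 3) \<le> 2 * (m * (m + 1)) + 8"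
  proof (cases m)
    case (Suc k)
    show ?thesis by (cases k) (simp_all add: Suc algebra_simps)
  qed simp
  have "((m + 1) ^ (m + 3))\<^sup>2 = ((m + 1)\<^sup>2) ^ (m + 3)" by (simp only: power_mult[symmetric] mult.commute)
  also have "\<dots> \<le> (2 ^ (m + 2)) ^ (m + 3)" using square_le_power2 by (rule power_mono) simp
  also have "\<dots> = 2 ^ ((m + 2) * (m + 3))" by (simp only: power_mult)
  also have "\<dots> \<le> 2 ^ (2 * (m * (m + 1)) + 8)" by (rule power_increasing[OF e]) simp
  also have "\<dots> = (16 * 2 ^ (m * (m + 1)))\<^sup>2"
    by (simp only: power_mult_distrib power_add power_mult[symmetric] mult.commute) simp
  finally show "((m + 1) ^ (m + 3))\<^sup>2 \<le> (16 * 2 ^ (m * (m + 1)))\<^sup>2" .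
qed simp

lemma total_time_arith:
  fixes m N p c nl ne a :: nat
  assumes N: "1 \<le> N" "N \<le> m + 1" and c: "c \<le> (nl + ne) * (5 * m)" and ne: "ne \<le> nl * a" and nl: "0 < nl"
  shows "(nl + ne) * (5 * m * (N * (4 * p + 11) + 13) + 14) + 19 +
     (N * (4 * p + 4 * N + 12) + 4) + (22 * (nl + ne + 1) + 15 * c + 7) +
     ((nl + 1 + ne) * 5 + 3) + (N * 3 + 2) + 2 + (N ^ N * (22 * (nl + ne + 1) + 15 * c + 7 +
     (ne + 1) * (2 * N * (2 * N)) * 41 + 18 + 1 + (N * (N * (4 * p + 12) + 4) + 5) + (3 * N + 4) + 1) + 1)
   \<le> 40000 * (a + 1) * (p + 1) * (nl * 2 ^ (m * (m + 1)))"
proof -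
  define M where "M = m + 1"
  define q where "q = p + 1"
  define g where "g = nl + ne + 1"
  define Y where "Y = q * (M * M)"
  define Z where "Z = g * Y"
  have pos: "1 \<le> M" "1 \<le> q" "1 \<le> g" by (simp_all add: M_def q_def g_def)
  have NM: "N \<le> M" using N by (simp add: M_def)
  have Mq: "M * q \<le> Y" using pos by (simp add: Y_def)
  have MM: "M * M \<le> Y" using pos by (simp add: Y_def)
  have MY: "M \<le> Y" using order_trans[OF _ Mq, of M] pos by simp
  have Y1: "1 \<le> Y" using MY pos by linarith
  have YZ: "Y \<le> Z" using pos by (simp add: Z_def)
  have gZ: "g \<le> Z" using Y1 by (simp add: Z_def)
  have Z1: "1 \<le> Z" using YZ Y1 by linarith
  have NN: "N * N \<le> Y" using mult_mono[OF NM NM] MM by simp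
  have Nq: "N * q \<le> Y" using order_trans[OF mult_right_mono[OF NM, of q] Mq] by simp
  have p4: "4 * p + 11 \<le> 11 * q" "4 * p + 12 \<le> 12 * q" by (simp_all add: q_def)
  have "5 * m * (N * (4 * p + 11) + 13) \<le> 5 * M * (M * (11 * q) + 13)"
    using NM p4 by (intro mult_mono add_mono) (simp_all add: M_def)
  also have "\<dots> = 55 * Y + 65 * M" by (simp add: Y_def algebra_simps)
  finally have "5 * m * (N * (4 * p + 11) + 13) + 14 \<le> 134 * Y" using MY Y1 by linarith
  then have "(nl + ne) * (5 * m * (N * (4 * p + 11) + 13) + 14) \<le> g * (134 * Y)"
    by (intro mult_mono) (simp_all add: g_def)
  then have t1: "(nl + ne) * (5 * m * (N * (4 * p + 11) + 13) + 14) \<le> 134 * Z"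
    by (simp add: Z_def mult.left_commute)
  have "N * (4 * p + 4 * N + 12) = N * (4 * p + 12) + 4 * (N * N)" by (simp add: algebra_simps)
  moreover have "N * (4 * p + 12) \<le> 12 * Y" using order_trans[OF mult_left_mono[OF p4(2), of N], of "12 * Y"] Nq by simp
  ultimately have t2: "N * (4 * p + 4 * N + 12) \<le> 16 * Z" using NN YZ by linarith
  have "(nl + ne) * (5 * m) \<le> g * (5 * Y)"
    using MY by (intro mult_mono) (simp_all add: g_def M_def)
  then have t3: "c \<le> 5 * Z" using c by (simp add: Z_def mult.left_commute)
  have g: "nl + ne + 1 = g" "nl + 1 + ne = g" by (simp_all add: g_def)
  have "N * (N * (4 * p + 12)) \<le> M * (M * (12 * q))" using NM p4 by (intro mult_mono) simp_all
  also have "\<dots> = 12 * Y" by (simp add: Y_def algebra_simps)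
  finally have t4: "N * (N * (4 * p + 12) + 4) \<le> 16 * Z"
    using NM MY YZ unfolding distrib_left by linarith
  have "(ne + 1) * (N * N) \<le> g * Y" using NN by (intro mult_mono) (simp_all add: g_def)
  then have t5: "(ne + 1) * (2 * N * (2 * N)) * 41 \<le> 164 * Z" unfolding Z_def by (simp add: algebra_simps)
  have NZ: "N \<le> Z" using NM MY YZ by linarith
  let ?r = "22 * g + 15 * c + 7 + (ne + 1) * (2 * N * (2 * N)) * 41 + 18 + 1 +
    (N * (N * (4 * p + 12) + 4) + 5) + (3 * N + 4) + 1"
  have r: "?r \<le> 316 * Z" using t3 t4 t5 gZ Z1 NZ by linarith
  have W: "N ^ N \<le> M ^ M" using power_mono[OF NM, of N] power_increasing[OF NM, of M] pos by linarith
  have "1 \<le> M ^ M" using pos by simp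
  then have ZW: "Z \<le> M ^ M * Z" by simp
  have rW: "N ^ N * ?r \<le> M ^ M * (316 * Z)" by (rule mult_mono[OF W r]) simp_all
  have "(nl + ne) * (5 * m * (N * (4 * p + 11) + 13) + 14) + 19 +
     (N * (4 * p + 4 * N + 12) + 4) + (22 * g + 15 * c + 7) + (g * 5 + 3) + (N * 3 + 2) + 2 + (N ^ N * ?r + 1)
    \<le> 700 * (M ^ M * Z)"
    using t1 t2 t3 gZ Z1 NZ rW ZW by linarith
  also have "M ^ M * Z = g * q * M ^ (m + 3)"
    by (simp add: Z_def Y_def M_def power_add power3_eq_cube algebra_simps del: One_nat_def)
  also have "g * q * M ^ (m + 3) \<le> (2 * nl * (a + 1)) * q * (16 * 2 ^ (m * (m + 1)))"
    using power_self_le_power2[of m] ne nl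
    by (intro mult_mono) (simp_all add: g_def M_def algebra_simps)
  finally show ?thesis unfolding g q_def by (simp add: algebra_simps del: power_add)
qed

lemma run_Seq_call:
  assumes "run c s P" "\<And>n s'. P n s' \<Longrightarrow> (\<And>a. a \<notin> writes c \<Longrightarrow> s' a = s a) \<Longrightarrow> run c' s' (\<lambda>m. Q (n + m))"
  shows "run (c ;; c') s Q"
  unfolding run_Seq using assms by (rule run_call)

definition round_prog :: com where
  "round_prog = intervals_prog ;; product_prog ;; If (Equal (V ''ok'') (Num 0)) Skip output_prog ;; next_prog"

definition pta_prog :: com where
  "pta_prog = parse_prog ;; rank_prog ;; intervals_prog ;; copy_prog ;;
     For ''i'' (V ''nt'') (Assign ''r'' (V ''i'') (Num 0)) ;;
     Set ''go'' (Num 1) ;; Set ''o'' (Num 1) ;;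
     While (Less (Num 0) (V ''go'')) round_prog"

lemma consistent_cong: "(\<And>t. t \<in> terms A \<Longrightarrow> R t = R' t) \<Longrightarrow> consistent A w R = consistent A w R'"
  unfolding consistent_def by simp

context pta_input
begin

abbreviation "same w \<equiv> Traces (inst w A) = Traces (inst v A)"
abbreviation "J' \<equiv> insert (int nl) I"

definition reference :: "state \<Rightarrow> nat \<Rightarrow> bool" where
  "reference s N \<longleftrightarrow> s ''b1'' 0 = 2 * rank_of v zero_term \<and>
    (\<forall>q \<in> J'. \<forall>m. s ''lo1'' q \<le> m \<and> m \<le> s ''hi1'' q \<longleftrightarrow> ifire (rank_of v) (2 * int N - 1) q m) \<and>
    (\<forall>l \<in> locs A. \<forall>m \<ge> 0. s ''ml1'' (li l) < m \<longleftrightarrow> stuck (s ''lo1'') (s ''hi1'') l m)"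

lemma reference_cong: "(\<And>a. a \<in> {''b1'', ''lo1'', ''hi1'', ''ml1''} \<Longrightarrow> s' a = s a) \<Longrightarrow> reference s' N = reference s N"
  unfolding reference_def by simp

lemma reference_abstraction:
  assumes "length Ts = card (terms A)" "reference s (length Ts)"
  shows "abstraction A I (int nl) ed v (s ''lo1'') (s ''hi1'') (2 * rank_of v zero_term)
    (region A v (rank_of v) (2 * int (length Ts) - 1))"
proof (rule abstraction_of_ranks[OF rank_of_consistent])
  show "2 * rank_of v t < 2 * int (length Ts) - 1" if "t \<in> terms A" for t
    using rank_of_range[OF that, of v] assms(1) by auto
qed (use assms(2) in \<open>auto simp: reference_def\<close>)

definition round_time :: "nat \<Rightarrow> nat \<Rightarrow> nat" where
  "round_time N c = 22 * (nl + length es + 1) + 15 * c + 7 + (length es + 1) * (2 * N * (2 * N)) * 41 + 18 + 1 +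
     (N * (N * (4 * card (params A) + 12) + 4) + 5) + (3 * N + 4)"

lemma run_decide:
  assumes par: "parsed s Ts Cs" and ref: "reference s (length Ts)"
    and R: "\<And>j. j < length Ts \<Longrightarrow> s ''r'' (int j) = R (Ts ! j)"
    and R0: "\<And>t. t \<in> terms A \<Longrightarrow> 0 \<le> R t \<and> R t < int (length Ts)"
    and mk: "\<And>m. s ''mk'' m \<le> s ''st'' 0"
  shows "run (intervals_prog ;; product_prog) s (\<lambda>n s'.
    n \<le> 22 * (nl + length es + 1) + 15 * length Cs + 7 + ((length es + 1) * (2 * length Ts * (2 * length Ts)) * 41 + 18) \<and>
    (\<forall>w. consistent A w R \<longrightarrow> (s' ''ok'' 0 \<noteq> 0 \<longleftrightarrow> same w)) \<and> (\<forall>m. s' ''mk'' m \<le> s' ''st'' 0))"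
  unfolding run_Seq
proof (rule run_call[OF run_intervals[of s Ts Cs R, OF par R R0]])
  let ?N = "length Ts" and ?b1 = "2 * rank_of v zero_term" and ?b2 = "2 * R zero_term"
  let ?M = "2 * int ?N - 1"
  note pf = parsed_facts[OF par]
  fix n1 s1
  assume A: "n1 \<le> 22 * (nl + length es + 1) + 15 * length Cs + 7 \<and> s1 ''b'' 0 = ?b2 \<and>
    (\<forall>q \<in> J'. \<forall>m. between s1 q m \<longleftrightarrow> ifire R ?M q m) \<and>
    (\<forall>l \<in> locs A. \<forall>m \<ge> 0. s1 ''ml'' (li l) < m \<longleftrightarrow> stuck (s1 ''lo'') (s1 ''hi'') l m)"
    and fr: "\<And>a. a \<notin> writes intervals_prog \<Longrightarrow> s1 a = s a"
  have zt: "zero_term \<in> terms A" by (simp add: terms_def)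
  have pr: "linked I (s ''sg'') (s ''nx'') (s ''fs'')" "s ''nx'' (int nl) = 0" "s ''nl'' 0 = int nl"
    "\<And>q. q \<in> I \<Longrightarrow> s ''sg'' q = li (lsrc q)"
    "\<And>q. q \<in> J' \<Longrightarrow> s ''tg'' q = li (ltgt q) \<and> s ''rs'' q = of_bool (rst q)"
    using par by (auto simp: parsed_def I_iff)
  have rg: "0 \<le> rank_of v t \<and> rank_of v t < int ?N" if "t \<in> terms A" for t
    using rank_of_range[OF that] pf(4) by simp
  have if1: "s ''lo1'' q \<le> m \<and> m \<le> s ''hi1'' q \<longleftrightarrow> ifire (rank_of v) ?M q m" if "q \<in> J'" for q m
    using ref that unfolding reference_def by blast
  have if2: "between s1 q m \<longleftrightarrow> ifire R ?M q m" if "q \<in> J'" for q m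
    using A that by blast
  interpret P: product A v G es "s ''lo1''" "s ''hi1''" "s ''ml1''" "s1 ''lo''" "s1 ''hi''" "s1 ''ml''"
    "s ''sg''" "s ''nx''" "s ''fs''" ?b1 ?b2 "2 * int ?N"
  proof
    show "0 \<le> ?b1" "?b1 < 2 * int ?N" using rg[OF zt] by auto
    show "0 \<le> ?b2" "?b2 < 2 * int ?N" using R0[OF zt] by auto
    show "0 \<le> m \<and> m < 2 * int ?N" if "q \<in> J'" "s ''lo1'' q \<le> m" "m \<le> s ''hi1'' q" for q m
      using if1[OF that(1), of m] that rg[OF zt] by (auto simp: ifire_def)
    show "0 \<le> m \<and> m < 2 * int ?N" if "q \<in> J'" "s1 ''lo'' q \<le> m" "m \<le> s1 ''hi'' q" for q m
      using if2[OF that(1), of m] that R0[OF zt] by (auto simp: ifire_def)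
    show "s ''ml1'' (li l) < m \<longleftrightarrow> stuck (s ''lo1'') (s ''hi1'') l m" if "l \<in> locs A" "0 \<le> m" for l m
      using ref that unfolding reference_def by blast
    show "s1 ''ml'' (li l) < m \<longleftrightarrow> stuck (s1 ''lo'') (s1 ''hi'') l m" if "l \<in> locs A" "0 \<le> m" for l m
      using A that by blast
  qed (use pr in blast)+
  have fx: "P.fixed s1"
    unfolding P.fixed_def using A ref pr pf(1) by (simp add: fr reference_def)
  have mk1: "s1 ''mk'' m \<le> s1 ''st'' 0" for m using mk by (simp add: fr)
  have ab2: "abstraction A I (int nl) ed w (s1 ''lo'') (s1 ''hi'') ?b2 (region A w R ?M)" if "consistent A w R" for w
  proof (rule abstraction_of_ranks[OF that])
    show "2 * R t < ?M" if "t \<in> terms A" for t using R0[OF that] by auto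
  qed (use if2 in auto)
  show "run product_prog s1 (\<lambda>n2 s'. n1 + n2 \<le> 22 * (nl + length es + 1) + 15 * length Cs + 7 + ((length es + 1) * (2 * ?N * (2 * ?N)) * 41 + 18) \<and>
    (\<forall>w. consistent A w R \<longrightarrow> (s' ''ok'' 0 \<noteq> 0 \<longleftrightarrow> same w)) \<and> (\<forall>m. s' ''mk'' m \<le> s' ''st'' 0))"
  proof (rule run_conseq[OF P.run_product[OF fx mk1]])
    fix n2 s'
    assume B: "n2 \<le> (length es + 1) * (nat (2 * int ?N) * nat (2 * int ?N)) * 41 + 18 \<and>
      (s' ''ok'' 0 \<noteq> 0 \<longleftrightarrow> (\<forall>q i j. P.rch q i j \<longrightarrow> P.agr q i j)) \<and> (\<forall>m. s' ''mk'' m \<le> s' ''st'' 0)"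
    have "nat (2 * int ?N) = 2 * ?N" by simp
    then have "n1 + n2 \<le> 22 * (nl + length es + 1) + 15 * length Cs + 7 + ((length es + 1) * (2 * ?N * (2 * ?N)) * 41 + 18)"
      using conjunct1[OF A] conjunct1[OF B] by (simp only:)
    moreover have "s' ''ok'' 0 \<noteq> 0 \<longleftrightarrow> same w" if "consistent A w R" for w
      using Traces_eq_iff[OF reference_abstraction[OF pf(4) ref] ab2[OF that]] B by metis
    ultimately show "n1 + n2 \<le> 22 * (nl + length es + 1) + 15 * length Cs + 7 + ((length es + 1) * (2 * ?N * (2 * ?N)) * 41 + 18) \<and>
      (\<forall>w. consistent A w R \<longrightarrow> (s' ''ok'' 0 \<noteq> 0 \<longleftrightarrow> same w)) \<and> (\<forall>m. s' ''mk'' m \<le> s' ''st'' 0)"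
      using B by blast
  qed
qed

abbreviation "enc_of Ts R \<equiv> enc_list (enc_constr (params A)) (order_conj R Ts)"

definition progress :: "state \<Rightarrow> lterm list \<Rightarrow> (int \<times> rel \<times> lterm) list \<Rightarrow> int \<Rightarrow> bool" where
  "progress s Ts Cs Q \<longleftrightarrow> parsed s Ts Cs \<and> reference s (length Ts) \<and> (\<forall>m. s ''mk'' m \<le> s ''st'' 0) \<and>
    (\<exists>Rs. written s (int (length Rs)) (concat (map (enc_of Ts) Rs)) \<and>
      (\<forall>R \<in> set Rs. \<forall>w. consistent A w R \<longrightarrow> same w) \<and>
      (\<forall>R w. (\<forall>t \<in> terms A. 0 \<le> R t \<and> R t < int (length Ts)) \<longrightarrow>
         numeral_of (length Ts) (\<lambda>j. R (Ts ! j)) (length Ts) < Q \<longrightarrow> consistent A w R \<longrightarrow> same w \<longrightarrow>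
         (\<exists>R' \<in> set Rs. consistent A w R')))"

definition loop_inv :: "state \<Rightarrow> lterm list \<Rightarrow> (int \<times> rel \<times> lterm) list \<Rightarrow> bool" where
  "loop_inv s Ts Cs \<longleftrightarrow>
    s ''go'' 0 = 1 \<and> (\<forall>k < length Ts. 0 \<le> digits s k \<and> digits s k < int (length Ts)) \<and>
      progress s Ts Cs (numeral_of (length Ts) (digits s) (length Ts)) \<or>
    s ''go'' 0 = 0 \<and> progress s Ts Cs (int (length Ts) ^ length Ts)"

lemma run_round:
  assumes li: "loop_inv s Ts Cs" and go: "s ''go'' 0 = 1"
  defines "Q \<equiv> numeral_of (length Ts) (digits s) (length Ts)"
  shows "run round_prog s (\<lambda>n s'. n \<le> round_time (length Ts) (length Cs) \<and> loop_inv s' Ts Cs \<and>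
    (s' ''go'' 0 = 0 \<or> numeral_of (length Ts) (digits s') (length Ts) = Q + 1))"
proof -
  let ?N = "length Ts" and ?P = "params A"
  have dg: "\<And>k. k < ?N \<Longrightarrow> 0 \<le> digits s k \<and> digits s k < int ?N" and pg: "progress s Ts Cs Q"
    using li go by (auto simp: loop_inv_def Q_def)
  have par: "parsed s Ts Cs" and ref: "reference s ?N" and mk: "\<And>m. s ''mk'' m \<le> s ''st'' 0"
    using pg by (auto simp: progress_def)
  note pf = parsed_facts[OF par]
  obtain Rs where Rs: "written s (int (length Rs)) (concat (map (enc_of Ts) Rs))"
    "\<And>R w. R \<in> set Rs \<Longrightarrow> consistent A w R \<Longrightarrow> same w"
    "\<And>R w. (\<forall>t \<in> terms A. 0 \<le> R t \<and> R t < int ?N) \<Longrightarrow> numeral_of ?N (\<lambda>j. R (Ts ! j)) ?N < Q \<Longrightarrow>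
       consistent A w R \<Longrightarrow> same w \<Longrightarrow> \<exists>R' \<in> set Rs. consistent A w R'"
    using pg unfolding progress_def by blast
  define R where "R t = digits s (inv_into {..<?N} ((!) Ts) t)" for t
  have "inj_on ((!) Ts) {..<?N}" using pf(2) by (auto simp: inj_on_def nth_eq_iff_index_eq)
  then have R: "s ''r'' (int j) = R (Ts ! j)" if "j < ?N" for j using that by (simp add: R_def)
  have R0: "0 \<le> R t \<and> R t < int ?N" if t: "t \<in> terms A" for t
  proof -
    obtain j where "j < ?N" "Ts ! j = t" using t pf(3) by (metis in_set_conv_nth)
    then show ?thesis using dg[of j] R[of j] by simp
  qed
  have uniq: "consistent A w R' = consistent A w R"
    if "\<forall>t \<in> terms A. 0 \<le> R' t \<and> R' t < int ?N" "numeral_of ?N (\<lambda>j. R' (Ts ! j)) ?N = Q" for R' w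
  proof (rule consistent_cong)
    fix t assume "t \<in> terms A"
    then obtain j where j: "j < ?N" "Ts ! j = t" using pf(3) by (metis in_set_conv_nth)
    have "R' (Ts ! j) = digits s j"
      by (rule numeral_of_inj[OF _ dg that(2)[unfolded Q_def] j(1)]) (use that(1) pf(3) nth_mem in auto)
    then show "R' t = R t" using j R by simp
  qed
  let ?T1 = "22 * (nl + length es + 1) + 15 * length Cs + 7 + ((length es + 1) * (2 * ?N * (2 * ?N)) * 41 + 18)"
  let ?TO = "?N * (?N * (4 * card ?P + 12) + 4) + 5"
  let ?Z = "\<lambda>n s'. n \<le> round_time ?N (length Cs) \<and> loop_inv s' Ts Cs \<and>
    (s' ''go'' 0 = 0 \<or> numeral_of ?N (digits s') ?N = Q + 1)"
  have step: "run (If (Equal (V ''ok'') (Num 0)) Skip output_prog) s1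
      (\<lambda>n s'. n \<le> ?TO + 1 \<and> (\<exists>Rs'. written s' (int (length Rs')) (concat (map (enc_of Ts) Rs')) \<and>
        Rs' = (if s1 ''ok'' 0 = 0 then Rs else Rs @ [R])))"
    if fr: "\<And>a. a \<in> {''np'', ''nt'', ''in'', ''tp'', ''r'', ''out'', ''o''} \<Longrightarrow> s1 a = s a" for s1
  proof (cases "s1 ''ok'' 0 = 0")
    case True
    then show ?thesis using Rs(1) by (simp add: written_def fr)
  next
    case False
    have W: "written s1 (int (length Rs)) (concat (map (enc_of Ts) Rs))" using Rs(1) by (simp add: written_def fr)
    have "run output_prog s1 (\<lambda>n s'. n \<le> ?TO \<and>
      written s' (int (length Rs) + 1) (concat (map (enc_of Ts) Rs) @ enc_of Ts R))"
      by (rule run_output[OF params_finite _ _ _ _ W]) (use pf R in \<open>simp_all add: fr\<close>)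
    then have O: "run output_prog s1 (\<lambda>n s'. Suc n \<le> ?TO + 1 \<and> (\<exists>Rs'. written s' (int (length Rs')) (concat (map (enc_of Ts) Rs')) \<and>
        Rs' = (if s1 ''ok'' 0 = 0 then Rs else Rs @ [R])))"
      by (rule run_conseq) (simp add: False add.commute)
    have b: "\<not> bval (Equal (V ''ok'') (Num 0)) s1" using False by simp
    show ?thesis unfolding run_If if_not_P[OF b] by (rule O)
  qed
  have "run (intervals_prog ;; product_prog) s (\<lambda>n1 s1. run (If (Equal (V ''ok'') (Num 0)) Skip output_prog) s1
    (\<lambda>n2 s2. run next_prog s2 (\<lambda>n3. ?Z (n1 + (n2 + n3)))))"
  proof (rule run_call[OF run_decide[of s Ts Cs R, OF par ref R R0 mk]])
    fix n1 s1
    assume A: "n1 \<le> ?T1 \<and> (\<forall>w. consistent A w R \<longrightarrow> (s1 ''ok'' 0 \<noteq> 0 \<longleftrightarrow> same w)) \<and> (\<forall>m. s1 ''mk'' m \<le> s1 ''st'' 0)"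
      and fr1: "\<And>a. a \<notin> writes (intervals_prog ;; product_prog) \<Longrightarrow> s1 a = s a"
    have fr1': "s1 a = s a" if "a \<in> {''np'', ''nt'', ''in'', ''tp'', ''r'', ''out'', ''o''}" for a
      using that by (elim insertE emptyE; simp add: fr1)
    show "run (If (Equal (V ''ok'') (Num 0)) Skip output_prog) s1 (\<lambda>n2 s2. run next_prog s2 (\<lambda>n3. ?Z (n1 + (n2 + n3))))"
    proof (rule run_call[OF step[OF fr1']])
      fix n2 s2
      assume B: "n2 \<le> ?TO + 1 \<and> (\<exists>Rs'. written s2 (int (length Rs')) (concat (map (enc_of Ts) Rs')) \<and>
        Rs' = (if s1 ''ok'' 0 = 0 then Rs else Rs @ [R]))"
        and fr2: "\<And>a. a \<notin> writes (If (Equal (V ''ok'') (Num 0)) Skip output_prog) \<Longrightarrow> s2 a = s1 a"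
      have r2: "s2 ''r'' = s ''r''" by (simp add: fr2 fr1)
      have dg': "0 \<le> digits s2 k \<and> digits s2 k < int ?N" if "k < ?N" for k using dg[OF that] by (simp add: r2)
      have dg2: "digits s2 = digits s" "s2 ''nt'' 0 = int ?N" "s2 ''go'' = s ''go''" using pf by (simp_all add: fr2 fr1)
      show "run next_prog s2 (\<lambda>n3. ?Z (n1 + (n2 + n3)))"
      proof (rule run_call[OF run_next[of s2 ?N, OF dg2(2) dg']])
        fix n3 s3
        assume C: "n3 \<le> 3 * ?N + 4 \<and>
          (if numeral_of ?N (digits s2) ?N + 1 < int ?N ^ ?N
           then s3 ''go'' 0 = s2 ''go'' 0 \<and> numeral_of ?N (digits s3) ?N = numeral_of ?N (digits s2) ?N + 1 \<and>
             (\<forall>k<?N. 0 \<le> digits s3 k \<and> digits s3 k < int ?N)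
           else s3 ''go'' 0 = 0)"
          and fr3: "\<And>a. a \<notin> writes next_prog \<Longrightarrow> s3 a = s2 a"
        have par3: "parsed s3 Ts Cs = parsed s Ts Cs"
          by (rule parsed_cong, elim insertE emptyE; simp add: fr3 fr2 fr1)
        have ref3: "reference s3 ?N = reference s ?N"
          by (rule reference_cong, elim insertE emptyE; simp add: fr3 fr2 fr1)
        have mk3: "\<forall>m. s3 ''mk'' m \<le> s3 ''st'' 0" using A by (simp add: fr3 fr2)
        define Rs' where "Rs' = (if s1 ''ok'' 0 = 0 then Rs else Rs @ [R])"
        have w3: "written s3 (int (length Rs')) (concat (map (enc_of Ts) Rs'))"
          using B unfolding Rs'_def by (simp add: written_def fr3)
        have ok: "s1 ''ok'' 0 \<noteq> 0 \<longleftrightarrow> same w" if "consistent A w R" for w using A that by blast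
        have sound: "same w" if "R' \<in> set Rs'" "consistent A w R'" for R' w
          using that Rs(2) ok unfolding Rs'_def by (auto split: if_splits)
        have complete: "\<exists>R'' \<in> set Rs'. consistent A w R''"
          if "\<forall>t \<in> terms A. 0 \<le> R' t \<and> R' t < int ?N" "numeral_of ?N (\<lambda>j. R' (Ts ! j)) ?N < Q + 1"
            "consistent A w R'" "same w" for R' w
        proof (cases "numeral_of ?N (\<lambda>j. R' (Ts ! j)) ?N = Q")
          case True
          then have "consistent A w R" using uniq[OF that(1) True] that(3) by simp
          then show ?thesis using ok that(4) unfolding Rs'_def by auto
        next
          case False
          then have "\<exists>R'' \<in> set Rs. consistent A w R''" using Rs(3)[OF that(1) _ that(3,4)] that(2) by simp
          then show ?thesis unfolding Rs'_def by auto
        qed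
        have pg3: "progress s3 Ts Cs (Q + 1)"
          unfolding progress_def using par par3 ref ref3 mk3 w3 sound complete by blast
        have Qb: "Q < int ?N ^ ?N" using numeral_of_bounds[of ?N "digits s" ?N] dg by (simp add: Q_def)
        have Q2: "numeral_of ?N (digits s2) ?N = Q" by (simp add: r2 Q_def)
        have "n1 + (n2 + n3) \<le> round_time ?N (length Cs)"
          using conjunct1[OF A] conjunct1[OF B] conjunct1[OF C] unfolding round_time_def by linarith
        moreover have "loop_inv s3 Ts Cs \<and> (s3 ''go'' 0 = 0 \<or> numeral_of ?N (digits s3) ?N = Q + 1)"
        proof (cases "Q + 1 < int ?N ^ ?N")
          case True
          then have "s3 ''go'' 0 = 1 \<and> numeral_of ?N (digits s3) ?N = Q + 1 \<and> (\<forall>k<?N. 0 \<le> digits s3 k \<and> digits s3 k < int ?N)"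
            using C Q2 dg2(3) go by simp
          then show ?thesis using pg3 unfolding loop_inv_def by simp
        next
          case False
          then have "s3 ''go'' 0 = 0" "Q + 1 = int ?N ^ ?N" using C Q2 Qb by simp_all
          then show ?thesis using pg3 unfolding loop_inv_def by simp
        qed
        ultimately show "?Z (n1 + (n2 + n3)) s3" by blast
      qed
    qed
  qed
  from this[unfolded run_Seq add.assoc] show ?thesis
    unfolding round_prog_def run_Seq .
qed


lemma run_loop:
  assumes li: "loop_inv s Ts Cs" and par: "parsed s Ts Cs"
  shows "run (While (Less (Num 0) (V ''go'')) round_prog) s (\<lambda>n s'.
    n \<le> length Ts ^ length Ts * (round_time (length Ts) (length Cs) + 1) + 1 \<and>
    progress s' Ts Cs (int (length Ts) ^ length Ts))"
proof -
  let ?N = "length Ts"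
  let ?\<mu> = "\<lambda>s'. if s' ''go'' 0 = 0 then 0 else ?N ^ ?N - nat (numeral_of ?N (digits s') ?N)"
  have "run (While (Less (Num 0) (V ''go'')) round_prog) s (\<lambda>n s'.
    n \<le> ?\<mu> s * (round_time ?N (length Cs) + 1) + 1 \<and> loop_inv s' Ts Cs \<and> \<not> bval (Less (Num 0) (V ''go'')) s' \<and>
    (\<forall>a. a \<notin> writes round_prog \<longrightarrow> s' a = s a))"
  proof (rule run_While[where \<mu> = ?\<mu>])
    fix s' assume li': "loop_inv s' Ts Cs" and b: "bval (Less (Num 0) (V ''go'')) s'"
    have go: "s' ''go'' 0 = 1" using li' b by (auto simp: loop_inv_def)
    have dg: "\<And>k. k < ?N \<Longrightarrow> 0 \<le> digits s' k \<and> digits s' k < int ?N"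
      using li' go by (auto simp: loop_inv_def)
    define Q where "Q = numeral_of ?N (digits s') ?N"
    have Q: "0 \<le> Q" "Q < int (?N ^ ?N)" using numeral_of_bounds[of ?N "digits s'" ?N] dg by (simp_all add: Q_def)
    show "run round_prog s' (\<lambda>n s''. n \<le> round_time ?N (length Cs) \<and> loop_inv s'' Ts Cs \<and> ?\<mu> s'' < ?\<mu> s')"
    proof (rule run_conseq[OF run_round[OF li' go]])
      fix n s'' assume *: "n \<le> round_time ?N (length Cs) \<and> loop_inv s'' Ts Cs \<and>
        (s'' ''go'' 0 = 0 \<or> numeral_of ?N (digits s'') ?N = numeral_of ?N (digits s') ?N + 1)"
      have "?N ^ ?N - nat (Q + 1) < ?N ^ ?N - nat Q" "0 < ?N ^ ?N - nat Q" using Q by linarith+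
      then have "?\<mu> s'' < ?\<mu> s'" using * go unfolding Q_def by auto
      then show "n \<le> round_time ?N (length Cs) \<and> loop_inv s'' Ts Cs \<and> ?\<mu> s'' < ?\<mu> s'" using * by blast
    qed
  qed (rule li)
  then show ?thesis
  proof (rule run_conseq)
    fix n s'
    assume *: "n \<le> ?\<mu> s * (round_time ?N (length Cs) + 1) + 1 \<and> loop_inv s' Ts Cs \<and>
      \<not> bval (Less (Num 0) (V ''go'')) s' \<and> (\<forall>a. a \<notin> writes round_prog \<longrightarrow> s' a = s a)"
    have "?\<mu> s * (round_time ?N (length Cs) + 1) \<le> ?N ^ ?N * (round_time ?N (length Cs) + 1)"
      by (rule mult_le_mono1) simp
    moreover have "progress s' Ts Cs (int ?N ^ ?N)" using * by (auto simp: loop_inv_def)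
    ultimately show "n \<le> ?N ^ ?N * (round_time ?N (length Cs) + 1) + 1 \<and> progress s' Ts Cs (int ?N ^ ?N)"
      using * by linarith
  qed
qed

lemma progress_0:
  assumes "parsed s Ts Cs" "reference s (length Ts)" "\<And>m. s ''mk'' m \<le> s ''st'' 0" "written s 0 []"
  shows "progress s Ts Cs 0"
proof -
  have "\<not> numeral_of (length Ts) (\<lambda>j. R (Ts ! j)) (length Ts) < 0"
    if "\<forall>t \<in> terms A. 0 \<le> R t \<and> R t < int (length Ts)" for R
    using that parsed_facts(3)[OF assms(1)] nth_mem
      numeral_of_bounds[of "length Ts" "\<lambda>j. R (Ts ! j)" "length Ts"] by (metis linorder_not_less)
  then show ?thesis
    unfolding progress_def using assms by (intro conjI exI[of _ "[]"]) auto
qed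

definition total_time :: "nat \<Rightarrow> nat \<Rightarrow> nat" where
  "total_time N c =
     (nl + length es) * (5 * card (LT A) * (N * (4 * card (params A) + 11) + 13) + 14) + 19 +
     (N * (4 * card (params A) + 4 * N + 12) + 4) + (22 * (nl + length es + 1) + 15 * c + 7) +
     ((nl + 1 + length es) * 5 + 3) + (N * 3 + 2) + 2 + (N ^ N * (round_time N c + 1) + 1)"

lemma sum_steps_le:
  fixes x :: nat
  shows "n1 \<le> a \<Longrightarrow> n2 \<le> b \<Longrightarrow> n3 \<le> c \<Longrightarrow> n4 \<le> d \<Longrightarrow> n5 \<le> x * (1 + 2) + 2 \<Longrightarrow> m \<le> e \<Longrightarrow>
    n1 + (n2 + (n3 + (n4 + (n5 + (1 + (1 + m)))))) \<le> a + b + c + d + (x * 3 + 2) + 2 + e"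
  by simp

lemma run_pta:
  "run pta_prog (input_state xs) (\<lambda>n s. \<exists>Ts Cs. n \<le> total_time (length Ts) (length Cs) \<and>
    progress s Ts Cs (int (length Ts) ^ length Ts))"
  unfolding pta_prog_def
proof (rule run_Seq_call[OF run_parse])
  let ?P = "params A" and ?Z = "\<lambda>n s. \<exists>Ts Cs. n \<le> total_time (length Ts) (length Cs) \<and>
    progress s Ts Cs (int (length Ts) ^ length Ts)"
  let ?c1 = "Assign ''r'' (V ''i'') (Num 0)"
  let ?l = "While (Less (Num 0) (V ''go'')) round_prog"
  fix n1 s1
  assume A1: "n1 \<le> (nl + length es) * (5 * card (LT A) * (card (terms A) * (4 * card ?P + 11) + 13) + 14) + 19 \<and>
     (\<exists>Ts Cs. parsed s1 Ts Cs) \<and> seg (s1 ''in'') (s1 ''p'' 0) (enc_valuation ?P v) \<and> s1 ''in'' = input_state xs ''in''"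
    and fr1: "\<And>a. a \<notin> writes parse_prog \<Longrightarrow> s1 a = input_state xs a"
  obtain Ts Cs where par1: "parsed s1 Ts Cs" using A1 by blast
  let ?N = "length Ts" and ?c = "length Cs"
  have N: "card (terms A) = ?N" using parsed_facts(4)[OF par1] by simp
  have sv: "seg (s1 ''in'') (s1 ''p'' 0) (enc_valuation ?P v)" using A1 by blast
  have z1: "s1 ''mk'' = (\<lambda>_. 0)" "s1 ''st'' = (\<lambda>_. 0)" "s1 ''out'' = (\<lambda>_. 0)"
    by (simp_all add: fr1 parse_prog_def input_state_other)
  show "run (rank_prog ;; intervals_prog ;; copy_prog ;; For ''i'' (V ''nt'') ?c1 ;; Set ''go'' (Num 1) ;; Set ''o'' (Num 1) ;; ?l) s1
    (\<lambda>m. ?Z (n1 + m))"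
  proof (rule run_Seq_call[OF run_rank[OF par1 sv]])
    fix n2 s2
    assume A2: "n2 \<le> ?N * (4 * card ?P + 4 * ?N + 12) + 4 \<and> (\<forall>j<?N. s2 ''r'' (int j) = rank_of v (Ts ! j))"
      and fr2: "\<And>a. a \<notin> writes rank_prog \<Longrightarrow> s2 a = s1 a"
    have "parsed s2 Ts Cs = parsed s1 Ts Cs" by (rule parsed_cong, elim insertE emptyE; simp add: fr2)
    then have par2: "parsed s2 Ts Cs" using par1 by blast
    have r2: "s2 ''r'' (int j) = rank_of v (Ts ! j)" if "j < ?N" for j using A2 that by blast
    have rg: "0 \<le> rank_of v t \<and> rank_of v t < int ?N" if "t \<in> terms A" for t using rank_of_range[OF that] N by simp
    show "run (intervals_prog ;; copy_prog ;; For ''i'' (V ''nt'') ?c1 ;; Set ''go'' (Num 1) ;; Set ''o'' (Num 1) ;; ?l) s2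
      (\<lambda>m. ?Z (n1 + (n2 + m)))"
    proof (rule run_Seq_call[OF run_intervals[of s2 Ts Cs "rank_of v", OF par2 r2 rg]])
      fix n3 s3
      assume A3: "n3 \<le> 22 * (nl + length es + 1) + 15 * ?c + 7 \<and> s3 ''b'' 0 = 2 * rank_of v zero_term \<and>
        (\<forall>q \<in> J'. \<forall>m. between s3 q m \<longleftrightarrow> ifire (rank_of v) (2 * int ?N - 1) q m) \<and>
        (\<forall>l \<in> locs A. \<forall>m \<ge> 0. s3 ''ml'' (li l) < m \<longleftrightarrow> stuck (s3 ''lo'') (s3 ''hi'') l m)"
        and fr3: "\<And>a. a \<notin> writes intervals_prog \<Longrightarrow> s3 a = s2 a"
      have ng: "s3 ''ng'' 0 = int (nl + 1 + length es)" using par2 by (simp add: fr3 parsed_def ix_def)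
      show "run (copy_prog ;; For ''i'' (V ''nt'') ?c1 ;; Set ''go'' (Num 1) ;; Set ''o'' (Num 1) ;; ?l) s3
        (\<lambda>m. ?Z (n1 + (n2 + (n3 + m))))"
      proof (rule run_Seq_call[OF run_copy[of s3 "nl + 1 + length es", OF ng]])
        fix n4 s4
        assume A4: "n4 \<le> (nl + 1 + length es) * 5 + 3 \<and> s4 ''b1'' 0 = s3 ''b'' 0 \<and>
          (\<forall>g. 0 \<le> g \<and> g < int (nl + 1 + length es) \<longrightarrow> s4 ''lo1'' g = s3 ''lo'' g \<and> s4 ''hi1'' g = s3 ''hi'' g \<and> s4 ''ml1'' g = s3 ''ml'' g)"
          and fr4: "\<And>a. a \<notin> writes copy_prog \<Longrightarrow> s4 a = s3 a"
        have "parsed s4 Ts Cs = parsed s2 Ts Cs" by (rule parsed_cong, elim insertE emptyE; simp add: fr4 fr3)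
        then have par4: "parsed s4 Ts Cs" using par2 by blast
        have cp: "s4 ''lo1'' g = s3 ''lo'' g" "s4 ''hi1'' g = s3 ''hi'' g" "s4 ''ml1'' g = s3 ''ml'' g"
          if "0 \<le> g" "g < int (nl + 1 + length es)" for g using A4 that by blast+
        have J: "0 \<le> q" "q < int (nl + 1 + length es)" if "q \<in> J'" for q using that by (auto simp: I_iff ix_def)
        have ref4: "reference s4 ?N"
          unfolding reference_def
        proof (intro conjI ballI allI impI)
          show "s4 ''b1'' 0 = 2 * rank_of v zero_term" using A3 A4 by simp
          show "s4 ''lo1'' q \<le> m \<and> m \<le> s4 ''hi1'' q \<longleftrightarrow> ifire (rank_of v) (2 * int ?N - 1) q m" if "q \<in> J'" for q m
          proof -
            have "between s3 q m \<longleftrightarrow> ifire (rank_of v) (2 * int ?N - 1) q m" using A3 that by blast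
            then show ?thesis by (simp add: cp[OF J[OF that]])
          qed
          fix l m assume l: "l \<in> locs A" "(0::int) \<le> m"
          have lr: "0 \<le> li l" "li l < int (nl + 1 + length es)" using li_range[OF l(1)] by auto
          have "stuck (s4 ''lo1'') (s4 ''hi1'') l m = stuck (s3 ''lo'') (s3 ''hi'') l m"
            unfolding stuck_def using cp J by (intro ball_cong refl) simp
          moreover have "s3 ''ml'' (li l) < m \<longleftrightarrow> stuck (s3 ''lo'') (s3 ''hi'') l m" using A3 l by blast
          ultimately show "s4 ''ml1'' (li l) < m \<longleftrightarrow> stuck (s4 ''lo1'') (s4 ''hi1'') l m"
            using cp(3)[OF lr] by simp
        qed
        have nt4: "s4 ''nt'' 0 = int ?N" by (rule parsed_facts(1)[OF par4])
        let ?I = "\<lambda>k s'. \<forall>j<k. digits s' j = 0"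
        have Z: "run (For ''i'' (V ''nt'') ?c1) s4 (\<lambda>n s'. n \<le> ?N * (1 + 2) + 2 \<and> ?I ?N s' \<and> s' ''i'' 0 = int ?N \<and>
          (\<forall>a. a \<notin> insert ''i'' (writes ?c1) \<longrightarrow> s' a = s4 a))"
        proof (rule run_For)
          show "?I 0 (upd s4 ''i'' 0 0)" by simp
          fix k s' assume fr: "\<And>a. a \<notin> insert ''i'' (writes ?c1) \<Longrightarrow> s' a = s4 a"
          show "aval (V ''nt'') s' = int ?N" using nt4 by (simp add: fr)
          assume "k < ?N" "s' ''i'' 0 = int k" "?I k s'"
          then show "run ?c1 s' (\<lambda>n s''. n \<le> 1 \<and> s'' ''i'' 0 = int k \<and> ?I (Suc k) (upd s'' ''i'' 0 (int (Suc k))))"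
            by simp
        qed
        show "run (For ''i'' (V ''nt'') ?c1 ;; Set ''go'' (Num 1) ;; Set ''o'' (Num 1) ;; ?l) s4
          (\<lambda>m. ?Z (n1 + (n2 + (n3 + (n4 + m)))))"
        proof (rule run_Seq_call[OF Z])
          fix n5 s5
          assume A5: "n5 \<le> ?N * (1 + 2) + 2 \<and> ?I ?N s5 \<and> s5 ''i'' 0 = int ?N \<and>
            (\<forall>a. a \<notin> insert ''i'' (writes ?c1) \<longrightarrow> s5 a = s4 a)"
            and fr5: "\<And>a. a \<notin> writes (For ''i'' (V ''nt'') ?c1) \<Longrightarrow> s5 a = s4 a"
          let ?s6 = "upd (upd s5 ''go'' 0 1) ''o'' 0 1"
          have "parsed ?s6 Ts Cs = parsed s4 Ts Cs" by (rule parsed_cong, elim insertE emptyE; simp add: fr5)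
          then have par6: "parsed ?s6 Ts Cs" using par4 by blast
          have "reference ?s6 ?N = reference s4 ?N" by (rule reference_cong, elim insertE emptyE; simp add: fr5)
          then have ref6: "reference ?s6 ?N" using ref4 by blast
          have z6: "?s6 ''mk'' m = 0" "?s6 ''st'' 0 = 0" "?s6 ''out'' 0 = 0" for m
            by (simp_all add: fr5 fr4 fr3 fr2 z1)
          have "progress ?s6 Ts Cs 0"
            by (rule progress_0[OF par6 ref6]) (use z6 in \<open>simp_all add: written_def\<close>)
          moreover have d6: "digits ?s6 k = 0" if "k < ?N" for k using A5 that by simp
          moreover have "numeral_of ?N (digits ?s6) ?N = 0" unfolding numeral_of_def by (rule sum.neutral) (use d6 in simp)
          ultimately have li6: "loop_inv ?s6 Ts Cs"
            unfolding loop_inv_def using parsed_facts(6)[OF par6] by simp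
          have "run ?l ?s6 (\<lambda>m. ?Z (n1 + (n2 + (n3 + (n4 + (n5 + (1 + (1 + m))))))))"
          proof (rule run_conseq[OF run_loop[OF li6 par6]])
            fix m s'
            assume A6: "m \<le> ?N ^ ?N * (round_time ?N ?c + 1) + 1 \<and> progress s' Ts Cs (int ?N ^ ?N)"
            have "n1 + (n2 + (n3 + (n4 + (n5 + (1 + (1 + m)))))) \<le> total_time ?N ?c"
              using conjunct1[OF A1] conjunct1[OF A2] conjunct1[OF A3] conjunct1[OF A4] conjunct1[OF A5] conjunct1[OF A6]
              unfolding total_time_def N by (rule sum_steps_le)
            then show "?Z (n1 + (n2 + (n3 + (n4 + (n5 + (1 + (1 + m))))))) s'" using A6 by blast
          qed
          then show "run (Set ''go'' (Num 1) ;; Set ''o'' (Num 1) ;; ?l) s5 (\<lambda>m. ?Z (n1 + (n2 + (n3 + (n4 + (n5 + m))))))"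
            unfolding run_Seq run_Assign aval.simps .
        qed
      qed
    qed
  qed
qed

lemma run_pta_correct:
  "run pta_prog (input_state xs) (\<lambda>n s. \<exists>F N c. n \<le> total_time N c \<and> N = card (terms A) \<and>
    c \<le> (nl + length es) * (5 * card (LT A)) \<and> formula_over (params A) F \<and>
    outputs s (enc_formula (params A) F) \<and> solutions (params A) F = {w \<in> valuations (params A). same w})"
proof (rule run_conseq[OF run_pta])
  fix n s
  assume "\<exists>Ts Cs. n \<le> total_time (length Ts) (length Cs) \<and> progress s Ts Cs (int (length Ts) ^ length Ts)"
  then obtain Ts Cs where n: "n \<le> total_time (length Ts) (length Cs)" and pg: "progress s Ts Cs (int (length Ts) ^ length Ts)"
    by blast
  let ?P = "params A" and ?N = "length Ts"
  have par: "parsed s Ts Cs" using pg by (simp add: progress_def)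
  note pf = parsed_facts[OF par]
  obtain Rs where Rs: "written s (int (length Rs)) (concat (map (enc_of Ts) Rs))"
    "\<And>R w. R \<in> set Rs \<Longrightarrow> consistent A w R \<Longrightarrow> same w"
    "\<And>R w. (\<forall>t \<in> terms A. 0 \<le> R t \<and> R t < int ?N) \<Longrightarrow> numeral_of ?N (\<lambda>j. R (Ts ! j)) ?N < int ?N ^ ?N \<Longrightarrow>
       consistent A w R \<Longrightarrow> same w \<Longrightarrow> \<exists>R' \<in> set Rs. consistent A w R'"
    using pg unfolding progress_def by blast
  define F where "F = map (\<lambda>R. order_conj R Ts) Rs"
  have over: "term_over ?P t" if "t \<in> set Ts" for t using par that by (simp add: parsed_def table_def)
  have "formula_over ?P F"
  proof -
    have "\<forall>c \<in> set (order_conj R Ts). term_over ?P (snd c)" for R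
      unfolding ball_order_conj using over by (auto simp: term_over_def tdiff_def)
    then show ?thesis unfolding formula_over_def F_def by fastforce
  qed
  moreover have "outputs s (enc_formula ?P F)"
  proof -
    have "enc_formula ?P F = int (length Rs) # concat (map (enc_of Ts) Rs)"
      by (simp add: enc_formula_def F_def enc_list_def comp_def)
    moreover have "seg (s ''out'') 0 (int (length Rs) # concat (map (enc_of Ts) Rs))"
      using Rs(1) by (simp add: written_def)
    ultimately show ?thesis unfolding outputs_def seg_def by simp
  qed
  moreover have "(\<exists>C \<in> set F. \<forall>(r, t) \<in> set C. rel_holds r (term_val ?P w t) 0) \<longleftrightarrow> same w" for w
  proof -
    have "(\<exists>C \<in> set F. \<forall>(r, t) \<in> set C. rel_holds r (term_val ?P w t) 0) \<longleftrightarrow> (\<exists>R \<in> set Rs. consistent A w R)"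
      unfolding F_def using order_conj_consistent[OF pf(3)] by simp
    also have "\<dots> \<longleftrightarrow> same w"
    proof
      assume "same w"
      moreover have rg: "0 \<le> rank_of w t \<and> rank_of w t < int ?N" if "t \<in> terms A" for t
        using rank_of_range[OF that] pf(4) by simp
      moreover have "numeral_of ?N (\<lambda>j. rank_of w (Ts ! j)) ?N < int ?N ^ ?N"
        using numeral_of_bounds[of ?N "\<lambda>j. rank_of w (Ts ! j)" ?N] rg pf(3) nth_mem by blast
      ultimately show "\<exists>R \<in> set Rs. consistent A w R"
        using Rs(3)[of "rank_of w" w] rank_of_consistent by blast
    qed (use Rs(2) in blast)
    finally show ?thesis .
  qed
  then have "solutions ?P F = {w \<in> valuations ?P. same w}" unfolding solutions_def by simp
  moreover have "length Cs \<le> (nl + length es) * (5 * card (LT A))" using par by (simp add: parsed_def)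
  ultimately show "\<exists>F N c. n \<le> total_time N c \<and> N = card (terms A) \<and>
    c \<le> (nl + length es) * (5 * card (LT A)) \<and> formula_over ?P F \<and>
    outputs s (enc_formula ?P F) \<and> solutions ?P F = {w \<in> valuations ?P. same w}"
    using n pf(4) by blast
qed

lemma length_es_le: "length es \<le> nl * card (actions A)"
proof -
  have "inj_on (\<lambda>e. (src e, act e)) (edges A)"
    using det unfolding deterministic_def inj_on_def by blast
  moreover have "(\<lambda>e. (src e, act e)) ` edges A \<subseteq> locs A \<times> actions A"
    using wf unfolding wf_pta_def by auto
  moreover have "finite (locs A \<times> actions A)" using wf unfolding wf_pta_def by simp
  ultimately have "card (edges A) \<le> card (locs A \<times> actions A)" by (rule card_inj_on_le)
  moreover have "length es = card (edges A)" using edges_set distinct_card[of es] by simp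
  ultimately show ?thesis by (simp add: nl_card card_cartesian_product)
qed

lemma total_time_le:
  assumes N: "N = card (terms A)" and c: "c \<le> (nl + length es) * (5 * card (LT A))"
  shows "total_time N c \<le> 40000 * (card (actions A) + 1) * (card (params A) + 1)
    * (card (locs A) * 2 ^ (card (LT A) * (card (LT A) + 1)))"
  unfolding total_time_def round_time_def nl_card[symmetric]
proof (rule total_time_arith[OF _ _ c length_es_le nl_pos])
  have "finite (LT A)" using wf by (rule finite_LT)
  then show "1 \<le> N" "N \<le> card (LT A) + 1" unfolding N terms_def by (auto simp: card_insert_if Suc_le_eq card_gt_0_iff)
qed

end

lemma encodes_pta_input:
  assumes "wf_pta A" "deterministic A" "v \<in> valuations (params A)" "encodes xs A v"
  shows "\<exists>G es. pta_input A v G es \<and> xs = pta_input.xs A v G es"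
  using assms(4) unfolding encodes_def
proof (elim exE conjE, goal_cases)
  case (1 G es)
  have i: "pta_input A v G es" unfolding pta_input_def using assms 1(1,2) by blast
  moreover have "xs = pta_input.xs A v G es"
    unfolding pta_input.xs_def[OF i] pta_input.ll_def[OF i] by (rule 1(3))
  ultimately show ?case by blast
qed

theorem theorem5p6:
  shows "\<exists>(prog :: com) (c :: nat). \<forall>(A :: pta) (v :: valuation) (xs :: int list).
    wf_pta A \<longrightarrow> deterministic A \<longrightarrow> v \<in> valuations (params A) \<longrightarrow> encodes xs A v \<longrightarrow>
    (\<exists>(F :: lformula) (n :: nat) (\<sigma> :: state).
       exec prog (input_state xs) n \<sigma> \<and>
       formula_over (params A) F \<and>
       outputs \<sigma> (enc_formula (params A) F) \<and>
       solutions (params A) F =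
         {v' \<in> valuations (params A). Traces (inst v' A) = Traces (inst v A)} \<and>
       n \<le> c * (card (actions A) + 1) * (card (params A) + 1)
             * (card (locs A) * 2 ^ (card (LT A) * (card (LT A) + 1))))"
proof (intro exI[of _ pta_prog] exI[of _ 40000] allI impI)
  fix A v xs
  assume "wf_pta A" "deterministic A" "v \<in> valuations (params A)" "encodes xs A v"
  then obtain G es where i: "pta_input A v G es" and xs: "xs = pta_input.xs A v G es"
    using encodes_pta_input by blast
  obtain n \<sigma> F N c where "exec pta_prog (input_state xs) n \<sigma>" "n \<le> pta_input.total_time A es N c"
    "N = card (terms A)" "c \<le> (pta_input.nl A + length es) * (5 * card (LT A))"
    "formula_over (params A) F" "outputs \<sigma> (enc_formula (params A) F)"
    "solutions (params A) F = {v' \<in> valuations (params A). Traces (inst v' A) = Traces (inst v A)}"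
    using pta_input.run_pta_correct[OF i] unfolding run_def xs by blast
  moreover note order_trans[OF this(2) pta_input.total_time_le[OF i this(3,4)]]
  ultimately show "\<exists>F n \<sigma>. exec pta_prog (input_state xs) n \<sigma> \<and> formula_over (params A) F \<and>
    outputs \<sigma> (enc_formula (params A) F) \<and>
    solutions (params A) F = {v' \<in> valuations (params A). Traces (inst v' A) = Traces (inst v A)} \<and>
    n \<le> 40000 * (card (actions A) + 1) * (card (params A) + 1)
          * (card (locs A) * 2 ^ (card (LT A) * (card (LT A) + 1)))"
    by blast
qed

end
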